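(* Let $n,d\ge1$, $p\ge 2d+1$, $\sigma>0$, and let $W\in\mathbb{R}^{nd\times nd}$ be a random symmetric matrix with $d\times d$ blocks, $W_{ji}=W_{ij}^{\top}$, $W_{ii}=0$, whose entries in the blocks $W_{ij}$, $i<j$, are i.i.d. standard Gaussian. Let $Z^{\top}=[I_d,\dots,I_d]$, $A=ZZ^{\top}+\sigma W$, and $f(S)=\langle A,SS^{\top}\rangle$ for $S\in\mathbb{R}^{nd\times p}$ with $d\times p$ blocks $S_i$ satisfying $S_iS_i^{\top}=I_d$. There is a small absolute constant $C_0>0$ such that if \[ \sigma\le C_0\sqrt{\frac{p-2d}{p+d}}\cdot\frac{n^{1/4}}{d^{3/4}}, \] then with high probability the optimization landscape of $f$ is benign: $f$ has only one local maximizer (up to $S\mapsto SU$, $U\in O(p)$), which is global, and for it $SS^{\top}$ is the maximizer of the SDP $\max\{\langle A,X\rangle:X\succeq0,X_{ii}=I_d\}$ and has rank $d$, corresponding to the maximizer of $\max_{R_i\in O(d)}\sum_{i,j}\langle R_iR_j^{\top},A_{ij}\rangle$.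
   Context: $\langle X,Y\rangle=\mathrm{Tr}(XY^{\top})$; $O(k)$ denotes the $k\times k$ orthogonal group. This is Gaussian-noise orthogonal group synchronization written in coordinates where the ground truth is $G_i=I_d$. *)

theory Defs
  imports "HOL-Probability.Probability" "Jordan_Normal_Form.DL_Rank"
begin

text \<open>Block conventions. An (nd x nd) matrix is stored in block form
  M i j a b = entry (a,b) of block (i,j), for i,j < n and a,b < d.
  An (nd x p) matrix S is stored as S i a k = entry (a,k) of block S_i, i < n, a < d, k < p.\<close>

definition kron :: "nat \<Rightarrow> nat \<Rightarrow> real" where
  "kron a b = (if a = b then 1 else 0)"

definition gidx :: "nat \<Rightarrow> nat \<Rightarrow> (nat \<times> nat \<times> nat \<times> nat) set" where
  "gidx n d = {(i, j, a, b). i < j \<and> j < n \<and> a < d \<and> b < d}"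

definition gauss_space :: "nat \<Rightarrow> nat \<Rightarrow> ((nat \<times> nat \<times> nat \<times> nat) \<Rightarrow> real) measure" where
  "gauss_space n d = PiM (gidx n d) (\<lambda>_. density lborel std_normal_density)"

definition noiseW :: "((nat \<times> nat \<times> nat \<times> nat) \<Rightarrow> real) \<Rightarrow> nat \<Rightarrow> nat \<Rightarrow> nat \<Rightarrow> nat \<Rightarrow> real" where
  "noiseW g i j a b =
     (if i < j then g (i, j, a, b) else if j < i then g (j, i, b, a) else 0)"

text \<open>A = Z Z^T + sigma W with Z^T = [I_d, ..., I_d]; every block of Z Z^T is I_d.\<close>
definition dataA :: "real \<Rightarrow> ((nat \<times> nat \<times> nat \<times> nat) \<Rightarrow> real) \<Rightarrow> nat \<Rightarrow> nat \<Rightarrow> nat \<Rightarrow> nat \<Rightarrow> real" where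
  "dataA \<sigma> g i j a b = kron a b + \<sigma> * noiseW g i j a b"

definition binner :: "nat \<Rightarrow> nat \<Rightarrow> (nat \<Rightarrow> nat \<Rightarrow> nat \<Rightarrow> nat \<Rightarrow> real)
    \<Rightarrow> (nat \<Rightarrow> nat \<Rightarrow> nat \<Rightarrow> nat \<Rightarrow> real) \<Rightarrow> real" where
  "binner n d A X = (\<Sum>i<n. \<Sum>j<n. \<Sum>a<d. \<Sum>b<d. A i j a b * X i j a b)"

definition gram :: "nat \<Rightarrow> (nat \<Rightarrow> nat \<Rightarrow> nat \<Rightarrow> real) \<Rightarrow> nat \<Rightarrow> nat \<Rightarrow> nat \<Rightarrow> nat \<Rightarrow> real" where
  "gram p S i j a b = (\<Sum>k<p. S i a k * S j b k)"

definition fobj :: "nat \<Rightarrow> nat \<Rightarrow> nat \<Rightarrow> (nat \<Rightarrow> nat \<Rightarrow> nat \<Rightarrow> nat \<Rightarrow> real)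
    \<Rightarrow> (nat \<Rightarrow> nat \<Rightarrow> nat \<Rightarrow> real) \<Rightarrow> real" where
  "fobj n d p A S = binner n d A (gram p S)"

definition stiefel :: "nat \<Rightarrow> nat \<Rightarrow> nat \<Rightarrow> (nat \<Rightarrow> nat \<Rightarrow> nat \<Rightarrow> real) set" where
  "stiefel n d p = {S. \<forall>i<n. \<forall>a<d. \<forall>b<d. (\<Sum>k<p. S i a k * S i b k) = kron a b}"

definition sdist :: "nat \<Rightarrow> nat \<Rightarrow> nat \<Rightarrow> (nat \<Rightarrow> nat \<Rightarrow> nat \<Rightarrow> real)
    \<Rightarrow> (nat \<Rightarrow> nat \<Rightarrow> nat \<Rightarrow> real) \<Rightarrow> real" where
  "sdist n d p S T = sqrt (\<Sum>i<n. \<Sum>a<d. \<Sum>k<p. (S i a k - T i a k)\<^sup>2)"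

definition local_max :: "nat \<Rightarrow> nat \<Rightarrow> nat \<Rightarrow> (nat \<Rightarrow> nat \<Rightarrow> nat \<Rightarrow> nat \<Rightarrow> real)
    \<Rightarrow> (nat \<Rightarrow> nat \<Rightarrow> nat \<Rightarrow> real) \<Rightarrow> bool" where
  "local_max n d p A S \<longleftrightarrow> S \<in> stiefel n d p \<and>
     (\<exists>\<delta>>0. \<forall>T \<in> stiefel n d p. sdist n d p S T < \<delta> \<longrightarrow> fobj n d p A T \<le> fobj n d p A S)"

definition global_max :: "nat \<Rightarrow> nat \<Rightarrow> nat \<Rightarrow> (nat \<Rightarrow> nat \<Rightarrow> nat \<Rightarrow> nat \<Rightarrow> real)
    \<Rightarrow> (nat \<Rightarrow> nat \<Rightarrow> nat \<Rightarrow> real) \<Rightarrow> bool" where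
  "global_max n d p A S \<longleftrightarrow> S \<in> stiefel n d p \<and>
     (\<forall>T \<in> stiefel n d p. fobj n d p A T \<le> fobj n d p A S)"

definition orth :: "nat \<Rightarrow> (nat \<Rightarrow> nat \<Rightarrow> real) \<Rightarrow> bool" where
  "orth p U \<longleftrightarrow> (\<forall>k<p. \<forall>m<p. (\<Sum>l<p. U l k * U l m) = kron k m)"

definition right_mult :: "nat \<Rightarrow> nat \<Rightarrow> nat \<Rightarrow> (nat \<Rightarrow> nat \<Rightarrow> nat \<Rightarrow> real)
    \<Rightarrow> (nat \<Rightarrow> nat \<Rightarrow> real) \<Rightarrow> (nat \<Rightarrow> nat \<Rightarrow> nat \<Rightarrow> real) \<Rightarrow> bool" where
  "right_mult n d p S U T \<longleftrightarrow> (\<forall>i<n. \<forall>a<d. \<forall>k<p. T i a k = (\<Sum>l<p. S i a l * U l k))"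

definition psd :: "nat \<Rightarrow> nat \<Rightarrow> (nat \<Rightarrow> nat \<Rightarrow> nat \<Rightarrow> nat \<Rightarrow> real) \<Rightarrow> bool" where
  "psd n d X \<longleftrightarrow> (\<forall>i<n. \<forall>j<n. \<forall>a<d. \<forall>b<d. X i j a b = X j i b a) \<and>
     (\<forall>x :: nat \<Rightarrow> nat \<Rightarrow> real.
        (\<Sum>i<n. \<Sum>j<n. \<Sum>a<d. \<Sum>b<d. x i a * X i j a b * x j b) \<ge> 0)"

definition sdp_feasible :: "nat \<Rightarrow> nat \<Rightarrow> (nat \<Rightarrow> nat \<Rightarrow> nat \<Rightarrow> nat \<Rightarrow> real) \<Rightarrow> bool" where
  "sdp_feasible n d X \<longleftrightarrow> psd n d X \<and> (\<forall>i<n. \<forall>a<d. \<forall>b<d. X i i a b = kron a b)"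

definition sdp_unique_max :: "nat \<Rightarrow> nat \<Rightarrow> (nat \<Rightarrow> nat \<Rightarrow> nat \<Rightarrow> nat \<Rightarrow> real)
    \<Rightarrow> (nat \<Rightarrow> nat \<Rightarrow> nat \<Rightarrow> nat \<Rightarrow> real) \<Rightarrow> bool" where
  "sdp_unique_max n d A X \<longleftrightarrow> sdp_feasible n d X \<and>
     (\<forall>Y. sdp_feasible n d Y \<longrightarrow> binner n d A Y \<le> binner n d A X) \<and>
     (\<forall>Y. sdp_feasible n d Y \<longrightarrow> binner n d A Y = binner n d A X \<longrightarrow>
          (\<forall>i<n. \<forall>j<n. \<forall>a<d. \<forall>b<d. Y i j a b = X i j a b))"

definition flat_mat :: "nat \<Rightarrow> nat \<Rightarrow> (nat \<Rightarrow> nat \<Rightarrow> nat \<Rightarrow> nat \<Rightarrow> real) \<Rightarrow> real mat" where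
  "flat_mat n d X = mat (n * d) (n * d) (\<lambda>(u, v). X (u div d) (v div d) (u mod d) (v mod d))"

definition brank :: "nat \<Rightarrow> nat \<Rightarrow> (nat \<Rightarrow> nat \<Rightarrow> nat \<Rightarrow> nat \<Rightarrow> real) \<Rightarrow> nat" where
  "brank n d X = vec_space.rank (n * d) (flat_mat n d X)"

definition orth_tuple :: "nat \<Rightarrow> nat \<Rightarrow> (nat \<Rightarrow> nat \<Rightarrow> nat \<Rightarrow> real) \<Rightarrow> bool" where
  "orth_tuple n d R \<longleftrightarrow> (\<forall>i<n. \<forall>a<d. \<forall>b<d. (\<Sum>c<d. R i a c * R i b c) = kron a b)"

definition gobj :: "nat \<Rightarrow> nat \<Rightarrow> (nat \<Rightarrow> nat \<Rightarrow> nat \<Rightarrow> nat \<Rightarrow> real)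
    \<Rightarrow> (nat \<Rightarrow> nat \<Rightarrow> nat \<Rightarrow> real) \<Rightarrow> real" where
  "gobj n d A R = binner n d A (gram d R)"

definition benign :: "nat \<Rightarrow> nat \<Rightarrow> nat \<Rightarrow> (nat \<Rightarrow> nat \<Rightarrow> nat \<Rightarrow> nat \<Rightarrow> real) \<Rightarrow> bool" where
  "benign n d p A \<longleftrightarrow>
     (\<exists>S. local_max n d p A S) \<and>
     (\<forall>S S'. local_max n d p A S \<longrightarrow> local_max n d p A S' \<longrightarrow>
         (\<exists>U. orth p U \<and> right_mult n d p S U S')) \<and>
     (\<forall>S. local_max n d p A S \<longrightarrow>
         global_max n d p A S \<and>
         sdp_unique_max n d A (gram p S) \<and>
         brank n d (gram p S) = d \<and>
         (\<exists>R. orth_tuple n d R \<and>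
              (\<forall>i<n. \<forall>j<n. \<forall>a<d. \<forall>b<d. gram p S i j a b = gram d R i j a b) \<and>
              (\<forall>R'. orth_tuple n d R' \<longrightarrow> gobj n d A R' \<le> gobj n d A R)))"

end

theory Submission
  imports Defs "Jordan_Normal_Form.DL_Rank_Submatrix" "HOL-Real_Asymp.Real_Asymp"
begin

text \<open>Write \<open>A = ZZ\<^sup>T + \<Delta>\<close>. At a local maximum \<open>S\<close> the first-order condition reads
  \<open>(AS)\<^sub>i = \<Lambda>\<^sub>i S\<^sub>i\<close> with \<open>\<Lambda>\<^sub>i\<close> symmetric. Second-order optimality along \<open>u w\<^sub>i\<^sup>T\<close>, where
  \<open>w\<^sub>i\<close> runs over the columns of \<open>I - S\<^sub>i\<^sup>T S\<^sub>i\<close>, gives \<open>\<Lambda>\<^sub>i \<ge> 0\<close> and, using \<open>p > 2d\<close>, that all singular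
  values of \<open>\<Sum>S\<^sub>i\<close> are at least \<open>n/2\<close>. Since \<open>S\<^sub>i\<close> is the polar factor of
  \<open>\<Sum>S\<^sub>j + (\<Delta>S)\<^sub>i\<close>, perturbation of polar factors bounds \<open>\<Sum>|S\<^sub>i - S\<^sub>j|\<^sup>2\<close> by a multiple of
  \<open>|\<Delta>|\<^sup>2 d / n\<close> for a suitable \<open>j\<close>, so every \<open>(\<Delta>S)\<^sub>i\<close> has norm at most \<open>n/8\<close> and
  \<open>\<Lambda>\<^sub>i \<ge> 3n/8 > |\<Delta>|\<close>. Hence \<open>\<Lambda> - A\<close> is positive semidefinite with kernel the column space of
  \<open>S\<close>, of dimension \<open>d\<close>: it is a dual certificate which also yields uniqueness. The Gaussian bounds on
  \<open>\<Delta>\<close> follow from a union bound over lattice points.\<close>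

section \<open>First- and second-order conditions at a local maximum\<close>

text \<open>The hard point is a bound on (\<Delta>S)_i that is uniform in i: S depends on the noise,
  so concentration does not apply to (\<Delta>S)_i itself, and |\<Delta>| controls these blocks well
  only on average. Replacing every S_j by one reference block splits (\<Delta>S)_i in two: the main
  part is a block row sum of \<Delta>, which does not involve S and is covered by concentration, and
  the remainder is a product of two quantities controlled by |\<Delta>|. The bound on the remainder
  is n/16 precisely under 16^4 |\<Delta>|^4 d \<le> n^3; for |\<Delta>| of order \<sigma> sqrt(nd)
  this is the threshold n^(1/4) / d^(3/4) for \<sigma>. The row sums are typically of order
  sqrt(nd), so there is room to bound them by n^(3/4) sqrt(d), which pays for the union over the n
  rows.

  With P_i = S_i^T S_i, the identity tr (I - P_i)(I - P_j) = p - 2d + |S_i S_j^T|^2 and the bound |S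
  S^T|^2 >= (nd)^2 / p average to (p - d)^2 / p. Compared with tr (I - P_i) = p - d, only the factor
  (p - d)/p >= 1/2 is lost, uniformly in p.\<close>

definition bform :: "nat \<Rightarrow> nat \<Rightarrow> nat \<Rightarrow> (nat \<Rightarrow> nat \<Rightarrow> nat \<Rightarrow> nat \<Rightarrow> real)
    \<Rightarrow> (nat \<Rightarrow> nat \<Rightarrow> nat \<Rightarrow> real) \<Rightarrow> (nat \<Rightarrow> nat \<Rightarrow> nat \<Rightarrow> real) \<Rightarrow> real" where
  "bform n d p A S T = (\<Sum>i<n. \<Sum>j<n. \<Sum>a<d. \<Sum>b<d. A i j a b * (\<Sum>k<p. S i a k * T j b k))"

definition amul :: "nat \<Rightarrow> nat \<Rightarrow> (nat \<Rightarrow> nat \<Rightarrow> nat \<Rightarrow> nat \<Rightarrow> real)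
    \<Rightarrow> (nat \<Rightarrow> nat \<Rightarrow> nat \<Rightarrow> real) \<Rightarrow> nat \<Rightarrow> nat \<Rightarrow> nat \<Rightarrow> real" where
  "amul n d A S i a k = (\<Sum>j<n. \<Sum>b<d. A i j a b * S j b k)"

definition bsym :: "nat \<Rightarrow> nat \<Rightarrow> (nat \<Rightarrow> nat \<Rightarrow> nat \<Rightarrow> nat \<Rightarrow> real) \<Rightarrow> bool" where
  "bsym n d A \<longleftrightarrow> (\<forall>i<n. \<forall>j<n. \<forall>a<d. \<forall>b<d. A i j a b = A j i b a)"

lemma fobj_eq_bform: "fobj n d p A S = bform n d p A S S"
  by (simp add: fobj_def binner_def gram_def bform_def)

lemma bform_amul: "bform n d p A V S = (\<Sum>i<n. \<Sum>a<d. \<Sum>k<p. V i a k * amul n d A S i a k)"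
proof -
  have "bform n d p A V S = (\<Sum>i<n. \<Sum>j<n. \<Sum>a<d. \<Sum>b<d. \<Sum>k<p. V i a k * (A i j a b * S j b k))"
    unfolding bform_def by (simp add: sum_distrib_left mult_ac)
  also have "\<dots> = (\<Sum>i<n. \<Sum>a<d. \<Sum>j<n. \<Sum>b<d. \<Sum>k<p. V i a k * (A i j a b * S j b k))"
    by (rule sum.cong[OF refl], rule sum.swap)
  also have "\<dots> = (\<Sum>i<n. \<Sum>a<d. \<Sum>j<n. \<Sum>k<p. \<Sum>b<d. V i a k * (A i j a b * S j b k))"
    by (intro sum.cong[OF refl] sum.swap)
  also have "\<dots> = (\<Sum>i<n. \<Sum>a<d. \<Sum>k<p. \<Sum>j<n. \<Sum>b<d. V i a k * (A i j a b * S j b k))"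
    by (intro sum.cong[OF refl] sum.swap)
  finally show ?thesis by (simp add: amul_def sum_distrib_left)
qed

lemma bform_sym:
  assumes "bsym n d A" shows "bform n d p A S T = bform n d p A T S"
proof -
  have "bform n d p A S T = (\<Sum>j<n. \<Sum>i<n. \<Sum>a<d. \<Sum>b<d. A i j a b * (\<Sum>k<p. S i a k * T j b k))"
    unfolding bform_def by (rule sum.swap)
  also have "\<dots> = (\<Sum>j<n. \<Sum>i<n. \<Sum>b<d. \<Sum>a<d. A i j a b * (\<Sum>k<p. S i a k * T j b k))"
    by (intro sum.cong[OF refl] sum.swap)
  also have "\<dots> = bform n d p A T S"
    unfolding bform_def using assms by (intro sum.cong[OF refl]) (simp add: bsym_def mult.commute)
  finally show ?thesis .
qed

lemma bform_add_left:
  "bform n d p A (\<lambda>i a k. S i a k + T i a k) X = bform n d p A S X + bform n d p A T X"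
  by (simp add: bform_amul sum.distrib algebra_simps)

lemma bform_scale_left:
  "bform n d p A (\<lambda>i a k. c * S i a k) X = c * bform n d p A S X"
  by (simp add: bform_amul sum_distrib_left mult.assoc)

lemma bform_add_right:
  "bform n d p A X (\<lambda>i a k. S i a k + T i a k) = bform n d p A X S + bform n d p A X T"
  by (simp add: bform_def sum.distrib algebra_simps)

lemma bform_scale_right:
  "bform n d p A X (\<lambda>i a k. c * S i a k) = c * bform n d p A X S"
  by (simp add: bform_def sum_distrib_left mult_ac)

lemmas bform_linear = bform_add_left bform_scale_left bform_add_right bform_scale_right

lemma bform_tendsto:
  assumes "\<And>i a k. i < n \<Longrightarrow> a < d \<Longrightarrow> k < p \<Longrightarrow> ((\<lambda>t. H t i a k) \<longlongrightarrow> H0 i a k) F"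
    and "\<And>i a k. i < n \<Longrightarrow> a < d \<Longrightarrow> k < p \<Longrightarrow> ((\<lambda>t. G t i a k) \<longlongrightarrow> G0 i a k) F"
  shows "((\<lambda>t. bform n d p A (H t) (G t)) \<longlongrightarrow> bform n d p A H0 G0) F"
  unfolding bform_def by (intro tendsto_intros assms) auto

text \<open>The objective is quadratic, so its increment along the curve can be divided by t, then
  by t^2, before t tends to 0. \<open>H\<close> may depend on t so that the curve can stay on the
  manifold exactly; only its limit enters the conclusion. One-sided t suffices, since the opposite
  sign is obtained from -V.\<close>

lemma local_max_curve:
  fixes H :: "real \<Rightarrow> nat \<Rightarrow> nat \<Rightarrow> nat \<Rightarrow> real"
  assumes lm: "local_max n d p A S" and sym: "bsym n d A"
    and st: "eventually (\<lambda>t. (\<lambda>i a k. S i a k + (t * V i a k + t\<^sup>2 * H t i a k)) \<in> stiefel n d p) (at_right 0)"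
    and lim: "\<And>i a k. i < n \<Longrightarrow> a < d \<Longrightarrow> k < p \<Longrightarrow> ((\<lambda>t. H t i a k) \<longlongrightarrow> H0 i a k) (at_right 0)"
  shows "bform n d p A V S \<le> 0"
    and "bform n d p A V S = 0 \<Longrightarrow> 2 * bform n d p A H0 S + bform n d p A V V \<le> 0"
proof -
  let ?F = "bform n d p A"
  let ?T = "\<lambda>t i a k. S i a k + (t * V i a k + t\<^sup>2 * H t i a k)"
  let ?r = "\<lambda>t. 2 * ?F (H t) S + ?F V V + t * (2 * ?F V (H t)) + t\<^sup>2 * ?F (H t) (H t)"
  have exp: "fobj n d p A (?T t) - fobj n d p A S = t * (2 * ?F V S) + t\<^sup>2 * ?r t" for t
  proof -
    have "?F S V = ?F V S" "?F S (H t) = ?F (H t) S" "?F (H t) V = ?F V (H t)"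
      by (auto intro: bform_sym[OF sym])
    then show ?thesis
      by (simp add: fobj_eq_bform bform_linear algebra_simps power2_eq_square)
  qed
  from lm obtain \<delta> where \<delta>: "\<delta> > 0" "\<And>T. T \<in> stiefel n d p \<Longrightarrow> sdist n d p S T < \<delta> \<Longrightarrow>
      fobj n d p A T \<le> fobj n d p A S" unfolding local_max_def by blast
  have tid: "((\<lambda>t::real. t) \<longlongrightarrow> 0) (at_right 0)" by (rule tendsto_ident_at)
  have "((\<lambda>t. sdist n d p S (?T t)) \<longlongrightarrow>
      sqrt (\<Sum>i<n. \<Sum>a<d. \<Sum>k<p. (S i a k - (S i a k + (0 * V i a k + 0\<^sup>2 * H0 i a k)))\<^sup>2)) (at_right 0)"
    unfolding sdist_def by (intro tendsto_intros lim tid) auto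
  then have "((\<lambda>t. sdist n d p S (?T t)) \<longlongrightarrow> 0) (at_right 0)" by simp
  then have "eventually (\<lambda>t. sdist n d p S (?T t) < \<delta>) (at_right 0)"
    using \<delta>(1) by (rule order_tendstoD)
  with st have ev: "eventually (\<lambda>t. t * (2 * ?F V S) + t\<^sup>2 * ?r t \<le> 0) (at_right 0)"
  proof eventually_elim
    case (elim t)
    then show ?case using \<delta>(2)[of "?T t"] exp[of t] by simp
  qed
  have pos: "eventually (\<lambda>t::real. t > 0) (at_right 0)" by (rule eventually_at_right_less)
  have rlim: "(?r \<longlongrightarrow> 2 * ?F H0 S + ?F V V + 0 * (2 * ?F V H0) + 0\<^sup>2 * ?F H0 H0) (at_right 0)"
    by (intro tendsto_intros bform_tendsto lim tid)
  have ev1: "eventually (\<lambda>t. 2 * ?F V S + t * ?r t \<le> 0) (at_right 0)"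
    using ev pos
  proof eventually_elim
    case (elim t)
    have "t * (2 * ?F V S + t * ?r t) \<le> 0"
      using elim(1) by (simp add: algebra_simps power2_eq_square)
    then show ?case using elim(2) by (simp add: mult_le_0_iff)
  qed
  have l1: "((\<lambda>t. 2 * ?F V S + t * ?r t) \<longlongrightarrow> 2 * ?F V S +
      0 * (2 * ?F H0 S + ?F V V + 0 * (2 * ?F V H0) + 0\<^sup>2 * ?F H0 H0)) (at_right 0)"
    by (intro tendsto_add tendsto_mult tendsto_const tid rlim)
  have "2 * ?F V S + 0 * (2 * ?F H0 S + ?F V V + 0 * (2 * ?F V H0) + 0\<^sup>2 * ?F H0 H0) \<le> 0"
    by (rule tendsto_upperbound[OF l1 ev1]) simp
  then show "?F V S \<le> 0" by simp
  assume z: "?F V S = 0"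
  have ev2: "eventually (\<lambda>t. ?r t \<le> 0) (at_right 0)"
    using ev pos
  proof eventually_elim
    case (elim t)
    have "t\<^sup>2 * ?r t \<le> 0" using elim(1) z by simp
    then show ?case using elim(2) by (simp add: mult_le_0_iff)
  qed
  have "2 * ?F H0 S + ?F V V + 0 * (2 * ?F V H0) + 0\<^sup>2 * ?F H0 H0 \<le> 0"
    by (rule tendsto_upperbound[OF rlim ev2]) simp
  then show "2 * ?F H0 S + ?F V V \<le> 0" by simp
qed

text \<open>Both test curves below rotate rows with a cosine of the form sqrt(1 - t^2 q); this is
  its second-order coefficient, found by rationalising the quotient.\<close>

lemma sqrt_quotient_limit: "((\<lambda>t::real. (sqrt (1 - t\<^sup>2 * q) - 1) / t\<^sup>2) \<longlongrightarrow> - q / 2) (at_right 0)"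
proof -
  have ev: "eventually (\<lambda>t::real. - q / (sqrt (1 - t\<^sup>2 * q) + 1) = (sqrt (1 - t\<^sup>2 * q) - 1) / t\<^sup>2) (at_right 0)"
  proof -
    have "((\<lambda>t::real. 1 - t\<^sup>2 * q) \<longlongrightarrow> 1 - 0\<^sup>2 * q) (at_right 0)"
      by (intro tendsto_intros)
    then have "eventually (\<lambda>t::real. 1 - t\<^sup>2 * q > 0) (at_right 0)"
      by (intro order_tendstoD(1)) auto
    moreover have "eventually (\<lambda>t::real. t > 0) (at_right 0)" by (rule eventually_at_right_less)
    ultimately show ?thesis
    proof eventually_elim
      case (elim t)
      define s where "s = sqrt (1 - t\<^sup>2 * q)"
      have s: "s\<^sup>2 = 1 - t\<^sup>2 * q" "s \<ge> 0" using elim(1) by (auto simp: s_def)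
      then have "(s - 1) * (s + 1) = - q * t\<^sup>2" by (simp add: algebra_simps power2_eq_square)
      moreover have "s + 1 \<noteq> 0" "t\<^sup>2 \<noteq> 0" using s elim(2) by auto
      ultimately have "- q / (s + 1) = (s - 1) / t\<^sup>2" by (metis frac_eq_eq)
      then show ?case by (simp add: s_def)
    qed
  qed
  have "((\<lambda>t::real. - q / (sqrt (1 - t\<^sup>2 * q) + 1)) \<longlongrightarrow> - q / (sqrt (1 - 0\<^sup>2 * q) + 1)) (at_right 0)"
    by (intro tendsto_intros) auto
  then have "((\<lambda>t::real. - q / (sqrt (1 - t\<^sup>2 * q) + 1)) \<longlongrightarrow> - q / 2) (at_right 0)" by simp
  then show ?thesis using ev by (rule Lim_transform_eventually)
qed

lemma eventually_sqrt_nonneg: "eventually (\<lambda>t::real. 1 - t\<^sup>2 * q \<ge> 0) (at_right 0)"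
proof -
  have "((\<lambda>t::real. 1 - t\<^sup>2 * q) \<longlongrightarrow> 1 - 0\<^sup>2 * q) (at_right 0)"
    by (intro tendsto_intros)
  then have "eventually (\<lambda>t::real. 1 - t\<^sup>2 * q > 0) (at_right 0)"
    by (intro order_tendstoD(1)) auto
  then show ?thesis by (rule eventually_mono) simp
qed

text \<open>The block (AS)_i S_i^T, the Lagrange multiplier of the constraint S_i S_i^T = I. Its
  symmetry and the stationarity equation (AS)_i = \<Lambda>_i S_i are derived below at local
  maxima.\<close>

definition lam :: "nat \<Rightarrow> nat \<Rightarrow> nat \<Rightarrow> (nat \<Rightarrow> nat \<Rightarrow> nat \<Rightarrow> nat \<Rightarrow> real)
    \<Rightarrow> (nat \<Rightarrow> nat \<Rightarrow> nat \<Rightarrow> real) \<Rightarrow> nat \<Rightarrow> nat \<Rightarrow> nat \<Rightarrow> real" where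
  "lam n d p A S i a b = (\<Sum>k<p. amul n d A S i a k * S i b k)"

lemma sum_kron_left: "a < d \<Longrightarrow> (\<Sum>b<d. kron a b * f b) = f a"
  by (simp add: kron_def if_distrib[of "\<lambda>x. x * _"] sum.delta cong: if_cong)

lemma sum_kron_right: "a < d \<Longrightarrow> (\<Sum>b<d. kron b a * f b) = f a"
  by (simp add: kron_def if_distrib[of "\<lambda>x. x * _"] sum.delta' cong: if_cong)

lemma kron_commute: "kron a b = kron b a"
  by (simp add: kron_def)

lemma stiefelD:
  "S \<in> stiefel n d p \<Longrightarrow> i < n \<Longrightarrow> a < d \<Longrightarrow> b < d \<Longrightarrow> (\<Sum>k<p. S i a k * S i b k) = kron a b"
  by (simp add: stiefel_def)

lemma local_max_stiefel: "local_max n d p A S \<Longrightarrow> S \<in> stiefel n d p"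
  by (simp add: local_max_def)

lemma sum_mult_expand:
  fixes x y z w :: "nat \<Rightarrow> real"
  shows "(\<Sum>k<p. (x k + y k) * (z k + w k)) =
    (\<Sum>k<p. x k * z k) + (\<Sum>k<p. x k * w k) + (\<Sum>k<p. y k * z k) + (\<Sum>k<p. y k * w k)"
  by (simp add: algebra_simps sum.distrib)

lemma stiefel_row_sum:
  assumes "S \<in> stiefel n d p" "i < n" "a < d"
  shows "(\<Sum>k<p. S i a k * (\<Sum>b<d. u b * S i b k)) = u a"
proof -
  have "(\<Sum>k<p. S i a k * (\<Sum>b<d. u b * S i b k)) = (\<Sum>k<p. \<Sum>b<d. u b * (S i a k * S i b k))"
    by (simp add: sum_distrib_left mult_ac)
  also have "\<dots> = (\<Sum>b<d. \<Sum>k<p. u b * (S i a k * S i b k))" by (rule sum.swap)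
  also have "\<dots> = (\<Sum>b<d. kron a b * u b)"
    using assms by (intro sum.cong[OF refl]) (simp add: sum_distrib_left[symmetric] stiefelD)
  finally show ?thesis using assms by (simp add: sum_kron_left)
qed

text \<open>In every block the curve turns the combination r_i = u^T S_i into c r_i + t w_i, where c
  = sqrt(1 - t^2 |w_i|^2), and leaves combinations orthogonal to u alone. As u is a unit vector and
  w_i is orthogonal to the rows of S_i, the rows stay orthonormal. The second-order correction
  -|w_i|^2/2 u r_i^T is what brings the multiplier into the inequality.\<close>

lemma local_max_normal_direction:
  assumes lm: "local_max n d p A S" and sym: "bsym n d A"
    and u: "(\<Sum>a<d. (u a)\<^sup>2) = 1"
    and w: "\<And>i a. i < n \<Longrightarrow> a < d \<Longrightarrow> (\<Sum>k<p. S i a k * w i k) = 0"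
  shows "(\<Sum>i<n. \<Sum>a<d. \<Sum>k<p. u a * w i k * amul n d A S i a k) \<le> 0"
    and "(\<Sum>i<n. \<Sum>a<d. \<Sum>k<p. u a * w i k * amul n d A S i a k) = 0 \<Longrightarrow>
      (\<Sum>i<n. \<Sum>j<n. \<Sum>a<d. \<Sum>b<d. u a * A i j a b * u b * (\<Sum>k<p. w i k * w j k))
      \<le> (\<Sum>i<n. (\<Sum>k<p. (w i k)\<^sup>2) * (\<Sum>a<d. \<Sum>b<d. u a * lam n d p A S i a b * u b))"
proof -
  note S = local_max_stiefel[OF lm]
  define q where "q i = (\<Sum>k<p. (w i k)\<^sup>2)" for i
  define r where "r i k = (\<Sum>b<d. u b * S i b k)" for i k
  define c where "c t i = sqrt (1 - t\<^sup>2 * q i)" for t i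
  define V where "V i a k = u a * w i k" for i a k
  define H where "H t i a k = ((c t i - 1) / t\<^sup>2) * (u a * r i k)" for t i a k
  define H0 where "H0 i a k = (- q i / 2) * (u a * r i k)" for i a k
  have Sr: "(\<Sum>k<p. S i a k * r i k) = u a" if "i < n" "a < d" for i a
    unfolding r_def using stiefel_row_sum[OF S that] .
  have rx: "(\<Sum>k<p. r i k * x k) = (\<Sum>b<d. u b * (\<Sum>k<p. S i b k * x k))" for i x
  proof -
    have "(\<Sum>k<p. r i k * x k) = (\<Sum>k<p. \<Sum>b<d. u b * (S i b k * x k))"
      by (simp add: r_def sum_distrib_right mult.assoc)
    also have "\<dots> = (\<Sum>b<d. \<Sum>k<p. u b * (S i b k * x k))" by (rule sum.swap)
    finally show ?thesis by (simp add: sum_distrib_left)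
  qed
  have rr: "(\<Sum>k<p. r i k * r i k) = 1" if "i < n" for i
    using rx[of i "r i"] Sr[OF that] u by (simp add: power2_eq_square)
  have rw: "(\<Sum>k<p. r i k * w i k) = 0" if "i < n" for i
    using rx[of i "w i"] w[OF that] by simp
  have "eventually (\<lambda>t. \<forall>i\<in>{..<n}. 1 - t\<^sup>2 * q i \<ge> 0) (at_right 0)"
    by (intro eventually_ball_finite ballI eventually_sqrt_nonneg finite_lessThan)
  moreover have "eventually (\<lambda>t::real. t > 0) (at_right 0)" by (rule eventually_at_right_less)
  ultimately have st: "eventually (\<lambda>t. (\<lambda>i a k. S i a k + (t * V i a k + t\<^sup>2 * H t i a k)) \<in> stiefel n d p) (at_right 0)"
  proof eventually_elim
    case (elim t)
    show ?case unfolding stiefel_def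
    proof (intro CollectI allI impI)
      fix i a b assume i: "i < n" and a: "a < d" and b: "b < d"
      define z where "z k = t * w i k + (c t i - 1) * r i k" for k
      have T: "t * V i a k + t\<^sup>2 * H t i a k = u a * z k" for a k
      proof -
        have "t\<^sup>2 * H t i a k = (c t i - 1) * (u a * r i k)" using elim by (simp add: H_def)
        then show ?thesis by (simp add: V_def z_def algebra_simps)
      qed
      have Sz: "(\<Sum>k<p. S i a k * z k) = (c t i - 1) * u a" if "a < d" for a
      proof -
        have "(\<Sum>k<p. S i a k * z k) = t * (\<Sum>k<p. S i a k * w i k) + (c t i - 1) * (\<Sum>k<p. S i a k * r i k)"
          by (simp add: z_def algebra_simps sum.distrib sum_distrib_left sum_subtractf)
        then show ?thesis using w[OF i that] Sr[OF i that] by simp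
      qed
      have "(\<Sum>k<p. z k * z k) = t\<^sup>2 * q i + 2 * t * (c t i - 1) * (\<Sum>k<p. r i k * w i k)
          + (c t i - 1)\<^sup>2 * (\<Sum>k<p. r i k * r i k)"
        unfolding z_def q_def sum_distrib_left sum.distrib[symmetric]
        by (intro sum.cong refl) (simp add: power2_eq_square algebra_simps)
      then have zz: "(\<Sum>k<p. z k * z k) = t\<^sup>2 * q i + (c t i - 1)\<^sup>2" using rr rw i by simp
      have cc: "(c t i)\<^sup>2 = 1 - t\<^sup>2 * q i" using elim i by (simp add: c_def)
      have "(\<Sum>k<p. (S i a k + u a * z k) * (S i b k + u b * z k)) =
        kron a b + u b * (\<Sum>k<p. S i a k * z k) + u a * (\<Sum>k<p. S i b k * z k) + u a * u b * (\<Sum>k<p. z k * z k)"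
        unfolding stiefelD[OF S i a b, symmetric] sum_mult_expand
        by (simp add: sum_distrib_left mult_ac)
      also have "\<dots> = kron a b + u a * u b * ((c t i)\<^sup>2 - 1 + t\<^sup>2 * q i)"
        unfolding Sz[OF a] Sz[OF b] zz by (simp add: algebra_simps power2_eq_square)
      also have "\<dots> = kron a b" using cc by simp
      finally show "(\<Sum>k<p. (S i a k + (t * V i a k + t\<^sup>2 * H t i a k)) * (S i b k + (t * V i b k + t\<^sup>2 * H t i b k))) = kron a b"
        by (simp only: T)
    qed
  qed
  have lim: "((\<lambda>t. H t i a k) \<longlongrightarrow> H0 i a k) (at_right 0)" for i a k
    unfolding H_def H0_def c_def by (intro tendsto_mult_right sqrt_quotient_limit)
  have V: "bform n d p A V S = (\<Sum>i<n. \<Sum>a<d. \<Sum>k<p. u a * w i k * amul n d A S i a k)"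
    by (simp add: bform_amul V_def)
  show "(\<Sum>i<n. \<Sum>a<d. \<Sum>k<p. u a * w i k * amul n d A S i a k) \<le> 0"
    using local_max_curve(1)[OF lm sym st lim] by (simp add: V)
  assume "(\<Sum>i<n. \<Sum>a<d. \<Sum>k<p. u a * w i k * amul n d A S i a k) = 0"
  then have so: "2 * bform n d p A H0 S + bform n d p A V V \<le> 0"
    using local_max_curve(2)[OF lm sym st lim] by (simp add: V)
  have lamr: "(\<Sum>k<p. r i k * amul n d A S i a k) = (\<Sum>b<d. lam n d p A S i a b * u b)" for i a
    unfolding rx lam_def by (simp add: sum_distrib_left sum_distrib_right mult_ac)
  have "bform n d p A H0 S = (\<Sum>i<n. (- q i / 2) * (\<Sum>a<d. u a * (\<Sum>k<p. r i k * amul n d A S i a k)))"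
    by (simp add: bform_amul H0_def sum_distrib_left mult_ac)
  also have "\<dots> = (\<Sum>i<n. (- q i / 2) * (\<Sum>a<d. \<Sum>b<d. u a * lam n d p A S i a b * u b))"
    by (simp only: lamr) (simp add: sum_distrib_left mult_ac)
  finally have H0S: "2 * bform n d p A H0 S = - (\<Sum>i<n. q i * (\<Sum>a<d. \<Sum>b<d. u a * lam n d p A S i a b * u b))"
    by (simp add: sum_distrib_left sum_negf[symmetric] mult_ac)
  have "bform n d p A V V = (\<Sum>i<n. \<Sum>j<n. \<Sum>a<d. \<Sum>b<d. u a * A i j a b * u b * (\<Sum>k<p. w i k * w j k))"
    unfolding bform_def V_def by (intro sum.cong refl) (simp add: sum_distrib_left mult_ac)
  with so H0S show "(\<Sum>i<n. \<Sum>j<n. \<Sum>a<d. \<Sum>b<d. u a * A i j a b * u b * (\<Sum>k<p. w i k * w j k))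
      \<le> (\<Sum>i<n. (\<Sum>k<p. (w i k)\<^sup>2) * (\<Sum>a<d. \<Sum>b<d. u a * lam n d p A S i a b * u b))"
    by (simp add: q_def)
qed

lemma local_max_first_order_normal:
  assumes lm: "local_max n d p A S" and sym: "bsym n d A"
    and u: "(\<Sum>a<d. (u a)\<^sup>2) = 1"
    and w: "\<And>i a. i < n \<Longrightarrow> a < d \<Longrightarrow> (\<Sum>k<p. S i a k * w i k) = 0"
  shows "(\<Sum>i<n. \<Sum>a<d. \<Sum>k<p. u a * w i k * amul n d A S i a k) = 0"
proof -
  have "(\<Sum>i<n. \<Sum>a<d. \<Sum>k<p. u a * (- w i k) * amul n d A S i a k) \<le> 0"
    using w by (intro local_max_normal_direction(1)[OF lm sym u]) (simp add: sum_negf)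
  then have "(\<Sum>i<n. \<Sum>a<d. \<Sum>k<p. u a * w i k * amul n d A S i a k) \<ge> 0"
    by (simp add: sum_negf)
  moreover have "(\<Sum>i<n. \<Sum>a<d. \<Sum>k<p. u a * w i k * amul n d A S i a k) \<le> 0"
    using w by (intro local_max_normal_direction(1)[OF lm sym u])
  ultimately show ?thesis by simp
qed

lemma local_max_second_order:
  assumes "local_max n d p A S" and "bsym n d A"
    and "(\<Sum>a<d. (u a)\<^sup>2) = 1"
    and "\<And>i a. i < n \<Longrightarrow> a < d \<Longrightarrow> (\<Sum>k<p. S i a k * w i k) = 0"
  shows "(\<Sum>i<n. \<Sum>j<n. \<Sum>a<d. \<Sum>b<d. u a * A i j a b * u b * (\<Sum>k<p. w i k * w j k))
      \<le> (\<Sum>i<n. (\<Sum>k<p. (w i k)\<^sup>2) * (\<Sum>a<d. \<Sum>b<d. u a * lam n d p A S i a b * u b))"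
  using local_max_normal_direction(2)[OF assms local_max_first_order_normal[OF assms]] .

text \<open>The curve rotates rows \<open>a0\<close> and \<open>b0\<close> of the single block
  \<open>i0\<close> within their plane. The one-sided derivative is the difference of the two
  entries; exchanging the rows gives the reverse inequality.\<close>

lemma local_max_lam_le:
  assumes lm: "local_max n d p A S" and sym: "bsym n d A"
    and i0: "i0 < n" and a0: "a0 < d" and b0: "b0 < d" and ne: "a0 \<noteq> b0"
  shows "lam n d p A S i0 a0 b0 \<le> lam n d p A S i0 b0 a0"
proof -
  note S = local_max_stiefel[OF lm]
  \<comment> \<open>With cosine c and sine t, the rotated row a is (1 + (c - 1) \<open>m a\<close>)
    times row a plus t \<open>e a\<close> times row \<open>\<pi> a\<close>. This covers the two
    moving rows and the fixed ones in one formula.\<close>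
  define \<pi> where "\<pi> a = (if a = a0 then b0 else if a = b0 then a0 else a)" for a
  define e :: "nat \<Rightarrow> real" where "e a = (if a = a0 then 1 else if a = b0 then -1 else 0)" for a
  define m :: "nat \<Rightarrow> real" where "m a = (if a = a0 \<or> a = b0 then 1 else 0)" for a
  define V where "V i a k = (if i = i0 then e a * S i0 (\<pi> a) k else 0)" for i a k
  define h :: "real \<Rightarrow> real" where "h t = (sqrt (1 - t\<^sup>2 * 1) - 1) / t\<^sup>2" for t
  define H where "H t i a k = h t * (if i = i0 then m a * S i0 a k else 0)" for t i a k
  define H0 where "H0 i a k = (- 1 / 2) * (if i = i0 then m a * S i0 a k else 0)" for i a k
  have pid: "\<pi> a < d" if "a < d" for a using that a0 b0 by (simp add: \<pi>_def)
  have "eventually (\<lambda>t::real. t > 0) (at_right 0)" by (rule eventually_at_right_less)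
  with eventually_sqrt_nonneg[of 1]
  have st: "eventually (\<lambda>t. (\<lambda>i a k. S i a k + (t * V i a k + t\<^sup>2 * H t i a k)) \<in> stiefel n d p) (at_right 0)"
  proof eventually_elim
    case (elim t)
    define c where "c = sqrt (1 - t\<^sup>2 * 1)"
    have cc: "c * c = 1 - t * t" using elim unfolding c_def by (simp add: power2_eq_square)
    show ?case unfolding stiefel_def
    proof (intro CollectI allI impI)
      fix i a b assume i: "i < n" and a: "a < d" and b: "b < d"
      show "(\<Sum>k<p. (S i a k + (t * V i a k + t\<^sup>2 * H t i a k)) * (S i b k + (t * V i b k + t\<^sup>2 * H t i b k))) = kron a b"
      proof (cases "i = i0")
        case False
        then show ?thesis using S i a b by (simp add: V_def H_def stiefelD)
      next
        case True
        have T: "S i a k + (t * V i a k + t\<^sup>2 * H t i a k) =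
            (1 + (c - 1) * m a) * S i0 a k + (t * e a) * S i0 (\<pi> a) k" for a k
        proof -
          have "t\<^sup>2 * h t = c - 1" using elim by (simp add: h_def c_def)
          then have "t\<^sup>2 * H t i a k = (c - 1) * (m a * S i0 a k)"
            using True by (simp add: H_def mult.assoc[symmetric])
          then show ?thesis using True by (simp add: V_def algebra_simps)
        qed
        have "(\<Sum>k<p. (S i a k + (t * V i a k + t\<^sup>2 * H t i a k)) * (S i b k + (t * V i b k + t\<^sup>2 * H t i b k)))
          = (1 + (c - 1) * m a) * (1 + (c - 1) * m b) * (\<Sum>k<p. S i0 a k * S i0 b k)
          + (1 + (c - 1) * m a) * (t * e b) * (\<Sum>k<p. S i0 a k * S i0 (\<pi> b) k)
          + (t * e a) * (1 + (c - 1) * m b) * (\<Sum>k<p. S i0 (\<pi> a) k * S i0 b k)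
          + (t * e a) * (t * e b) * (\<Sum>k<p. S i0 (\<pi> a) k * S i0 (\<pi> b) k)"
          unfolding T sum_mult_expand by (simp add: sum_distrib_left mult_ac)
        also have "\<dots> = (1 + (c - 1) * m a) * (1 + (c - 1) * m b) * kron a b
          + (1 + (c - 1) * m a) * (t * e b) * kron a (\<pi> b)
          + (t * e a) * (1 + (c - 1) * m b) * kron (\<pi> a) b
          + (t * e a) * (t * e b) * kron (\<pi> a) (\<pi> b)"
          using S i0 a b by (simp add: stiefelD pid)
        also have "\<dots> = kron a b"
          using ne cc by (auto simp: kron_def \<pi>_def e_def m_def)
        finally show ?thesis .
      qed
    qed
  qed
  have hl: "(h \<longlongrightarrow> - 1 / 2) (at_right 0)" unfolding h_def by (rule sqrt_quotient_limit)
  have lim: "((\<lambda>t. H t i a k) \<longlongrightarrow> H0 i a k) (at_right 0)" for i a k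
    unfolding H_def H0_def by (intro tendsto_mult_right hl)
  have "bform n d p A V S = (\<Sum>i<n. if i = i0 then (\<Sum>a<d. e a * (\<Sum>k<p. S i0 (\<pi> a) k * amul n d A S i0 a k)) else 0)"
    unfolding bform_amul by (intro sum.cong refl) (simp add: V_def sum_distrib_left mult_ac)
  also have "\<dots> = (\<Sum>a<d. e a * (\<Sum>k<p. S i0 (\<pi> a) k * amul n d A S i0 a k))"
    using i0 by (simp add: sum.delta)
  also have "\<dots> = (\<Sum>a\<in>{a0, b0}. e a * (\<Sum>k<p. S i0 (\<pi> a) k * amul n d A S i0 a k))"
    using a0 b0 by (intro sum.mono_neutral_right) (auto simp: e_def)
  also have "\<dots> = lam n d p A S i0 a0 b0 - lam n d p A S i0 b0 a0"
    using ne by (simp add: e_def \<pi>_def lam_def mult.commute)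
  finally show ?thesis using local_max_curve(1)[OF lm sym st lim] by simp
qed

lemma local_max_lam_sym:
  assumes "local_max n d p A S" "bsym n d A" "i < n" "a < d" "b < d"
  shows "lam n d p A S i a b = lam n d p A S i b a"
proof (cases "a = b")
  case False
  with local_max_lam_le[OF assms this] local_max_lam_le[OF assms(1-3,5,4)] show ?thesis by force
qed simp

text \<open>The part \<open>N\<close> of row \<open>a0\<close> of (AS)_i0 that is orthogonal to the
  rows of S_i0 is itself an admissible normal direction. Testing the first-order condition with it
  yields |N|^2 = 0.\<close>

lemma local_max_amul:
  assumes lm: "local_max n d p A S" and sym: "bsym n d A"
    and i0: "i0 < n" and a0: "a0 < d" and k0: "k0 < p"
  shows "amul n d A S i0 a0 k0 = (\<Sum>b<d. lam n d p A S i0 a0 b * S i0 b k0)"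
proof -
  note S = local_max_stiefel[OF lm]
  define N where "N k = amul n d A S i0 a0 k - (\<Sum>b<d. lam n d p A S i0 a0 b * S i0 b k)" for k
  define u :: "nat \<Rightarrow> real" where "u a = (if a = a0 then 1 else 0)" for a
  define w where "w i k = (if i = i0 then N k else 0)" for i k
  have SN: "(\<Sum>k<p. S i0 a k * N k) = 0" if "a < d" for a
  proof -
    have "(\<Sum>k<p. S i0 a k * N k) = lam n d p A S i0 a0 a - (\<Sum>k<p. S i0 a k * (\<Sum>b<d. lam n d p A S i0 a0 b * S i0 b k))"
      by (simp add: N_def lam_def algebra_simps sum_subtractf)
    then show ?thesis by (simp add: stiefel_row_sum[OF S i0 that])
  qed
  have u1: "(\<Sum>a<d. (u a)\<^sup>2) = 1" using a0 by (simp add: u_def if_distrib[of "\<lambda>x. x^2"] sum.delta' cong: if_cong)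
  have w: "(\<Sum>k<p. S i a k * w i k) = 0" if "i < n" "a < d" for i a
    using SN that by (cases "i = i0") (simp_all add: w_def)
  have "(\<Sum>i<n. \<Sum>a<d. \<Sum>k<p. u a * w i k * amul n d A S i a k) = 0"
    by (rule local_max_first_order_normal[OF lm sym u1 w])
  moreover have "(\<Sum>k<p. u a * w i k * amul n d A S i a k)
      = (if a = a0 then if i = i0 then (\<Sum>k<p. N k * amul n d A S i0 a0 k) else 0 else 0)" for i a
    by (simp add: u_def w_def)
  ultimately have 1: "(\<Sum>k<p. N k * amul n d A S i0 a0 k) = 0"
    using i0 a0 by (simp add: sum.delta)
  have "(\<Sum>k<p. N k * (\<Sum>b<d. lam n d p A S i0 a0 b * S i0 b k))
      = (\<Sum>k<p. \<Sum>b<d. lam n d p A S i0 a0 b * (S i0 b k * N k))"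
    by (simp add: sum_distrib_left mult_ac)
  also have "\<dots> = (\<Sum>b<d. \<Sum>k<p. lam n d p A S i0 a0 b * (S i0 b k * N k))" by (rule sum.swap)
  also have "\<dots> = 0" by (simp add: sum_distrib_left[symmetric] SN)
  finally have "(\<Sum>k<p. N k * N k) = 0"
    using 1 by (simp add: N_def right_diff_distrib sum_subtractf)
  then have "N k0 * N k0 = 0" using k0 by (subst (asm) sum_nonneg_eq_0_iff) auto
  then show ?thesis by (simp add: N_def)
qed

section \<open>Positive semidefinite forms\<close>

lemma sum_Cauchy_Schwarz: 
  fixes x y :: "nat \<Rightarrow> real"
  shows "(\<Sum>k<m. x k * y k)\<^sup>2 \<le> (\<Sum>k<m. (x k)\<^sup>2) * (\<Sum>k<m. (y k)\<^sup>2)"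
  by (rule Cauchy_Schwarz_ineq_sum)

lemma injective_imp_solvable:
  fixes M :: "nat \<Rightarrow> nat \<Rightarrow> real"
  assumes inj: "\<And>x. (\<And>a. a < d \<Longrightarrow> (\<Sum>b<d. M a b * x b) = 0) \<Longrightarrow> (\<And>a. a < d \<Longrightarrow> x a = 0)"
  shows "\<exists>x. \<forall>a<d. (\<Sum>b<d. M a b * x b) = z a"
proof -
  define A where "A = mat d d (\<lambda>(a, b). M a b)"
  have A: "A \<in> carrier_mat d d" by (simp add: A_def)
  have mv: "(A *\<^sub>v v) $ a = (\<Sum>b<d. M a b * v $ b)" if "a < d" "v \<in> carrier_vec d" for v a
    using that by (simp add: A_def scalar_prod_def atLeast0LessThan)
  have "det A \<noteq> 0"
  proof
    assume "det A = 0"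
    then obtain v where v: "v \<in> carrier_vec d" "v \<noteq> 0\<^sub>v d" "A *\<^sub>v v = 0\<^sub>v d"
      using det_0_iff_vec_prod_zero[OF A] by blast
    have "v $ a = 0" if "a < d" for a
    proof (rule inj[OF _ that])
      fix a assume "a < d"
      then show "(\<Sum>b<d. M a b * v $ b) = 0" using mv[of a v] v by simp
    qed
    then have "v = 0\<^sub>v d" using v(1) by (intro eq_vecI) auto
    with v(2) show False by simp
  qed
  from det_non_zero_imp_unit[OF A this, unfolded Units_def, of "()"]
  obtain B where B: "B \<in> carrier_mat d d" "A * B = 1\<^sub>m d"
    by (auto simp: ring_mat_def)
  have "A *\<^sub>v (B *\<^sub>v vec d z) = (A * B) *\<^sub>v vec d z"
    using A B by (intro assoc_mult_mat_vec[symmetric, of _ d d _ d]) auto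
  then have e: "A *\<^sub>v (B *\<^sub>v vec d z) = vec d z" using B by simp
  have "(\<Sum>b<d. M a b * (B *\<^sub>v vec d z) $ b) = z a" if "a < d" for a
    using mv[OF that, of "B *\<^sub>v vec d z"] e that B by simp
  then show ?thesis by blast
qed

lemma psd_Cauchy_Schwarz:
  fixes M :: "nat \<Rightarrow> nat \<Rightarrow> real"
  assumes sym: "\<And>a b. a < d \<Longrightarrow> b < d \<Longrightarrow> M a b = M b a"
    and psd: "\<And>x. (\<Sum>a<d. \<Sum>b<d. x a * M a b * x b) \<ge> 0"
  shows "(\<Sum>a<d. \<Sum>b<d. x a * M a b * y b)\<^sup>2 \<le>
    (\<Sum>a<d. \<Sum>b<d. x a * M a b * x b) * (\<Sum>a<d. \<Sum>b<d. y a * M a b * y b)"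
proof -
  let ?q = "\<lambda>x y. (\<Sum>a<d. \<Sum>b<d. x a * M a b * y b)"
  have swap: "?q y x = ?q x y"
  proof -
    have "?q y x = (\<Sum>b<d. \<Sum>a<d. y a * M a b * x b)" by (rule sum.swap)
    also have "\<dots> = ?q x y" using sym by (intro sum.cong refl) simp
    finally show ?thesis .
  qed
  have ex: "?q (\<lambda>a. s * x a + t * y a) (\<lambda>a. s * x a + t * y a) = s\<^sup>2 * ?q x x + 2 * s * t * ?q x y + t\<^sup>2 * ?q y y" for s t
  proof -
    have "?q (\<lambda>a. s * x a + t * y a) (\<lambda>a. s * x a + t * y a) = s\<^sup>2 * ?q x x + s * t * ?q x y + s * t * ?q y x + t\<^sup>2 * ?q y y"
      unfolding sum_distrib_left sum.distrib[symmetric]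
      by (intro sum.cong refl) (simp add: algebra_simps power2_eq_square)
    then show ?thesis by (simp add: swap)
  qed
  have nn: "s\<^sup>2 * ?q x x + 2 * s * t * ?q x y + t\<^sup>2 * ?q y y \<ge> 0" for s t
    using psd[of "\<lambda>a. s * x a + t * y a"] unfolding ex .
  define A B C where "A = ?q x x" and "B = ?q x y" and "C = ?q y y"
  have nn: "s\<^sup>2 * A + 2 * s * t * B + t\<^sup>2 * C \<ge> 0" for s t using nn unfolding A_def B_def C_def .
  have A: "A \<ge> 0" and C: "C \<ge> 0" using nn[of 1 0] nn[of 0 1] by auto
  have "B\<^sup>2 \<le> A * C"
  proof (cases "A = 0")
    case True
    have "B = 0"
    proof (rule ccontr)
      assume "B \<noteq> 0"
      \<comment> \<open>For A = 0 and t = 1 the form is affine in s, and this s makes it -C - 2 <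
        0.\<close>
      have "(- (C + 1) / B)\<^sup>2 * A + 2 * (- (C + 1) / B) * 1 * B + 1\<^sup>2 * C \<ge> 0" by (rule nn)
      with True \<open>B \<noteq> 0\<close> C show False by simp
    qed
    with True show ?thesis by simp
  next
    case False
    have "(-B)\<^sup>2 * A + 2 * (-B) * A * B + A\<^sup>2 * C \<ge> 0" by (rule nn)
    then have "A * (A * C - B\<^sup>2) \<ge> 0" by (simp add: algebra_simps power2_eq_square)
    then show ?thesis using False A by (simp add: zero_le_mult_iff)
  qed
  then show ?thesis unfolding A_def B_def C_def .
qed

text \<open>The form of \<open>M\<inverse>\<close> is at most \<open>1/c\<close>, and Cauchy--Schwarz for \<open>M\<close> turns this into a lower bound for \<open>M\<close>.\<close>
lemma psd_lower_bound:
  fixes M :: "nat \<Rightarrow> nat \<Rightarrow> real"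
  assumes sym: "\<And>a b. a < d \<Longrightarrow> b < d \<Longrightarrow> M a b = M b a"
    and psd: "\<And>x. (\<Sum>a<d. \<Sum>b<d. x a * M a b * x b) \<ge> 0"
    and c: "c > 0"
    and low: "\<And>x. (\<Sum>a<d. (\<Sum>b<d. M a b * x b)\<^sup>2) \<ge> c\<^sup>2 * (\<Sum>a<d. (x a)\<^sup>2)"
  shows "(\<Sum>a<d. \<Sum>b<d. x a * M a b * x b) \<ge> c * (\<Sum>a<d. (x a)\<^sup>2)"
proof -
  let ?n = "\<lambda>x. (\<Sum>a<d. (x a :: real)\<^sup>2)"
  let ?q = "\<lambda>x y. (\<Sum>a<d. \<Sum>b<d. x a * M a b * y b)"
  have qm: "?q z y = (\<Sum>a<d. z a * (\<Sum>b<d. M a b * y b))" for z y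
    by (simp add: sum_distrib_left mult_ac)
  obtain y where y: "\<And>a. a < d \<Longrightarrow> (\<Sum>b<d. M a b * y b) = x a"
  proof -
    have "\<exists>y. \<forall>a<d. (\<Sum>b<d. M a b * y b) = x a"
    proof (rule injective_imp_solvable)
      fix y :: "nat \<Rightarrow> real" and a
      assume "\<And>a. a < d \<Longrightarrow> (\<Sum>b<d. M a b * y b) = 0" and a: "a < d"
      then have "c\<^sup>2 * ?n y \<le> 0" using low[of y] by simp
      then have "?n y \<le> 0" using c by (simp add: mult_le_0_iff)
      then have "?n y = 0" by (intro antisym sum_nonneg) auto
      then show "y a = 0" using a by (subst (asm) sum_nonneg_eq_0_iff) auto
    qed
    then show ?thesis using that by blast
  qed
  have nx: "?n x \<ge> c\<^sup>2 * ?n y" using low[of y] y by simp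
  have qxy: "?q x y = ?n x" using y by (simp add: qm power2_eq_square)
  have qyy: "?q y y = (\<Sum>a<d. y a * x a)" using y by (simp add: qm)
  have n0: "?n x \<ge> 0" "?n y \<ge> 0" by (auto intro: sum_nonneg)
  have "(?q y y)\<^sup>2 \<le> ?n y * ?n x" unfolding qyy by (rule sum_Cauchy_Schwarz)
  then have "c\<^sup>2 * (?q y y)\<^sup>2 \<le> (c\<^sup>2 * ?n y) * ?n x" using mult_left_mono[of _ _ "c\<^sup>2"] by (simp add: mult.assoc)
  also have "\<dots> \<le> ?n x * ?n x" using nx n0 by (intro mult_right_mono) auto
  finally have "(c * ?q y y)\<^sup>2 \<le> (?n x)\<^sup>2" unfolding power_mult_distrib power2_eq_square[of "?n x"] .
  then have 1: "c * ?q y y \<le> ?n x" using n0(1) by (rule power2_le_imp_le)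
  have "(?n x)\<^sup>2 \<le> ?q x x * ?q y y" using psd_Cauchy_Schwarz[OF sym psd, of x y] by (simp only: qxy)
  then have "c * (?n x)\<^sup>2 \<le> ?q x x * (c * ?q y y)" using c by (simp add: mult_left_mono mult.left_commute)
  also have "\<dots> \<le> ?q x x * ?n x" by (rule mult_left_mono[OF 1 psd])
  finally have "?n x * (?q x x - c * ?n x) \<ge> 0" by (simp add: algebra_simps power2_eq_square)
  then show ?thesis
  proof (cases "?n x = 0")
    case True then show ?thesis using psd[of x] by simp
  next
    case False
    with \<open>?n x * (?q x x - c * ?n x) \<ge> 0\<close> n0 show ?thesis by (simp add: zero_le_mult_iff)
  qed
qed

text \<open>One Cholesky step per element: the row of the pivot \<open>e\<close>, divided by the
  root of the pivot, is one vector of the factorization, and the Schur complement \<open>M'\<close>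
  on the remaining indices is again positive semidefinite. A zero pivot fits in because division by
  zero yields 0, so that then \<open>M' = M\<close> and the new vector is 0.\<close>

lemma psd_Gram_factorization:
  fixes M :: "'a \<Rightarrow> 'a \<Rightarrow> real"
  assumes "finite I"
    and "\<And>u v. u \<in> I \<Longrightarrow> v \<in> I \<Longrightarrow> M u v = M v u"
    and "\<And>x. (\<Sum>u\<in>I. \<Sum>v\<in>I. x u * M u v * x v) \<ge> 0"
  shows "\<exists>N (V :: nat \<Rightarrow> 'a \<Rightarrow> real). \<forall>u\<in>I. \<forall>v\<in>I. M u v = (\<Sum>m<N. V m u * V m v)"
  using assms
proof (induction I arbitrary: M rule: finite_induct)
  case empty
  show ?case by auto
next
  case (insert e I)
  let ?J = "insert e I"
  have sym: "\<And>u v. u \<in> ?J \<Longrightarrow> v \<in> ?J \<Longrightarrow> M u v = M v u" by (rule insert.prems(1))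
  have exp: "(\<Sum>u\<in>?J. \<Sum>v\<in>?J. x u * M u v * x v) =
    x e * M e e * x e + 2 * x e * (\<Sum>v\<in>I. M e v * x v) + (\<Sum>u\<in>I. \<Sum>v\<in>I. x u * M u v * x v)" for x
  proof -
    have "(\<Sum>u\<in>I. x u * M u e * x e) = x e * (\<Sum>v\<in>I. M e v * x v)"
      unfolding sum_distrib_left using sym by (intro sum.cong refl) (simp add: mult_ac)
    then show ?thesis using insert.hyps by (simp add: sum.distrib sum_distrib_left mult_ac)
  qed
  have nn: "x e * M e e * x e + 2 * x e * (\<Sum>v\<in>I. M e v * x v) + (\<Sum>u\<in>I. \<Sum>v\<in>I. x u * M u v * x v) \<ge> 0" for x
    using insert.prems(2)[of x] unfolding exp .
  have upd: "s * M e e * s + 2 * s * (\<Sum>v\<in>I. M e v * x v) + (\<Sum>u\<in>I. \<Sum>v\<in>I. x u * M u v * x v) \<ge> 0" for s x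
  proof -
    have "(\<Sum>v\<in>I. M e v * (x(e := s)) v) = (\<Sum>v\<in>I. M e v * x v)"
      using insert.hyps by (intro sum.cong refl) auto
    moreover have "(\<Sum>u\<in>I. \<Sum>v\<in>I. (x(e := s)) u * M u v * (x(e := s)) v) = (\<Sum>u\<in>I. \<Sum>v\<in>I. x u * M u v * x v)"
      using insert.hyps by (intro sum.cong refl) auto
    ultimately show ?thesis using nn[of "x(e := s)"] by simp
  qed
  have e0: "M e e \<ge> 0" using upd[of 1 "\<lambda>_. 0"] by simp
  define M' where "M' u v = M u v - M e u * M e v / M e e" for u v
  \<comment> \<open>A zero pivot forces a zero row: otherwise the form at s e + v is affine in s
    with slope 2 \<open>M e v\<close> and takes the value -1 for the s chosen below.\<close>
  have row0: "M e v = 0" if "M e e = 0" "v \<in> I" for v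
  proof (rule ccontr)
    assume ne: "M e v \<noteq> 0"
    define x where "x w = (if w = v then 1 else 0 :: real)" for w
    have a: "(\<Sum>w\<in>I. M e w * x w) = M e v"
      using that insert.hyps by (simp add: x_def if_distrib[of "\<lambda>z. _ * z"] sum.delta cong: if_cong)
    have b: "(\<Sum>u\<in>I. \<Sum>w\<in>I. x u * M u w * x w) = M v v"
    proof -
      have "(\<Sum>w\<in>I. x u * M u w * x w) = x u * M u v" for u
        using that insert.hyps by (simp add: x_def if_distrib[of "\<lambda>z. _ * z"] sum.delta cong: if_cong)
      then show ?thesis using that insert.hyps by (simp add: x_def if_distrib[of "\<lambda>z. z * _"] sum.delta cong: if_cong)
    qed
    define s where "s = - (M v v + 1) / (2 * M e v)"
    have "2 * s * M e v = - (M v v + 1)" using ne by (simp add: s_def)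
    then show False using upd[of s x] that(1) unfolding a b by simp
  qed
  have psd': "(\<Sum>u\<in>I. \<Sum>v\<in>I. x u * M' u v * x v) \<ge> 0" for x
  proof -
    define s where "s = (\<Sum>v\<in>I. M e v * x v)"
    have "(\<Sum>u\<in>I. \<Sum>v\<in>I. x u * (M e u * M e v / M e e) * x v) = s * s / M e e"
      unfolding s_def sum_product sum_divide_distrib by (intro sum.cong refl) (simp add: mult_ac)
    then have 1: "(\<Sum>u\<in>I. \<Sum>v\<in>I. x u * M' u v * x v) = (\<Sum>u\<in>I. \<Sum>v\<in>I. x u * M u v * x v) - s * s / M e e"
      unfolding M'_def by (simp add: algebra_simps sum_subtractf)
    show ?thesis
    proof (cases "M e e = 0")
      case True
      then show ?thesis using 1 upd[of 0 x] by simp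
    next
      case False
      have "(- s / M e e) * M e e * (- s / M e e) + 2 * (- s / M e e) * s = - (s * s / M e e)"
        using False by (simp add: field_simps)
      then show ?thesis using upd[of "- s / M e e" x] 1 unfolding s_def[symmetric] by linarith
    qed
  qed
  have "\<And>u v. u \<in> I \<Longrightarrow> v \<in> I \<Longrightarrow> M' u v = M' v u" using sym by (simp add: M'_def mult.commute)
  from insert.IH[OF this psd'] obtain N and V :: "nat \<Rightarrow> 'a \<Rightarrow> real" where
    NV: "\<And>u v. u \<in> I \<Longrightarrow> v \<in> I \<Longrightarrow> M' u v = (\<Sum>m<N. V m u * V m v)" by blast
  define V' where "V' m u = (if m < N then if u = e then 0 else V m u else M e u / sqrt (M e e))" for m u
  have "M u v = (\<Sum>m<Suc N. V' m u * V' m v)" if u: "u \<in> ?J" and v: "v \<in> ?J" for u v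
  proof -
    have "(\<Sum>m<Suc N. V' m u * V' m v) = (\<Sum>m<N. V' m u * V' m v) + M e u * M e v / M e e"
      using e0 by (simp add: V'_def)
    also have "\<dots> = M u v"
    proof (cases "u = e \<or> v = e")
      case True
      then have "(\<Sum>m<N. V' m u * V' m v) = 0" by (intro sum.neutral) (auto simp: V'_def)
      moreover have "M e u * M e v / M e e = M u v"
      proof -
        have z: "M e w = 0" if "M e e = 0" "w \<in> ?J" for w
          using that row0 by auto
        have "M u e = M e u" using u by (intro sym) auto
        then show ?thesis using True z[OF _ u] z[OF _ v] by (cases "M e e = 0") auto
      qed
      ultimately show ?thesis by simp
    next
      case False
      then have "(\<Sum>m<N. V' m u * V' m v) = M' u v" using u v NV by (simp add: V'_def)
      then show ?thesis by (simp add: M'_def)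
    qed
    finally show ?thesis by simp
  qed
  then show ?case by blast
qed

section \<open>The deterministic argument\<close>

lemma stiefel_row_norm:
  assumes "S \<in> stiefel n d p" "i < n"
  shows "(\<Sum>k<p. (\<Sum>b<d. u b * S i b k)\<^sup>2) = (\<Sum>b<d. (u b)\<^sup>2)"
proof -
  have "(\<Sum>k<p. (\<Sum>b<d. u b * S i b k)\<^sup>2) = (\<Sum>k<p. \<Sum>a<d. u a * (S i a k * (\<Sum>b<d. u b * S i b k)))"
    by (simp add: power2_eq_square sum_distrib_right mult.assoc)
  also have "\<dots> = (\<Sum>a<d. \<Sum>k<p. u a * (S i a k * (\<Sum>b<d. u b * S i b k)))" by (rule sum.swap)
  also have "\<dots> = (\<Sum>a<d. u a * u a)"
    using assms by (intro sum.cong refl) (simp add: sum_distrib_left[symmetric] stiefel_row_sum)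
  finally show ?thesis by (simp add: power2_eq_square)
qed

lemma stiefel_total:
  assumes "S \<in> stiefel n d p" "i < n"
  shows "(\<Sum>a<d. \<Sum>k<p. (S i a k)\<^sup>2) = d"
  using stiefelD[OF assms] by (simp add: power2_eq_square kron_def)

lemma double_sum_Cauchy_Schwarz:
  fixes x y :: "nat \<Rightarrow> nat \<Rightarrow> real"
  shows "(\<Sum>i<n. \<Sum>a<d. x i a * y i a)\<^sup>2 \<le> (\<Sum>i<n. \<Sum>a<d. (x i a)\<^sup>2) * (\<Sum>i<n. \<Sum>a<d. (y i a)\<^sup>2)"
  using Cauchy_Schwarz_ineq_sum[of "\<lambda>(i,a). x i a" "\<lambda>(i,a). y i a" "{..<n} \<times> {..<d}"]
  by (simp add: sum.cartesian_product case_prod_beta)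

lemma sum_square_le:
  fixes x :: "nat \<Rightarrow> real"
  shows "(\<Sum>i<n. x i)\<^sup>2 \<le> n * (\<Sum>i<n. (x i)\<^sup>2)"
  using sum_Cauchy_Schwarz[of "\<lambda>_. 1" x n] by simp

lemma L2_set_diff_ge:
  "L2_set f A - L2_set g A \<le> L2_set (\<lambda>i. f i + g i) A"
proof -
  have "L2_set (\<lambda>i. (f i + g i) + (- g i)) A \<le> L2_set (\<lambda>i. f i + g i) A + L2_set (\<lambda>i. - g i) A"
    by (rule L2_set_triangle_ineq)
  then show ?thesis by (simp add: L2_set_def)
qed

lemma le_square_div_self:
  fixes x y c :: real
  assumes "x * x \<le> c * x * y" "x \<ge> 0" "c * y \<ge> 0"
  shows "x \<le> c * y"
proof (cases "x = 0")
  case False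
  have "x * x \<le> x * (c * y)" using assms(1) by (simp add: mult_ac)
  then show ?thesis using False assms(2) by (simp add: mult_le_cancel_left)
qed (use assms in simp)

text \<open>Turns a bilinear bound into a bound on the image: testing |x^T D y| \<le> c |x| |y| with
  x = Dy gives the premise for X = |Dy|^2, Y = |y|^2.\<close>

lemma le_square_if_le_sqrt:
  fixes X Y c :: real
  assumes "X \<le> c * sqrt X * sqrt Y" "X \<ge> 0" "Y \<ge> 0" "c \<ge> 0"
  shows "X \<le> c\<^sup>2 * Y"
proof -
  have "sqrt X * sqrt X \<le> c * sqrt X * sqrt Y" using assms by simp
  then have "sqrt X \<le> c * sqrt Y" using assms by (rule_tac le_square_div_self) auto
  then have "(sqrt X)\<^sup>2 \<le> (c * sqrt Y)\<^sup>2" by (rule power_mono) (use assms in simp)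
  then show ?thesis using assms by (simp add: power_mult_distrib)
qed

text \<open>\<open>D\<close> is the noise \<open>\<Delta>\<close>, \<open>L\<close> bounds its operator norm and \<open>B\<close> the norms of its block row sums.\<close>
locale sync =
  fixes n d p :: nat and D :: "nat \<Rightarrow> nat \<Rightarrow> nat \<Rightarrow> nat \<Rightarrow> real" and L B :: real
  assumes n1: "n \<ge> 1" and d1: "d \<ge> 1" and p: "p \<ge> 2 * d + 1"
    and Dsym: "bsym n d D"
    and D0: "\<And>i a b. i < n \<Longrightarrow> a < d \<Longrightarrow> b < d \<Longrightarrow> D i i a b = 0"
    and L0: "L \<ge> 0" and B0: "B \<ge> 0"
    and Dop: "\<And>x y. \<bar>\<Sum>i<n. \<Sum>j<n. \<Sum>a<d. \<Sum>b<d. x i a * D i j a b * y j b\<bar> \<le>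
        L * sqrt (\<Sum>i<n. \<Sum>a<d. (x i a)\<^sup>2) * sqrt (\<Sum>i<n. \<Sum>a<d. (y i a)\<^sup>2)"
    and Bop: "\<And>i u v. i < n \<Longrightarrow> \<bar>\<Sum>j<n. \<Sum>a<d. \<Sum>b<d. u a * D i j a b * v b\<bar> \<le>
        B * sqrt (\<Sum>a<d. (u a)\<^sup>2) * sqrt (\<Sum>a<d. (v a)\<^sup>2)"
    and Lsmall: "65536 * L ^ 4 * d \<le> real n ^ 3" and Bsmall: "16 * B \<le> n"
begin

definition A :: "nat \<Rightarrow> nat \<Rightarrow> nat \<Rightarrow> nat \<Rightarrow> real" where
  "A i j a b = kron a b + D i j a b"

lemma Asym: "bsym n d A"
  using Dsym by (simp add: bsym_def A_def kron_commute)

text \<open>Since 65536 = 16^4, the smallness condition on L says in this form that the geometric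
  mean of L sqrt(n) and L sqrt(d) is at most n/16.\<close>

lemma Lnd: "L ^ 4 * (real n * d) \<le> (n / 16) ^ 4"
proof -
  have "real n * (65536 * L ^ 4 * d) \<le> n * real n ^ 3" using Lsmall by (rule mult_left_mono) simp
  then show ?thesis by (simp add: power_divide power_numeral_reduce mult_ac)
qed

lemma L_le: "L \<le> n / 16"
proof -
  have "L ^ 4 * 1 \<le> L ^ 4 * (real n * d)" using n1 d1 L0 
    by (intro mult_left_mono) (auto simp: mult_ge1_I)
  also have "\<dots> \<le> (n / 16) ^ 4" using Lnd by simp
  finally show ?thesis using power_mono_iff[of L "real n / 16" 4] L0 by simp
qed

lemma D_vec: "(\<Sum>i<n. \<Sum>a<d. (\<Sum>j<n. \<Sum>b<d. D i j a b * y j b)\<^sup>2) \<le> L\<^sup>2 * (\<Sum>i<n. \<Sum>a<d. (y i a)\<^sup>2)"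
proof -
  define x where "x i a = (\<Sum>j<n. \<Sum>b<d. D i j a b * y j b)" for i a
  have nn: "(\<Sum>i<n. \<Sum>a<d. (x i a)\<^sup>2) \<ge> 0" "(\<Sum>i<n. \<Sum>a<d. (y i a)\<^sup>2) \<ge> 0" by (auto intro!: sum_nonneg)
  have "(x i a)\<^sup>2 = (\<Sum>j<n. \<Sum>b<d. x i a * D i j a b * y j b)" for i a
  proof -
    have "(x i a)\<^sup>2 = x i a * (\<Sum>j<n. \<Sum>b<d. D i j a b * y j b)" by (simp add: power2_eq_square x_def)
    then show ?thesis by (simp add: sum_distrib_left mult.assoc)
  qed
  then have "(\<Sum>i<n. \<Sum>a<d. (x i a)\<^sup>2) = (\<Sum>i<n. \<Sum>a<d. \<Sum>j<n. \<Sum>b<d. x i a * D i j a b * y j b)"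
    by simp
  also have "\<dots> = (\<Sum>i<n. \<Sum>j<n. \<Sum>a<d. \<Sum>b<d. x i a * D i j a b * y j b)"
    by (intro sum.cong refl sum.swap)
  also have "\<dots> \<le> L * sqrt (\<Sum>i<n. \<Sum>a<d. (x i a)\<^sup>2) * sqrt (\<Sum>i<n. \<Sum>a<d. (y i a)\<^sup>2)"
    using Dop[of x y] by linarith
  finally have "(\<Sum>i<n. \<Sum>a<d. (x i a)\<^sup>2) \<le> L\<^sup>2 * (\<Sum>i<n. \<Sum>a<d. (y i a)\<^sup>2)"
    by (rule le_square_if_le_sqrt[OF _ nn L0])
  then show ?thesis by (simp add: x_def)
qed

text \<open>A vector supported in block i selects a block column of D, which symmetry identifies
  with the block row.\<close>

lemma D_row:
  assumes "i < n"
  shows "(\<Sum>j<n. \<Sum>b<d. (\<Sum>a<d. u a * D i j a b)\<^sup>2) \<le> L\<^sup>2 * (\<Sum>a<d. (u a)\<^sup>2)"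
proof -
  define y where "y j a = (if j = i then u a else 0)" for j a
  have 1: "(\<Sum>i<n. \<Sum>a<d. (y i a)\<^sup>2) = (\<Sum>a<d. (u a)\<^sup>2)"
  proof -
    have "(\<Sum>a<d. (y j a)\<^sup>2) = (if j = i then (\<Sum>a<d. (u a)\<^sup>2) else 0)" for j by (simp add: y_def)
    then show ?thesis using assms by (simp add: sum.delta)
  qed
  have 2: "(\<Sum>l<n. \<Sum>a<d. D j l b a * y l a) = (\<Sum>a<d. u a * D i j a b)" if "j < n" "b < d" for j b
  proof -
    have "(\<Sum>a<d. D j l b a * y l a) = (if l = i then (\<Sum>a<d. D j i b a * u a) else 0)" for l by (simp add: y_def)
    then have "(\<Sum>l<n. \<Sum>a<d. D j l b a * y l a) = (\<Sum>a<d. D j i b a * u a)" using assms by (simp add: sum.delta)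
    also have "\<dots> = (\<Sum>a<d. u a * D i j a b)"
      using Dsym assms that by (intro sum.cong refl) (simp add: bsym_def)
    finally show ?thesis .
  qed
  show ?thesis using D_vec[of y] unfolding 1 by (simp add: 2)
qed

end

locale sync_max = sync +
  fixes S :: "nat \<Rightarrow> nat \<Rightarrow> nat \<Rightarrow> real"
  assumes lm: "local_max n d p A S"
begin

lemma S: "S \<in> stiefel n d p"
  using lm by (rule local_max_stiefel)

text \<open>In the paper's notation: \<open>Sb = \<Sum>S\<^sub>i = Z\<^sup>T S\<close> and \<open>DS = \<Delta> S\<close>.\<close>
definition "Sb a k = (\<Sum>i<n. S i a k)"
definition "DS i a k = amul n d D S i a k"
definition "\<Lambda> i a b = lam n d p A S i a b"

lemma amul_A: "a < d \<Longrightarrow> amul n d A S i a k = Sb a k + DS i a k"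
  by (simp add: amul_def A_def DS_def Sb_def distrib_right sum.distrib sum_kron_left)

lemma Lam_S: "i < n \<Longrightarrow> a < d \<Longrightarrow> k < p \<Longrightarrow> (\<Sum>b<d. \<Lambda> i a b * S i b k) = Sb a k + DS i a k"
  using local_max_amul[OF lm Asym] by (simp add: \<Lambda>_def amul_A)

lemma Lam_sym: "i < n \<Longrightarrow> a < d \<Longrightarrow> b < d \<Longrightarrow> \<Lambda> i a b = \<Lambda> i b a"
  using local_max_lam_sym[OF lm Asym] by (simp add: \<Lambda>_def)

lemma S_total: "(\<Sum>i<n. \<Sum>a<d. \<Sum>k<p. (S i a k)\<^sup>2) = real n * d"
  using stiefel_total[OF S] by simp

lemma DS_total: "(\<Sum>i<n. \<Sum>a<d. \<Sum>k<p. (DS i a k)\<^sup>2) \<le> L\<^sup>2 * (real n * d)"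
proof -
  have sw: "(\<Sum>i<n. \<Sum>a<d. \<Sum>k<p. f i a k) = (\<Sum>k<p. \<Sum>i<n. \<Sum>a<d. f i a k)" for f :: "nat \<Rightarrow> nat \<Rightarrow> nat \<Rightarrow> real"
  proof -
    have "(\<Sum>i<n. \<Sum>a<d. \<Sum>k<p. f i a k) = (\<Sum>i<n. \<Sum>k<p. \<Sum>a<d. f i a k)" by (intro sum.cong refl sum.swap)
    also have "\<dots> = (\<Sum>k<p. \<Sum>i<n. \<Sum>a<d. f i a k)" by (rule sum.swap)
    finally show ?thesis .
  qed
  have "(\<Sum>i<n. \<Sum>a<d. \<Sum>k<p. (DS i a k)\<^sup>2) = (\<Sum>k<p. \<Sum>i<n. \<Sum>a<d. (\<Sum>j<n. \<Sum>b<d. D i j a b * S j b k)\<^sup>2)"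
    unfolding sw by (simp add: DS_def amul_def)
  also have "\<dots> \<le> (\<Sum>k<p. L\<^sup>2 * (\<Sum>i<n. \<Sum>a<d. (S i a k)\<^sup>2))" by (intro sum_mono D_vec)
  also have "\<dots> = L\<^sup>2 * (\<Sum>i<n. \<Sum>a<d. \<Sum>k<p. (S i a k)\<^sup>2)" unfolding sw by (simp add: sum_distrib_left)
  finally show ?thesis by (simp add: S_total)
qed

lemma uDS_eq: "(\<Sum>a<d. u a * DS i a k) = (\<Sum>j<n. \<Sum>b<d. (\<Sum>a<d. u a * D i j a b) * S j b k)"
proof -
  have "(\<Sum>a<d. u a * DS i a k) = (\<Sum>a<d. \<Sum>j<n. \<Sum>b<d. u a * D i j a b * S j b k)"
    by (simp add: DS_def amul_def sum_distrib_left mult.assoc)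
  also have "\<dots> = (\<Sum>j<n. \<Sum>a<d. \<Sum>b<d. u a * D i j a b * S j b k)" by (rule sum.swap)
  also have "\<dots> = (\<Sum>j<n. \<Sum>b<d. \<Sum>a<d. u a * D i j a b * S j b k)" by (intro sum.cong refl sum.swap)
  finally show ?thesis by (simp add: sum_distrib_right)
qed

text \<open>Each S_j preserves the norm of row vectors, so summing n blocks costs a factor n over
  \<open>D_row\<close>. The companion \<open>uDS_le_F\<close> uses the Frobenius norm of the block
  instead, which is of order L^2 d on average over i.\<close>

lemma uDS_le_n:
  assumes "i < n"
  shows "(\<Sum>k<p. (\<Sum>a<d. u a * DS i a k)\<^sup>2) \<le> n * (L\<^sup>2 * (\<Sum>a<d. (u a)\<^sup>2))"
proof -
  define g where "g j b = (\<Sum>a<d. u a * D i j a b)" for j b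
  have "(\<Sum>k<p. (\<Sum>a<d. u a * DS i a k)\<^sup>2) = (\<Sum>k<p. (\<Sum>j<n. \<Sum>b<d. g j b * S j b k)\<^sup>2)"
    by (simp add: uDS_eq g_def)
  also have "\<dots> \<le> (\<Sum>k<p. n * (\<Sum>j<n. (\<Sum>b<d. g j b * S j b k)\<^sup>2))" by (intro sum_mono sum_square_le)
  also have "\<dots> = n * (\<Sum>j<n. \<Sum>k<p. (\<Sum>b<d. g j b * S j b k)\<^sup>2)"
    by (simp add: sum_distrib_left[symmetric] sum.swap[of _ "{..<p}"])
  also have "\<dots> = n * (\<Sum>j<n. \<Sum>b<d. (g j b)\<^sup>2)" using stiefel_row_norm[OF S] by simp
  also have "\<dots> \<le> n * (L\<^sup>2 * (\<Sum>a<d. (u a)\<^sup>2))" unfolding g_def by (intro mult_left_mono D_row assms) auto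
  finally show ?thesis .
qed

lemma uDS_le_F:
  "(\<Sum>k<p. (\<Sum>a<d. u a * DS i a k)\<^sup>2) \<le> (\<Sum>a<d. (u a)\<^sup>2) * (\<Sum>a<d. \<Sum>k<p. (DS i a k)\<^sup>2)"
proof -
  have "(\<Sum>k<p. (\<Sum>a<d. u a * DS i a k)\<^sup>2) \<le> (\<Sum>k<p. (\<Sum>a<d. (u a)\<^sup>2) * (\<Sum>a<d. (DS i a k)\<^sup>2))"
    by (intro sum_mono sum_Cauchy_Schwarz)
  also have "\<dots> = (\<Sum>a<d. (u a)\<^sup>2) * (\<Sum>a<d. \<Sum>k<p. (DS i a k)\<^sup>2)"
    by (simp add: sum_distrib_left[symmetric] sum.swap[of _ "{..<p}"])
  finally show ?thesis .
qed

lemma second_order: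
  assumes w: "\<And>i a. i < n \<Longrightarrow> a < d \<Longrightarrow> (\<Sum>k<p. S i a k * w i k) = 0"
  shows "(\<Sum>i<n. \<Sum>j<n. \<Sum>a<d. \<Sum>b<d. u a * A i j a b * u b * (\<Sum>k<p. w i k * w j k))
      \<le> (\<Sum>i<n. (\<Sum>k<p. (w i k)\<^sup>2) * (\<Sum>a<d. \<Sum>b<d. u a * \<Lambda> i a b * u b))"
proof (cases "(\<Sum>a<d. (u a)\<^sup>2) = 0")
  case True
  then have "u a = 0" if "a < d" for a using that by (subst (asm) sum_nonneg_eq_0_iff) auto
  then show ?thesis by simp
next
  case False
  define s where "s = sqrt (\<Sum>a<d. (u a)\<^sup>2)"
  have s: "s\<^sup>2 = (\<Sum>a<d. (u a)\<^sup>2)" "s > 0"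
    using False by (auto simp: s_def sum_nonneg order_less_le)
  define v where "v a = u a / s" for a
  have u: "u a = s * v a" for a using s by (simp add: v_def)
  have v1: "(\<Sum>a<d. (v a)\<^sup>2) = 1"
    using s by (simp add: v_def power_divide sum_divide_distrib[symmetric] s(1)[symmetric])
  have "s\<^sup>2 * (\<Sum>i<n. \<Sum>j<n. \<Sum>a<d. \<Sum>b<d. v a * A i j a b * v b * (\<Sum>k<p. w i k * w j k))
      \<le> s\<^sup>2 * (\<Sum>i<n. (\<Sum>k<p. (w i k)\<^sup>2) * (\<Sum>a<d. \<Sum>b<d. v a * \<Lambda> i a b * v b))"
    unfolding \<Lambda>_def by (intro mult_left_mono local_max_second_order[OF lm Asym v1 w]) auto
  moreover have "(\<Sum>i<n. \<Sum>j<n. \<Sum>a<d. \<Sum>b<d. u a * A i j a b * u b * (\<Sum>k<p. w i k * w j k)) =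
     s\<^sup>2 * (\<Sum>i<n. \<Sum>j<n. \<Sum>a<d. \<Sum>b<d. v a * A i j a b * v b * (\<Sum>k<p. w i k * w j k))"
    by (simp only: sum_distrib_left[of "s\<^sup>2"]) (intro sum.cong refl, simp add: u power2_eq_square)
  moreover have "(\<Sum>i<n. (\<Sum>k<p. (w i k)\<^sup>2) * (\<Sum>a<d. \<Sum>b<d. u a * \<Lambda> i a b * u b)) =
     s\<^sup>2 * (\<Sum>i<n. (\<Sum>k<p. (w i k)\<^sup>2) * (\<Sum>a<d. \<Sum>b<d. v a * \<Lambda> i a b * v b))"
  proof -
    have "(\<Sum>a<d. \<Sum>b<d. u a * \<Lambda> i a b * u b) = s\<^sup>2 * (\<Sum>a<d. \<Sum>b<d. v a * \<Lambda> i a b * v b)" for i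
      by (simp only: sum_distrib_left[of "s\<^sup>2"]) (intro sum.cong refl, simp add: u power2_eq_square)
    then show ?thesis by (subst sum_distrib_left) (simp only: mult.left_commute)
  qed
  ultimately show ?thesis by (simp only:)
qed

text \<open>The orthogonal projection \<open>I - S\<^sub>i\<^sup>T S\<^sub>i\<close>, whose columns are the test directions \<open>w\<^sub>i\<close>.\<close>
definition "Q i l k = kron l k - (\<Sum>a<d. S i a l * S i a k)"

lemma S_Q: assumes "i < n" "a < d" "l < p" shows "(\<Sum>k<p. S i a k * Q i l k) = 0"
proof -
  have "(\<Sum>k<p. S i a k * Q i l k) = (\<Sum>k<p. kron l k * S i a k) - (\<Sum>k<p. S i a k * (\<Sum>b<d. S i b l * S i b k))"
    by (simp add: Q_def algebra_simps sum_subtractf)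
  then show ?thesis using assms by (simp add: sum_kron_left stiefel_row_sum[OF S])
qed

text \<open>This is the trace of the product of two orthogonal projections of corank d. Because p >
  2d, it is positive for every pair of blocks, whatever their relative position.\<close>

lemma Q_Q:
  assumes i: "i < n" and j: "j < n"
  shows "(\<Sum>l<p. \<Sum>k<p. Q i l k * Q j l k) = real p - 2 * d + (\<Sum>a<d. \<Sum>b<d. (gram p S i j a b)\<^sup>2)"
proof -
  let ?P = "\<lambda>i l k. \<Sum>a<d. S i a l * S i a k"
  have tr: "(\<Sum>l<p. \<Sum>k<p. kron l k * ?P i l k) = d" if "i < n" for i
  proof -
    have "(\<Sum>l<p. \<Sum>k<p. kron l k * ?P i l k) = (\<Sum>l<p. ?P i l l)" by (simp add: sum_kron_left)
    also have "\<dots> = (\<Sum>a<d. \<Sum>l<p. (S i a l)\<^sup>2)" by (subst sum.swap) (simp add: power2_eq_square)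
    finally show ?thesis using stiefel_total[OF S that] by simp
  qed
  have PP: "(\<Sum>l<p. \<Sum>k<p. ?P i l k * ?P j l k) = (\<Sum>a<d. \<Sum>b<d. (gram p S i j a b)\<^sup>2)"
  proof -
    have "(\<Sum>l<p. \<Sum>k<p. ?P i l k * ?P j l k) =
      (\<Sum>l<p. \<Sum>k<p. \<Sum>a<d. \<Sum>b<d. (S i a l * S j b l) * (S i a k * S j b k))"
      by (simp add: sum_product mult_ac)
    also have "\<dots> = (\<Sum>a<d. \<Sum>b<d. \<Sum>l<p. \<Sum>k<p. (S i a l * S j b l) * (S i a k * S j b k))"
      by (subst (2) sum.swap, subst (1) sum.swap, subst (3) sum.swap, subst (2) sum.swap) (rule refl)
    also have "\<dots> = (\<Sum>a<d. \<Sum>b<d. (gram p S i j a b)\<^sup>2)"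
      by (simp add: gram_def power2_eq_square sum_product)
    finally show ?thesis .
  qed
  have kk: "(\<Sum>l<p. \<Sum>k<p. kron l k * kron l k) = p"
    by (simp add: sum_kron_left) (simp add: kron_def)
  have "(\<Sum>l<p. \<Sum>k<p. Q i l k * Q j l k) = (\<Sum>l<p. \<Sum>k<p. kron l k * kron l k)
     - (\<Sum>l<p. \<Sum>k<p. kron l k * ?P i l k) - (\<Sum>l<p. \<Sum>k<p. kron l k * ?P j l k) + (\<Sum>l<p. \<Sum>k<p. ?P i l k * ?P j l k)"
    unfolding Q_def sum_subtractf[symmetric] sum.distrib[symmetric]
    by (intro sum.cong refl) (simp add: algebra_simps)
  then show ?thesis by (simp add: tr i j PP kk)
qed

lemma Q_norm:
  assumes i: "i < n"
  shows "(\<Sum>l<p. \<Sum>k<p. (Q i l k)\<^sup>2) = real p - d"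
proof -
  have "(\<Sum>a<d. \<Sum>b<d. (gram p S i i a b)\<^sup>2) = (\<Sum>a<d. \<Sum>b<d. kron a b * kron a b)"
    using stiefelD[OF S i] by (simp add: gram_def power2_eq_square)
  also have "\<dots> = d" by (simp add: sum_kron_left) (simp add: kron_def)
  finally show ?thesis using Q_Q[OF i i] by (simp add: power2_eq_square)
qed

text \<open>Test directions supported in block i see only A_ii, which is the identity since the
  noise has zero diagonal blocks. Summing over the columns of the projection gives both sides the
  same positive factor p - d.\<close>

lemma Lam_nonneg:
  assumes i: "i < n"
  shows "(\<Sum>a<d. \<Sum>b<d. u a * \<Lambda> i a b * u b) \<ge> 0"
proof -
  let ?q = "\<Sum>a<d. \<Sum>b<d. u a * \<Lambda> i a b * u b"
  let ?r = "\<Sum>a<d. \<Sum>b<d. u a * A i i a b * u b"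
  have l: "?r * (\<Sum>k<p. (Q i l k)\<^sup>2) \<le> (\<Sum>k<p. (Q i l k)\<^sup>2) * ?q" if l: "l < p" for l
  proof -
    define w where "w j k = (if j = i then Q i l k else 0)" for j k
    have w: "(\<Sum>k<p. S j a k * w j k) = 0" if "j < n" "a < d" for j a
      using S_Q[OF i that(2) l] by (cases "j = i") (simp_all add: w_def)
    have ww: "(\<Sum>k<p. w j k * w m k) = (if j = i then if m = i then (\<Sum>k<p. (Q i l k)\<^sup>2) else 0 else 0)" for j m
      by (simp add: w_def power2_eq_square)
    have 1: "(\<Sum>a<d. \<Sum>b<d. u a * A j m a b * u b * (\<Sum>k<p. w j k * w m k)) =
      (if m = i then if j = i then ?r * (\<Sum>k<p. (Q i l k)\<^sup>2) else 0 else 0)" for j m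
      by (simp add: ww sum_distrib_right)
    have 2: "(\<Sum>k<p. (w j k)\<^sup>2) * (\<Sum>a<d. \<Sum>b<d. u a * \<Lambda> j a b * u b) = (if j = i then (\<Sum>k<p. (Q i l k)\<^sup>2) * ?q else 0)" for j
      using ww[of j j] by (simp add: power2_eq_square)
    show ?thesis using second_order[of w u, OF w] i unfolding 1 2 by (simp add: sum.delta)
  qed
  have "(\<Sum>l<p. ?r * (\<Sum>k<p. (Q i l k)\<^sup>2)) \<le> (\<Sum>l<p. (\<Sum>k<p. (Q i l k)\<^sup>2) * ?q)"
    by (intro sum_mono l) simp
  then have "?r * (real p - d) \<le> (real p - d) * ?q"
    by (simp only: sum_distrib_left[symmetric] sum_distrib_right[symmetric] Q_norm[OF i])
  moreover have "real p - d > 0" using p by simp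
  ultimately have "?r \<le> ?q" by (simp add: mult.commute)
  moreover have "?r = (\<Sum>a<d. \<Sum>b<d. kron a b * (u a * u b))"
    using i D0 by (intro sum.cong refl) (simp add: A_def)
  moreover have "\<dots> \<ge> 0" by (simp add: sum_kron_left sum_nonneg)
  ultimately show ?thesis by simp
qed

end

section \<open>Second-order optimality and the singular values of the block sum\<close>

lemma sum_Gram_squares:
  fixes s :: "'a \<Rightarrow> 'b \<Rightarrow> real"
  shows "(\<Sum>k\<in>K. \<Sum>l\<in>K. (\<Sum>e\<in>E. s e k * s e l)\<^sup>2) = (\<Sum>e\<in>E. \<Sum>f\<in>E. (\<Sum>k\<in>K. s e k * s f k)\<^sup>2)"
proof -
  let ?t = "\<lambda>e f k l. (s e k * s f k) * (s e l * s f l)"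
  have "(\<Sum>k\<in>K. \<Sum>l\<in>K. (\<Sum>e\<in>E. s e k * s e l)\<^sup>2) = (\<Sum>k\<in>K. \<Sum>l\<in>K. \<Sum>e\<in>E. \<Sum>f\<in>E. ?t e f k l)"
    unfolding power2_eq_square sum_product by (intro sum.cong refl) (simp add: mult_ac)
  also have "\<dots> = (\<Sum>k\<in>K. \<Sum>e\<in>E. \<Sum>l\<in>K. \<Sum>f\<in>E. ?t e f k l)" by (intro sum.cong refl sum.swap)
  also have "\<dots> = (\<Sum>e\<in>E. \<Sum>k\<in>K. \<Sum>l\<in>K. \<Sum>f\<in>E. ?t e f k l)" by (rule sum.swap)
  also have "\<dots> = (\<Sum>e\<in>E. \<Sum>k\<in>K. \<Sum>f\<in>E. \<Sum>l\<in>K. ?t e f k l)" by (intro sum.cong refl sum.swap)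
  also have "\<dots> = (\<Sum>e\<in>E. \<Sum>f\<in>E. \<Sum>k\<in>K. \<Sum>l\<in>K. ?t e f k l)" by (intro sum.cong refl sum.swap)
  finally show ?thesis by (simp add: power2_eq_square sum_product)
qed

context sync_max
begin

text \<open>The matrix \<open>H\<close> = S^T S has the same Frobenius norm as the Gram matrix, but
  only p diagonal entries, and these add up to nd. Cauchy-Schwarz on the diagonal gives the
  bound.\<close>

lemma gram_norm_ge: "(\<Sum>i<n. \<Sum>j<n. \<Sum>a<d. \<Sum>b<d. (gram p S i j a b)\<^sup>2) \<ge> (real n * d)\<^sup>2 / p"
proof -
  define H where "H k l = (\<Sum>i<n. \<Sum>a<d. S i a k * S i a l)" for k l
  have H2: "(\<Sum>k<p. \<Sum>l<p. (H k l)\<^sup>2) = (\<Sum>i<n. \<Sum>j<n. \<Sum>a<d. \<Sum>b<d. (gram p S i j a b)\<^sup>2)"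
  proof -
    define s where "s e k = S (fst e) (snd e) k" for e k
    have "H k l = (\<Sum>e\<in>{..<n}\<times>{..<d}. s e k * s e l)" for k l
      by (simp add: H_def s_def sum.cartesian_product case_prod_beta)
    then have "(\<Sum>k<p. \<Sum>l<p. (H k l)\<^sup>2) = (\<Sum>k<p. \<Sum>l<p. (\<Sum>e\<in>{..<n}\<times>{..<d}. s e k * s e l)\<^sup>2)"
      by (simp only:)
    also have "\<dots> = (\<Sum>e\<in>{..<n}\<times>{..<d}. \<Sum>f\<in>{..<n}\<times>{..<d}. (\<Sum>k<p. s e k * s f k)\<^sup>2)"
      by (rule sum_Gram_squares)
    also have "\<dots> = (\<Sum>i<n. \<Sum>a<d. \<Sum>j<n. \<Sum>b<d. (gram p S i j a b)\<^sup>2)"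
      by (simp add: s_def gram_def sum.cartesian_product')
    also have "\<dots> = (\<Sum>i<n. \<Sum>j<n. \<Sum>a<d. \<Sum>b<d. (gram p S i j a b)\<^sup>2)"
      by (intro sum.cong refl sum.swap)
    finally show ?thesis .
  qed
  have tr: "(\<Sum>k<p. H k k) = real n * d"
  proof -
    have "(\<Sum>k<p. H k k) = (\<Sum>i<n. \<Sum>k<p. \<Sum>a<d. (S i a k)\<^sup>2)"
      unfolding H_def by (subst sum.swap) (simp add: power2_eq_square)
    also have "\<dots> = (\<Sum>i<n. \<Sum>a<d. \<Sum>k<p. (S i a k)\<^sup>2)" by (intro sum.cong refl sum.swap)
    finally show ?thesis by (simp add: S_total)
  qed
  have "(real n * d)\<^sup>2 \<le> p * (\<Sum>k<p. (H k k)\<^sup>2)"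
    using sum_square_le[of "\<lambda>k. H k k" p] by (simp add: tr)
  also have "\<dots> \<le> p * (\<Sum>k<p. \<Sum>l<p. (H k l)\<^sup>2)"
    by (intro mult_left_mono sum_mono member_le_sum) auto
  finally show ?thesis using p unfolding H2 by (simp add: field_simps)
qed

text \<open>\<Lambda>_i is (\<open>Sb\<close> + (\<Delta>S)_i) S_i^T, and in the sum over i the
  first part becomes |u^T \<open>Sb\<close>|^2. Lower bounds on the summed multipliers thus turn
  into lower bounds on the singular values of \<open>Sb\<close>.\<close>

lemma Lam_sum:
  "(\<Sum>i<n. \<Sum>a<d. \<Sum>b<d. u a * \<Lambda> i a b * u b) =
    (\<Sum>k<p. (\<Sum>a<d. u a * Sb a k)\<^sup>2) + (\<Sum>i<n. \<Sum>k<p. (\<Sum>a<d. u a * DS i a k) * (\<Sum>a<d. u a * S i a k))"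
proof -
  have 1: "(\<Sum>a<d. \<Sum>b<d. u a * \<Lambda> i a b * u b) =
    (\<Sum>k<p. (\<Sum>a<d. u a * Sb a k) * (\<Sum>a<d. u a * S i a k)) + (\<Sum>k<p. (\<Sum>a<d. u a * DS i a k) * (\<Sum>a<d. u a * S i a k))" for i
  proof -
    have "(\<Sum>a<d. \<Sum>b<d. u a * \<Lambda> i a b * u b) = (\<Sum>a<d. \<Sum>b<d. \<Sum>k<p. (u a * (Sb a k + DS i a k)) * (u b * S i b k))"
      unfolding \<Lambda>_def lam_def sum_distrib_left sum_distrib_right
      by (intro sum.cong refl) (simp add: amul_A mult_ac)
    also have "\<dots> = (\<Sum>a<d. \<Sum>k<p. \<Sum>b<d. (u a * (Sb a k + DS i a k)) * (u b * S i b k))"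
      by (intro sum.cong refl sum.swap)
    also have "\<dots> = (\<Sum>k<p. \<Sum>a<d. \<Sum>b<d. (u a * (Sb a k + DS i a k)) * (u b * S i b k))"
      by (rule sum.swap)
    also have "\<dots> = (\<Sum>k<p. (\<Sum>a<d. u a * (Sb a k + DS i a k)) * (\<Sum>b<d. u b * S i b k))"
      by (simp only: sum_product)
    finally show ?thesis by (simp add: distrib_left distrib_right sum.distrib)
  qed
  have "(\<Sum>i<n. \<Sum>k<p. (\<Sum>a<d. u a * Sb a k) * (\<Sum>a<d. u a * S i a k)) =
    (\<Sum>k<p. \<Sum>i<n. (\<Sum>a<d. u a * Sb a k) * (\<Sum>a<d. u a * S i a k))" by (rule sum.swap)
  also have "\<dots> = (\<Sum>k<p. (\<Sum>a<d. u a * Sb a k) * (\<Sum>i<n. \<Sum>a<d. u a * S i a k))"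
    by (simp only: sum_distrib_left)
  also have "\<dots> = (\<Sum>k<p. (\<Sum>a<d. u a * Sb a k)\<^sup>2)"
  proof -
    have "(\<Sum>i<n. \<Sum>a<d. u a * S i a k) = (\<Sum>a<d. u a * Sb a k)" for k
      by (subst sum.swap) (simp add: Sb_def sum_distrib_left)
    then show ?thesis by (simp add: power2_eq_square)
  qed
  finally show ?thesis by (simp add: 1 sum.distrib)
qed

text \<open>The second-order inequality is summed over all columns of the projections
  \<open>Q i\<close>. The signal part becomes the sum of the traces from \<open>Q_Q\<close>, the
  noise costs at most L n (p - d), and the right-hand side is p - d times the quantity to be
  bounded.\<close>

lemma Lam_sum_ge:
  assumes u: "(\<Sum>a<d. (u a)\<^sup>2) = 1"
  shows "(\<Sum>i<n. \<Sum>a<d. \<Sum>b<d. u a * \<Lambda> i a b * u b) \<ge> (real n)\<^sup>2 / 2 - n * L"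
proof -
  let ?q = "\<Sum>i<n. \<Sum>a<d. \<Sum>b<d. u a * \<Lambda> i a b * u b"
  let ?g = "\<Sum>i<n. \<Sum>j<n. \<Sum>a<d. \<Sum>b<d. (gram p S i j a b)\<^sup>2"
  have QQ: "(\<Sum>l<p. \<Sum>k<p. Q i l k * Q j l k) = real p - 2 * d + (\<Sum>a<d. \<Sum>b<d. (gram p S i j a b)\<^sup>2)"
    if "i < n" "j < n" for i j using Q_Q[OF that] .
  have "(\<Sum>l<p. \<Sum>i<n. \<Sum>j<n. \<Sum>a<d. \<Sum>b<d. u a * A i j a b * u b * (\<Sum>k<p. Q i l k * Q j l k))
    \<le> (\<Sum>l<p. \<Sum>i<n. (\<Sum>k<p. (Q i l k)\<^sup>2) * (\<Sum>a<d. \<Sum>b<d. u a * \<Lambda> i a b * u b))"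
    by (intro sum_mono second_order) (auto intro: S_Q)
  also have "\<dots> = (\<Sum>i<n. \<Sum>l<p. (\<Sum>k<p. (Q i l k)\<^sup>2) * (\<Sum>a<d. \<Sum>b<d. u a * \<Lambda> i a b * u b))" by (rule sum.swap)
  also have "\<dots> = (\<Sum>i<n. (real p - d) * (\<Sum>a<d. \<Sum>b<d. u a * \<Lambda> i a b * u b))"
    by (simp only: sum_distrib_right[symmetric]) (simp add: Q_norm)
  finally have so: "(\<Sum>l<p. \<Sum>i<n. \<Sum>j<n. \<Sum>a<d. \<Sum>b<d. u a * A i j a b * u b * (\<Sum>k<p. Q i l k * Q j l k))
    \<le> (real p - d) * ?q" by (simp only: sum_distrib_left)
  have uk: "(\<Sum>a<d. \<Sum>b<d. u a * kron a b * u b) = 1"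
  proof -
    have "(\<Sum>a<d. \<Sum>b<d. u a * kron a b * u b) = (\<Sum>a<d. u a * (\<Sum>b<d. kron a b * u b))"
      by (simp only: sum_distrib_left mult.assoc)
    then show ?thesis using u by (simp add: sum_kron_left power2_eq_square)
  qed
  have "(\<Sum>a<d. \<Sum>b<d. u a * A i j a b * u b * z) = z + (\<Sum>a<d. \<Sum>b<d. u a * D i j a b * u b * z)" for i j z
  proof -
    have "(\<Sum>a<d. \<Sum>b<d. u a * A i j a b * u b * z) = (\<Sum>a<d. \<Sum>b<d. u a * kron a b * u b) * z + (\<Sum>a<d. \<Sum>b<d. u a * D i j a b * u b * z)"
      unfolding sum_distrib_right sum.distrib[symmetric] by (intro sum.cong refl) (simp add: A_def algebra_simps)
    then show ?thesis by (simp add: uk)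
  qed
  then have "(\<Sum>l<p. \<Sum>i<n. \<Sum>j<n. \<Sum>a<d. \<Sum>b<d. u a * A i j a b * u b * (\<Sum>k<p. Q i l k * Q j l k)) =
     (\<Sum>l<p. \<Sum>i<n. \<Sum>j<n. \<Sum>k<p. Q i l k * Q j l k) +
     (\<Sum>l<p. \<Sum>i<n. \<Sum>j<n. \<Sum>a<d. \<Sum>b<d. u a * D i j a b * u b * (\<Sum>k<p. Q i l k * Q j l k))"
    by (simp add: sum.distrib)
  moreover have "(\<Sum>l<p. \<Sum>i<n. \<Sum>j<n. \<Sum>k<p. Q i l k * Q j l k) = (real n)\<^sup>2 * (real p - 2 * d) + ?g"
  proof -
    have "(\<Sum>l<p. \<Sum>i<n. \<Sum>j<n. \<Sum>k<p. Q i l k * Q j l k) = (\<Sum>i<n. \<Sum>l<p. \<Sum>j<n. \<Sum>k<p. Q i l k * Q j l k)" by (rule sum.swap)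
    also have "\<dots> = (\<Sum>i<n. \<Sum>j<n. \<Sum>l<p. \<Sum>k<p. Q i l k * Q j l k)" by (intro sum.cong refl sum.swap)
    also have "\<dots> = (real n)\<^sup>2 * (real p - 2 * d) + ?g" by (simp add: QQ sum.distrib sum_subtractf power2_eq_square algebra_simps)
    finally show ?thesis .
  qed
  moreover have "(\<Sum>l<p. \<Sum>i<n. \<Sum>j<n. \<Sum>a<d. \<Sum>b<d. u a * D i j a b * u b * (\<Sum>k<p. Q i l k * Q j l k))
     \<ge> - (L * (real n * (real p - d)))"
  proof -
    have "(\<Sum>i<n. \<Sum>j<n. \<Sum>a<d. \<Sum>b<d. u a * D i j a b * u b * (\<Sum>k<p. Q i l k * Q j l k)) =
      (\<Sum>k<p. \<Sum>i<n. \<Sum>j<n. \<Sum>a<d. \<Sum>b<d. (u a * Q i l k) * D i j a b * (u b * Q j l k))" for l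
    proof -
      have "(\<Sum>i<n. \<Sum>j<n. \<Sum>a<d. \<Sum>b<d. u a * D i j a b * u b * (\<Sum>k<p. Q i l k * Q j l k)) =
        (\<Sum>i<n. \<Sum>j<n. \<Sum>a<d. \<Sum>b<d. \<Sum>k<p. (u a * Q i l k) * D i j a b * (u b * Q j l k))"
        by (simp add: sum_distrib_left mult_ac)
      then show ?thesis by (simp only: sum.swap[of _ "{..<p}"])
    qed
    moreover have "(\<Sum>i<n. \<Sum>j<n. \<Sum>a<d. \<Sum>b<d. (u a * Q i l k) * D i j a b * (u b * Q j l k)) \<ge> - (L * (\<Sum>i<n. (Q i l k)\<^sup>2))" for l k
    proof -
      have e: "(\<Sum>i<n. \<Sum>a<d. (u a * Q i l k)\<^sup>2) = (\<Sum>i<n. (Q i l k)\<^sup>2)"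
        by (simp add: power_mult_distrib sum_distrib_right[symmetric] u)
      have nn: "(\<Sum>i<n. (Q i l k)\<^sup>2) \<ge> 0" by (simp add: sum_nonneg)
      have "\<bar>\<Sum>i<n. \<Sum>j<n. \<Sum>a<d. \<Sum>b<d. (u a * Q i l k) * D i j a b * (u b * Q j l k)\<bar> \<le> L * (\<Sum>i<n. (Q i l k)\<^sup>2)"
        using Dop[of "\<lambda>i a. u a * Q i l k" "\<lambda>i a. u a * Q i l k"] nn unfolding e by (simp add: mult.assoc)
      then show ?thesis by linarith
    qed
    ultimately have "(\<Sum>l<p. \<Sum>i<n. \<Sum>j<n. \<Sum>a<d. \<Sum>b<d. u a * D i j a b * u b * (\<Sum>k<p. Q i l k * Q j l k)) \<ge>
       (\<Sum>l<p. \<Sum>k<p. - (L * (\<Sum>i<n. (Q i l k)\<^sup>2)))"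
      by (simp only:) (intro sum_mono, simp)
    moreover have "(\<Sum>l<p. \<Sum>k<p. (\<Sum>i<n. (Q i l k)\<^sup>2)) = (real p - d) * n"
    proof -
      have "(\<Sum>l<p. \<Sum>k<p. (\<Sum>i<n. (Q i l k)\<^sup>2)) = (\<Sum>l<p. \<Sum>i<n. (\<Sum>k<p. (Q i l k)\<^sup>2))" by (intro sum.cong refl sum.swap)
      also have "\<dots> = (\<Sum>i<n. \<Sum>l<p. (\<Sum>k<p. (Q i l k)\<^sup>2))" by (rule sum.swap)
      finally show ?thesis by (simp add: Q_norm)
    qed
    ultimately show ?thesis by (simp add: sum_negf sum_distrib_left[symmetric] mult.commute)
  qed
  ultimately have 1: "(real n)\<^sup>2 * (real p - 2 * d) + ?g - L * (real n * (real p - d)) \<le> (real p - d) * ?q"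
    using so by linarith
  have pd: "real p - d > 0" "real p > 0" using p by simp_all
  \<comment> \<open>This is p (p - 2d) + d^2 = (p - d)^2: the Gram term completes the square, so one
    factor p - d cancels against the right-hand side.\<close>
  have "(real n)\<^sup>2 * (real p - 2 * d) + (real n * d)\<^sup>2 / p = (real p - d) * ((real n)\<^sup>2 * ((real p - d) / p))"
    using pd by (simp add: field_simps power2_eq_square)
  then have "(real p - d) * ((real n)\<^sup>2 * ((real p - d) / p) - L * n) \<le> (real p - d) * ?q"
    using 1 gram_norm_ge by (simp add: algebra_simps)
  then have "(real n)\<^sup>2 * ((real p - d) / p) - L * n \<le> ?q" using pd by (simp add: mult_le_cancel_left)
  \<comment> \<open>(p - d)/p >= 1/2 because p >= 2d.\<close>
  moreover have "(real n)\<^sup>2 * (1 / 2) \<le> (real n)\<^sup>2 * ((real p - d) / p)"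
    using p by (intro mult_left_mono) (auto simp: field_simps)
  ultimately show ?thesis by (simp add: mult.commute)
qed

text \<open>The two bounds are those by \<open>|\<Delta>|\<surd>n\<close> and \<open>|\<Delta>|\<surd>d\<close>; neither suffices for all \<open>d\<close>, but their
  geometric mean does.\<close>
lemma noise_small:
  assumes "y\<^sup>2 \<le> (real n)\<^sup>2 * (L\<^sup>2 * n)" "y\<^sup>2 \<le> (real n)\<^sup>2 * (L\<^sup>2 * d)"
  shows "\<bar>y\<bar> \<le> (real n)\<^sup>2 / 16"
proof -
  have "y\<^sup>2 * y\<^sup>2 \<le> ((real n)\<^sup>2 * (L\<^sup>2 * n)) * ((real n)\<^sup>2 * (L\<^sup>2 * d))"
    using assms by (intro mult_mono) auto
  also have "\<dots> = (real n)^4 * (L ^ 4 * (real n * d))" by (simp add: power2_eq_square power4_eq_xxxx)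
  also have "\<dots> \<le> (real n)^4 * (n / 16) ^ 4" using Lnd by (intro mult_left_mono) auto
  finally have "\<bar>y\<bar> ^ 4 \<le> ((real n)\<^sup>2 / 16) ^ 4"
    by (simp add: power2_eq_square power4_eq_xxxx)
  then show ?thesis using power_mono_iff[of "\<bar>y\<bar>" "(real n)\<^sup>2 / 16" 4] by simp
qed

text \<open>The main term n^2/2 loses n^2/16 twice, once to the noise in the second-order condition
  and once to the cross term \<open>?y\<close> of \<open>Lam_sum\<close>; the remaining 3/8 exceeds
  1/4. The two estimates \<open>y1\<close> and \<open>y2\<close> of the cross term are what
  \<open>noise_small\<close> combines.\<close>

lemma Sb_unit_lower:
  assumes u: "(\<Sum>a<d. (u a)\<^sup>2) = 1"
  shows "(\<Sum>k<p. (\<Sum>a<d. u a * Sb a k)\<^sup>2) \<ge> (n / 2)\<^sup>2"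
proof -
  let ?y = "\<Sum>i<n. \<Sum>k<p. (\<Sum>a<d. u a * DS i a k) * (\<Sum>a<d. u a * S i a k)"
  let ?z = "\<Sum>i<n. \<Sum>k<p. (\<Sum>a<d. u a * DS i a k)\<^sup>2"
  have "?y\<^sup>2 \<le> ?z * (\<Sum>i<n. \<Sum>k<p. (\<Sum>a<d. u a * S i a k)\<^sup>2)" by (rule double_sum_Cauchy_Schwarz)
  also have "(\<Sum>i<n. \<Sum>k<p. (\<Sum>a<d. u a * S i a k)\<^sup>2) = n" using u by (simp add: stiefel_row_norm[OF S])
  finally have y: "?y\<^sup>2 \<le> ?z * n" .
  have "?z \<le> (\<Sum>i<n. n * (L\<^sup>2 * (\<Sum>a<d. (u a)\<^sup>2)))" by (intro sum_mono uDS_le_n) auto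
  then have "?z * n \<le> (real n * (n * L\<^sup>2)) * n" using u by (intro mult_right_mono) auto
  with y have y1: "?y\<^sup>2 \<le> (real n)\<^sup>2 * (L\<^sup>2 * n)" by (simp add: power2_eq_square mult_ac)
  have "?z \<le> (\<Sum>i<n. (\<Sum>a<d. (u a)\<^sup>2) * (\<Sum>a<d. \<Sum>k<p. (DS i a k)\<^sup>2))" by (intro sum_mono uDS_le_F)
  also have "\<dots> \<le> L\<^sup>2 * (real n * d)" using DS_total u by simp
  finally have "?z * n \<le> (L\<^sup>2 * (real n * d)) * n" by (intro mult_right_mono) auto
  with y have y2: "?y\<^sup>2 \<le> (real n)\<^sup>2 * (L\<^sup>2 * d)" by (simp add: power2_eq_square mult_ac)
  have "\<bar>?y\<bar> \<le> (real n)\<^sup>2 / 16" by (rule noise_small[OF y1 y2])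
  moreover have "n * L \<le> (real n)\<^sup>2 / 16" using mult_left_mono[OF L_le, of "real n"] by (simp add: power2_eq_square)
  ultimately have "(\<Sum>k<p. (\<Sum>a<d. u a * Sb a k)\<^sup>2) \<ge> (real n)\<^sup>2 / 2 - (real n)\<^sup>2 / 16 - (real n)\<^sup>2 / 16"
    using Lam_sum_ge[OF u] Lam_sum[of u] by linarith
  moreover have "(real n)\<^sup>2 \<ge> 0" "(n / 2)\<^sup>2 = (real n)\<^sup>2 / 4" by (simp_all add: power_divide)
  ultimately show ?thesis by linarith
qed

lemma Sb_lower: "(\<Sum>k<p. (\<Sum>a<d. u a * Sb a k)\<^sup>2) \<ge> (n / 2)\<^sup>2 * (\<Sum>a<d. (u a)\<^sup>2)"
proof (cases "(\<Sum>a<d. (u a)\<^sup>2) = 0")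
  case True
  then show ?thesis by (simp add: sum_nonneg)
next
  case False
  define s where "s = sqrt (\<Sum>a<d. (u a)\<^sup>2)"
  have s: "s\<^sup>2 = (\<Sum>a<d. (u a)\<^sup>2)" "s > 0"
    using False by (auto simp: s_def sum_nonneg order_less_le)
  define v where "v a = u a / s" for a
  have u: "u a = s * v a" for a using s by (simp add: v_def)
  have v1: "(\<Sum>a<d. (v a)\<^sup>2) = 1"
    using s by (simp add: v_def power_divide sum_divide_distrib[symmetric] s(1)[symmetric])
  have "s\<^sup>2 * (n / 2)\<^sup>2 \<le> s\<^sup>2 * (\<Sum>k<p. (\<Sum>a<d. v a * Sb a k)\<^sup>2)"
    by (intro mult_left_mono Sb_unit_lower v1) simp
  also have "\<dots> = (\<Sum>k<p. (\<Sum>a<d. u a * Sb a k)\<^sup>2)"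
    by (simp add: u mult.assoc sum_distrib_left[symmetric] power_mult_distrib)
  finally show ?thesis by (simp add: s(1) mult.commute)
qed

text \<open>\<open>S\<^sub>i\<close> is the polar factor of \<open>\<Lambda>\<^sub>i S\<^sub>i\<close>, so \<open>\<Lambda>\<^sub>i\<close> has the singular values of
  \<open>\<Sum>S\<^sub>j + (\<Delta> S)\<^sub>i\<close>; second-order optimality gives their sign.\<close>
lemma Lam_lower:
  assumes i: "i < n" and e: "e \<ge> 0" "e < n / 2"
    and DSe: "\<And>u. (\<Sum>k<p. (\<Sum>a<d. u a * DS i a k)\<^sup>2) \<le> e\<^sup>2 * (\<Sum>a<d. (u a)\<^sup>2)"
  shows "(\<Sum>a<d. \<Sum>b<d. u a * \<Lambda> i a b * u b) \<ge> (n / 2 - e) * (\<Sum>a<d. (u a)\<^sup>2)"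
proof (rule psd_lower_bound)
  show "\<Lambda> i a b = \<Lambda> i b a" if "a < d" "b < d" for a b using Lam_sym i that .
  show "(\<Sum>a<d. \<Sum>b<d. x a * \<Lambda> i a b * x b) \<ge> 0" for x by (rule Lam_nonneg[OF i])
  show "n / 2 - e > 0" using e by simp
  fix x :: "nat \<Rightarrow> real"
  define N where "N = L2_set x {..<d}"
  have N: "N\<^sup>2 = (\<Sum>a<d. (x a)\<^sup>2)" "N \<ge> 0" by (simp_all add: N_def L2_set_def sum_nonneg)
  let ?f = "\<lambda>k. \<Sum>a<d. x a * Sb a k" and ?g = "\<lambda>k. \<Sum>a<d. x a * DS i a k"
  have "(\<Sum>a<d. (\<Sum>b<d. \<Lambda> i a b * x b)\<^sup>2) = (\<Sum>k<p. (\<Sum>a<d. (\<Sum>b<d. \<Lambda> i a b * x b) * S i a k)\<^sup>2)"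
    by (rule stiefel_row_norm[OF S i, symmetric])
  also have "\<dots> = (\<Sum>k<p. (?f k + ?g k)\<^sup>2)"
  proof (intro sum.cong refl)
    fix k assume k: "k \<in> {..<p}"
    have "(\<Sum>a<d. (\<Sum>b<d. \<Lambda> i a b * x b) * S i a k) = (\<Sum>a<d. \<Sum>b<d. x b * (\<Lambda> i b a * S i a k))"
      unfolding sum_distrib_right using Lam_sym[OF i] by (intro sum.cong refl) (simp add: mult_ac)
    also have "\<dots> = (\<Sum>b<d. \<Sum>a<d. x b * (\<Lambda> i b a * S i a k))" by (rule sum.swap)
    also have "\<dots> = (\<Sum>b<d. x b * (Sb b k + DS i b k))"
      unfolding sum_distrib_left[symmetric] using Lam_S[OF i] k by (intro sum.cong refl) simp
    finally show "(\<Sum>a<d. (\<Sum>b<d. \<Lambda> i a b * x b) * S i a k)\<^sup>2 = (?f k + ?g k)\<^sup>2"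
      by (simp add: distrib_left sum.distrib)
  qed
  finally have eq: "(\<Sum>a<d. (\<Sum>b<d. \<Lambda> i a b * x b)\<^sup>2) = (L2_set (\<lambda>k. ?f k + ?g k) {..<p})\<^sup>2"
    by (simp add: L2_set_def sum_nonneg)
  have f: "n / 2 * N \<le> L2_set ?f {..<p}"
    unfolding L2_set_def using Sb_lower[of x] by (intro real_le_rsqrt) (simp only: N power_mult_distrib)
  have g: "L2_set ?g {..<p} \<le> e * N"
    unfolding L2_set_def using DSe[of x] e N by (intro real_le_lsqrt) (auto simp: power_mult_distrib intro: sum_nonneg)
  have "(n / 2 - e) * N \<le> L2_set (\<lambda>k. ?f k + ?g k) {..<p}"
    using L2_set_diff_ge[of ?f "{..<p}" ?g] f g by (simp add: algebra_simps)
  then have "((n / 2 - e) * N)\<^sup>2 \<le> (L2_set (\<lambda>k. ?f k + ?g k) {..<p})\<^sup>2"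
    by (rule power_mono) (use e N in simp)
  then show "(n / 2 - e)\<^sup>2 * (\<Sum>a<d. (x a)\<^sup>2) \<le> (\<Sum>a<d. (\<Sum>b<d. \<Lambda> i a b * x b)\<^sup>2)"
    by (simp add: eq N power_mult_distrib)
qed

end

section \<open>Perturbation of polar factors and uniform control of the noise\<close>

lemma sum_ge_card_mult_member:
  fixes f :: "nat \<Rightarrow> real"
  assumes "n \<ge> 1" shows "\<exists>i<n. n * f i \<le> (\<Sum>i<n. f i)"
proof (rule ccontr)
  assume "\<not> ?thesis"
  then have "(\<Sum>j<n. (\<Sum>i<n. f i)) < (\<Sum>j<n. n * f j)"
    using assms by (intro sum_strict_mono) (auto simp: lessThan_empty_iff)
  then show False by (simp add: sum_distrib_left)
qed

lemma L2_set_le: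
  assumes "(\<Sum>i\<in>I. (f i)\<^sup>2) \<le> c\<^sup>2 * m" "c \<ge> 0" "m \<ge> 0"
  shows "L2_set f I \<le> c * sqrt m"
  unfolding L2_set_def using assms by (intro real_le_lsqrt) (simp_all add: power_mult_distrib)

text \<open>Applied with \<open>T\<close> and \<open>U\<close> in both orders, this is the perturbation bound for polar factors.\<close>
lemma polar_pairing:
  fixes M T U :: "nat \<Rightarrow> nat \<Rightarrow> real"
  assumes sym: "\<And>a b. a < d \<Longrightarrow> b < d \<Longrightarrow> M a b = M b a"
    and T: "\<And>a b. a < d \<Longrightarrow> b < d \<Longrightarrow> (\<Sum>k<p. T a k * T b k) = kron a b"
    and U: "\<And>a b. a < d \<Longrightarrow> b < d \<Longrightarrow> (\<Sum>k<p. U a k * U b k) = kron a b"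
  shows "2 * (\<Sum>a<d. \<Sum>k<p. (\<Sum>b<d. M a b * T b k) * (T a k - U a k)) =
    (\<Sum>k<p. \<Sum>a<d. \<Sum>b<d. (T a k - U a k) * M a b * (T b k - U b k))"
proof -
  define br where "br X Y = (\<Sum>a<d. \<Sum>b<d. M a b * (\<Sum>k<p. X a k * Y b k))" for X Y :: "nat \<Rightarrow> nat \<Rightarrow> real"
  have brs: "br X Y = br Y X" for X Y
  proof -
    have "br X Y = (\<Sum>b<d. \<Sum>a<d. M a b * (\<Sum>k<p. X a k * Y b k))" unfolding br_def by (rule sum.swap)
    also have "\<dots> = br Y X" unfolding br_def using sym by (intro sum.cong refl) (simp add: mult.commute)
    finally show ?thesis .
  qed
  have d1: "br (\<lambda>a k. X a k - Y a k) Z = br X Z - br Y Z" for X Y Z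
    by (simp add: br_def left_diff_distrib right_diff_distrib sum_subtractf)
  have TU: "br T T = br U U" unfolding br_def using T U by simp
  have l: "(\<Sum>a<d. \<Sum>k<p. (\<Sum>b<d. M a b * T b k) * (T a k - U a k)) = br (\<lambda>a k. T a k - U a k) T"
  proof -
    have "(\<Sum>a<d. \<Sum>k<p. (\<Sum>b<d. M a b * T b k) * (T a k - U a k)) = (\<Sum>a<d. \<Sum>k<p. \<Sum>b<d. M a b * ((T a k - U a k) * T b k))"
      unfolding sum_distrib_right by (intro sum.cong refl) simp
    also have "\<dots> = (\<Sum>a<d. \<Sum>b<d. \<Sum>k<p. M a b * ((T a k - U a k) * T b k))" by (intro sum.cong refl sum.swap)
    finally show ?thesis by (simp add: br_def sum_distrib_left)
  qed
  have r: "(\<Sum>k<p. \<Sum>a<d. \<Sum>b<d. V a k * M a b * V b k) = br V V" for V :: "nat \<Rightarrow> nat \<Rightarrow> real"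
  proof -
    have "(\<Sum>k<p. \<Sum>a<d. \<Sum>b<d. V a k * M a b * V b k) = (\<Sum>a<d. \<Sum>b<d. \<Sum>k<p. V a k * M a b * V b k)"
      by (simp only: sum.swap[of _ "{..<p}"])
    then show ?thesis by (simp add: br_def sum_distrib_left mult_ac)
  qed
  have "br (\<lambda>a k. T a k - U a k) (\<lambda>a k. T a k - U a k) = br T T - br T U - br U T + br U U"
    by (simp add: d1 brs[of _ "\<lambda>a k. T a k - U a k"])
  then show ?thesis unfolding l r d1 using brs[of T U] TU by simp
qed

context sync_max
begin

text \<open>The reference block is one whose noise is at most average in Frobenius norm. There both
  bounds on u^T (\<Delta>S)_i are available with factors n and d, and their geometric mean is small
  by \<open>Lnd\<close>; the average says nothing comparable about an arbitrary block.\<close>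

lemma good_block:
  obtains i0 where "i0 < n" "\<And>u. (\<Sum>k<p. (\<Sum>a<d. u a * DS i0 a k)\<^sup>2) \<le> (n / 16)\<^sup>2 * (\<Sum>a<d. (u a)\<^sup>2)"
    "(\<Sum>a<d. \<Sum>k<p. (DS i0 a k)\<^sup>2) \<le> L\<^sup>2 * d"
proof -
  obtain i0 where i0: "i0 < n" "n * (\<Sum>a<d. \<Sum>k<p. (DS i0 a k)\<^sup>2) \<le> (\<Sum>i<n. \<Sum>a<d. \<Sum>k<p. (DS i a k)\<^sup>2)"
    using sum_ge_card_mult_member[OF n1, of "\<lambda>i. \<Sum>a<d. \<Sum>k<p. (DS i a k)\<^sup>2"] by blast
  have "n * (\<Sum>a<d. \<Sum>k<p. (DS i0 a k)\<^sup>2) \<le> n * (L\<^sup>2 * d)"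
    using i0(2) DS_total by (simp add: mult_ac)
  then have F: "(\<Sum>a<d. \<Sum>k<p. (DS i0 a k)\<^sup>2) \<le> L\<^sup>2 * d" using n1 by simp
  have "(\<Sum>k<p. (\<Sum>a<d. u a * DS i0 a k)\<^sup>2) \<le> (n / 16)\<^sup>2 * (\<Sum>a<d. (u a)\<^sup>2)" for u
  proof -
    define z m where "z = (\<Sum>k<p. (\<Sum>a<d. u a * DS i0 a k)\<^sup>2)" and "m = (\<Sum>a<d. (u a)\<^sup>2)"
    have nn: "z \<ge> 0" "m \<ge> 0" by (simp_all add: z_def m_def sum_nonneg)
    have z1: "z \<le> n * (L\<^sup>2 * m)" unfolding z_def m_def by (rule uDS_le_n[OF i0(1)])
    have z2: "z \<le> m * (L\<^sup>2 * d)" unfolding z_def m_def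
      using uDS_le_F[of u i0] F by (elim order_trans) (intro mult_left_mono F, simp add: sum_nonneg)
    have "z * z \<le> (n * (L\<^sup>2 * m)) * (m * (L\<^sup>2 * d))" using nn by (intro mult_mono z1 z2) auto
    also have "\<dots> = m\<^sup>2 * (L^4 * (real n * d))" by (simp add: power2_eq_square power4_eq_xxxx)
    also have "\<dots> \<le> m\<^sup>2 * (n / 16) ^ 4" using Lnd by (intro mult_left_mono) auto
    also have "\<dots> = ((n / 16)\<^sup>2 * m)\<^sup>2" by (simp add: power2_eq_square power4_eq_xxxx)
    finally have "z\<^sup>2 \<le> ((n / 16)\<^sup>2 * m)\<^sup>2" by (simp add: power2_eq_square)
    then show "z \<le> (n / 16)\<^sup>2 * m" using nn by (rule_tac power2_le_imp_le) auto
  qed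
  with i0(1) F show ?thesis using that by blast
qed

text \<open>In \<Lambda>_i S_i - \<Lambda>_i0 S_i0 the common term \<open>Sb\<close> cancels and
  only a difference of noise blocks remains. Pairing it with S_i - S_i0 and using
  \<open>polar_pairing\<close> in both orders leaves two quadratic forms. Coercivity is taken from
  \<Lambda>_i0 alone, as only \<Lambda>_i >= 0 is known so far for general i.\<close>

lemma block_distance:
  assumes i: "i < n" and i0: "i0 < n"
    and good: "\<And>u. (\<Sum>k<p. (\<Sum>a<d. u a * DS i0 a k)\<^sup>2) \<le> (n / 16)\<^sup>2 * (\<Sum>a<d. (u a)\<^sup>2)"
  shows "(\<Sum>a<d. \<Sum>k<p. (S i a k - S i0 a k)\<^sup>2) \<le> 64 / (real n)\<^sup>2 * (\<Sum>a<d. \<Sum>k<p. (DS i a k - DS i0 a k)\<^sup>2)"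
proof -
  define E where "E a k = S i a k - S i0 a k" for a k
  define X where "X = (\<Sum>a<d. \<Sum>k<p. (E a k)\<^sup>2)"
  define Y where "Y = (\<Sum>a<d. \<Sum>k<p. (DS i a k - DS i0 a k)\<^sup>2)"
  have nn: "X \<ge> 0" "Y \<ge> 0" by (simp_all add: X_def Y_def sum_nonneg)
  have n0: "real n > 0" using n1 by simp
  let ?s = "\<Sum>a<d. \<Sum>k<p. (DS i a k - DS i0 a k) * E a k"
  have 1: "2 * (\<Sum>a<d. \<Sum>k<p. (\<Sum>b<d. \<Lambda> i a b * S i b k) * (S i a k - S i0 a k)) =
    (\<Sum>k<p. \<Sum>a<d. \<Sum>b<d. (S i a k - S i0 a k) * \<Lambda> i a b * (S i b k - S i0 b k))"
    using Lam_sym[OF i] stiefelD[OF S i] stiefelD[OF S i0] by (intro polar_pairing) auto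
  have 2: "2 * (\<Sum>a<d. \<Sum>k<p. (\<Sum>b<d. \<Lambda> i0 a b * S i0 b k) * (S i0 a k - S i a k)) =
    (\<Sum>k<p. \<Sum>a<d. \<Sum>b<d. (S i0 a k - S i a k) * \<Lambda> i0 a b * (S i0 b k - S i b k))"
    using Lam_sym[OF i0] stiefelD[OF S i] stiefelD[OF S i0] by (intro polar_pairing) auto
  have 3: "(\<Sum>a<d. \<Sum>b<d. E a k * \<Lambda> i a b * E b k) \<ge> 0" for k
    by (rule Lam_nonneg[OF i])
  have 4: "(\<Sum>a<d. \<Sum>b<d. (S i0 a k - S i a k) * \<Lambda> i0 a b * (S i0 b k - S i b k)) \<ge> (n / 2 - n / 16) * (\<Sum>a<d. (S i0 a k - S i a k)\<^sup>2)" for k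
    using n0 good by (intro Lam_lower i0) auto
  have "?s = (\<Sum>a<d. \<Sum>k<p. ((\<Sum>b<d. \<Lambda> i a b * S i b k) - (\<Sum>b<d. \<Lambda> i0 a b * S i0 b k)) * E a k)"
    using Lam_S[OF i] Lam_S[OF i0] by (intro sum.cong refl) simp
  also have "\<dots> = (\<Sum>a<d. \<Sum>k<p. (\<Sum>b<d. \<Lambda> i a b * S i b k) * (S i a k - S i0 a k)) +
     (\<Sum>a<d. \<Sum>k<p. (\<Sum>b<d. \<Lambda> i0 a b * S i0 b k) * (S i0 a k - S i a k))"
    unfolding sum.distrib[symmetric] by (intro sum.cong refl) (simp add: E_def algebra_simps)
  finally have "2 * ?s = (\<Sum>k<p. \<Sum>a<d. \<Sum>b<d. E a k * \<Lambda> i a b * E b k) +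
      (\<Sum>k<p. \<Sum>a<d. \<Sum>b<d. (S i0 a k - S i a k) * \<Lambda> i0 a b * (S i0 b k - S i b k))"
    using 1 2 by (simp add: E_def)
  also have "\<dots> \<ge> 0 + (\<Sum>k<p. (n / 2 - n / 16) * (\<Sum>a<d. (S i0 a k - S i a k)\<^sup>2))"
    by (intro add_mono sum_mono 4 sum_nonneg 3)
  also have "(\<Sum>k<p. (n / 2 - n / 16) * (\<Sum>a<d. (S i0 a k - S i a k)\<^sup>2)) = (n / 2 - n / 16) * X"
  proof -
    have "X = (\<Sum>k<p. \<Sum>a<d. (E a k)\<^sup>2)" unfolding X_def by (rule sum.swap)
    also have "\<dots> = (\<Sum>k<p. \<Sum>a<d. (S i0 a k - S i a k)\<^sup>2)"
      by (intro sum.cong refl) (simp add: E_def power2_commute)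
    finally show ?thesis by (simp only: sum_distrib_left)
  qed
  finally have "7 / 16 * (n * X) \<le> 2 * ?s" by (simp add: algebra_simps)
  moreover have "n * X \<ge> 0" using nn by simp
  \<comment> \<open>The factor 7/32 is rounded down to 1/8, whose inverse square is the 64 of the
    conclusion.\<close>
  ultimately have "n / 8 * X \<le> ?s" by linarith
  then have "(n / 8 * X)\<^sup>2 \<le> ?s\<^sup>2" by (rule power_mono) (use nn in simp)
  also have "\<dots> \<le> Y * X" unfolding X_def Y_def by (rule double_sum_Cauchy_Schwarz)
  finally have "X * X \<le> (64 / (real n)\<^sup>2) * X * Y"
    using n0 by (simp add: field_simps power2_eq_square)
  then have "X \<le> (64 / (real n)\<^sup>2) * Y" using nn by (rule_tac le_square_div_self) auto
  then show ?thesis by (simp add: X_def Y_def E_def)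
qed

lemma total_distance:
  assumes i0: "i0 < n"
    and good: "\<And>u. (\<Sum>k<p. (\<Sum>a<d. u a * DS i0 a k)\<^sup>2) \<le> (n / 16)\<^sup>2 * (\<Sum>a<d. (u a)\<^sup>2)"
    and F: "(\<Sum>a<d. \<Sum>k<p. (DS i0 a k)\<^sup>2) \<le> L\<^sup>2 * d"
  shows "(\<Sum>i<n. \<Sum>a<d. \<Sum>k<p. (S i a k - S i0 a k)\<^sup>2) \<le> 256 * L\<^sup>2 * d / n"
proof -
  let ?f = "\<lambda>i. \<Sum>a<d. \<Sum>k<p. (DS i a k)\<^sup>2"
  have n0: "real n > 0" using n1 by simp
  have "(\<Sum>a<d. \<Sum>k<p. (S i a k - S i0 a k)\<^sup>2) \<le> 64 / (real n)\<^sup>2 * (2 * ?f i + 2 * ?f i0)" if "i < n" for i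
  proof -
    have sq: "(x - y)\<^sup>2 \<le> 2 * x\<^sup>2 + 2 * y\<^sup>2" for x y :: real
      using zero_le_power2[of "x + y"] by (simp add: power2_eq_square algebra_simps)
    have "(\<Sum>a<d. \<Sum>k<p. (DS i a k - DS i0 a k)\<^sup>2) \<le> (\<Sum>a<d. \<Sum>k<p. 2 * (DS i a k)\<^sup>2 + 2 * (DS i0 a k)\<^sup>2)"
      by (intro sum_mono sq)
    also have "\<dots> = 2 * ?f i + 2 * ?f i0" by (simp add: sum.distrib sum_distrib_left)
    finally have "64 / (real n)\<^sup>2 * (\<Sum>a<d. \<Sum>k<p. (DS i a k - DS i0 a k)\<^sup>2) \<le> 64 / (real n)\<^sup>2 * (2 * ?f i + 2 * ?f i0)"
      by (intro mult_left_mono) auto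
    with block_distance[OF that i0 good] show ?thesis by linarith
  qed
  then have "(\<Sum>i<n. \<Sum>a<d. \<Sum>k<p. (S i a k - S i0 a k)\<^sup>2) \<le> (\<Sum>i<n. 64 / (real n)\<^sup>2 * (2 * ?f i + 2 * ?f i0))"
    by (intro sum_mono) simp
  also have "\<dots> = 64 / (real n)\<^sup>2 * (\<Sum>i<n. 2 * ?f i + 2 * ?f i0)" by (simp only: sum_distrib_left)
  also have "\<dots> = 64 / (real n)\<^sup>2 * (2 * (\<Sum>i<n. ?f i) + 2 * (n * ?f i0))"
    by (simp only: sum.distrib sum_distrib_left[symmetric]) simp
  also have "\<dots> \<le> 64 / (real n)\<^sup>2 * (2 * (L\<^sup>2 * (real n * d)) + 2 * (n * (L\<^sup>2 * d)))"
    by (intro mult_left_mono add_mono DS_total F) auto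
  also have "\<dots> = 256 * L\<^sup>2 * d / n" using n0 by (simp add: field_simps power2_eq_square)
  finally show ?thesis .
qed

text \<open>Writing S_j = S_i0 + (S_j - S_i0) splits u^T (\<Delta>S)_i. The first part
  \<open>?f\<close> is u^T times a block row sum of the noise, times the isometry S_i0, hence
  controlled by B; the second part \<open>?h\<close> is controlled by Cauchy-Schwarz from
  \<open>D_row\<close> and \<open>total_distance\<close>. Each contributes n/16.\<close>

lemma uDS_small:
  assumes i: "i < n"
  shows "(\<Sum>k<p. (\<Sum>a<d. u a * DS i a k)\<^sup>2) \<le> (n / 8)\<^sup>2 * (\<Sum>a<d. (u a)\<^sup>2)"
proof -
  obtain i0 where i0: "i0 < n" "\<And>u. (\<Sum>k<p. (\<Sum>a<d. u a * DS i0 a k)\<^sup>2) \<le> (n / 16)\<^sup>2 * (\<Sum>a<d. (u a)\<^sup>2)"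
    "(\<Sum>a<d. \<Sum>k<p. (DS i0 a k)\<^sup>2) \<le> L\<^sup>2 * d" by (rule good_block) blast
  have n0: "real n > 0" using n1 by simp
  define g where "g j b = (\<Sum>a<d. u a * D i j a b)" for j b
  define v where "v b = (\<Sum>j<n. g j b)" for b
  define m where "m = (\<Sum>a<d. (u a)\<^sup>2)"
  have m: "m \<ge> 0" by (simp add: m_def sum_nonneg)
  let ?f = "\<lambda>k. \<Sum>b<d. v b * S i0 b k" and ?h = "\<lambda>k. \<Sum>j<n. \<Sum>b<d. g j b * (S j b k - S i0 b k)"
  have split: "(\<Sum>a<d. u a * DS i a k) = ?f k + ?h k" for k
  proof -
    have "?f k = (\<Sum>j<n. \<Sum>b<d. g j b * S i0 b k)"
      by (subst sum.swap) (simp add: v_def sum_distrib_right)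
    then show ?thesis unfolding uDS_eq g_def[symmetric]
      by (simp add: right_diff_distrib sum_subtractf)
  qed
  have "(\<Sum>b<d. (v b)\<^sup>2) = (\<Sum>b<d. \<Sum>j<n. \<Sum>a<d. u a * D i j a b * v b)"
    unfolding power2_eq_square by (subst (1) v_def) (simp add: g_def sum_distrib_right)
  also have "\<dots> = (\<Sum>j<n. \<Sum>b<d. \<Sum>a<d. u a * D i j a b * v b)" by (rule sum.swap)
  also have "\<dots> = (\<Sum>j<n. \<Sum>a<d. \<Sum>b<d. u a * D i j a b * v b)" by (intro sum.cong refl sum.swap)
  also have "\<dots> \<le> B * sqrt (\<Sum>b<d. (v b)\<^sup>2) * sqrt m"
    using Bop[OF i, of u v] by (simp add: m_def mult_ac)
  finally have v: "(\<Sum>b<d. (v b)\<^sup>2) \<le> B\<^sup>2 * m"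
    using m B0 by (intro le_square_if_le_sqrt) (auto simp: sum_nonneg)
  have "(\<Sum>k<p. (?f k)\<^sup>2) \<le> (n / 16)\<^sup>2 * m"
  proof -
    have "B\<^sup>2 \<le> (n / 16)\<^sup>2" using Bsmall B0 by (intro power_mono) auto
    then have "B\<^sup>2 * m \<le> (n / 16)\<^sup>2 * m" using m by (rule mult_right_mono)
    with v show ?thesis by (simp add: stiefel_row_norm[OF S i0(1)])
  qed
  then have f: "L2_set ?f {..<p} \<le> n / 16 * sqrt m"
    using m by (intro L2_set_le) auto
  have "(\<Sum>k<p. (?h k)\<^sup>2) \<le> (\<Sum>k<p. (\<Sum>j<n. \<Sum>b<d. (g j b)\<^sup>2) * (\<Sum>j<n. \<Sum>b<d. (S j b k - S i0 b k)\<^sup>2))"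
    by (intro sum_mono double_sum_Cauchy_Schwarz)
  also have "\<dots> = (\<Sum>j<n. \<Sum>b<d. (g j b)\<^sup>2) * (\<Sum>j<n. \<Sum>b<d. \<Sum>k<p. (S j b k - S i0 b k)\<^sup>2)"
    by (simp only: sum_distrib_left[symmetric] sum.swap[of _ "{..<p}"])
  also have "\<dots> \<le> (L\<^sup>2 * m) * (256 * L\<^sup>2 * d / n)"
    unfolding g_def m_def by (intro mult_mono D_row i total_distance i0) (auto intro!: sum_nonneg mult_nonneg_nonneg)
  also have "\<dots> = (256 * (L ^ 4 * d)) / n * m" by (simp add: power2_eq_square power4_eq_xxxx)
  \<comment> \<open>After clearing denominators this is the locale assumption \<open>Lsmall\<close>:
    65536 = 256 * 16^2, with 256 coming from \<open>total_distance\<close>.\<close>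
  also have "\<dots> \<le> (n / 16)\<^sup>2 * m"
    using Lsmall n0 m by (intro mult_right_mono) (simp_all add: field_simps power2_eq_square power3_eq_cube)
  finally have h: "L2_set ?h {..<p} \<le> n / 16 * sqrt m"
    using m by (intro L2_set_le) auto
  have "L2_set (\<lambda>k. ?f k + ?h k) {..<p} \<le> n / 8 * sqrt m"
    using L2_set_triangle_ineq[of ?f ?h "{..<p}"] f h by simp
  then have "(L2_set (\<lambda>k. ?f k + ?h k) {..<p})\<^sup>2 \<le> (n / 8 * sqrt m)\<^sup>2"
    by (rule power_mono) simp
  then have "(\<Sum>k<p. (?f k + ?h k)\<^sup>2) \<le> (n / 8)\<^sup>2 * m"
    using m by (simp add: L2_set_def sum_nonneg power_mult_distrib power_divide)
  then show ?thesis by (simp only: split m_def)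
qed

section \<open>The dual certificate\<close>

lemma Lam_ge: "i < n \<Longrightarrow> (\<Sum>a<d. \<Sum>b<d. u a * \<Lambda> i a b * u b) \<ge> 3 * n / 8 * (\<Sum>a<d. (u a)\<^sup>2)"
  using Lam_lower[of i "n / 8" u] uDS_small n1 by simp

text \<open>The bilinear form of \<open>diag(\<Lambda>\<^sub>i) - A\<close>.\<close>
definition "q x y = (\<Sum>i<n. \<Sum>a<d. \<Sum>b<d. x i a * \<Lambda> i a b * y i b) -
  (\<Sum>i<n. \<Sum>j<n. \<Sum>a<d. \<Sum>b<d. x i a * A i j a b * y j b)"

lemma q_mul: "q x y = (\<Sum>i<n. \<Sum>a<d. x i a * ((\<Sum>b<d. \<Lambda> i a b * y i b) - (\<Sum>j<n. \<Sum>b<d. A i j a b * y j b)))"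
proof -
  have "(\<Sum>i<n. \<Sum>j<n. \<Sum>a<d. \<Sum>b<d. x i a * A i j a b * y j b) = (\<Sum>i<n. \<Sum>a<d. \<Sum>j<n. \<Sum>b<d. x i a * A i j a b * y j b)"
    by (intro sum.cong refl sum.swap)
  then show ?thesis by (simp add: q_def right_diff_distrib sum_subtractf sum_distrib_left mult.assoc)
qed

text \<open>Stationarity (AS)_i = \<Lambda>_i S_i says that every column of S lies in the kernel of
  the certificate.\<close>

lemma q_S: "q x (\<lambda>i a. \<Sum>k<p. S i a k * v k) = 0"
proof -
  have "(\<Sum>b<d. \<Lambda> i a b * (\<Sum>k<p. S i b k * v k)) = (\<Sum>j<n. \<Sum>b<d. A i j a b * (\<Sum>k<p. S j b k * v k))"
    if ia: "i < n" "a < d" for i a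
  proof -
    have "(\<Sum>b<d. \<Lambda> i a b * (\<Sum>k<p. S i b k * v k)) = (\<Sum>k<p. (\<Sum>b<d. \<Lambda> i a b * S i b k) * v k)"
      unfolding sum_distrib_left sum_distrib_right by (subst sum.swap) (simp add: mult.assoc)
    also have "\<dots> = (\<Sum>k<p. (\<Sum>j<n. \<Sum>b<d. A i j a b * S j b k) * v k)"
    proof (intro sum.cong refl)
      fix k assume "k \<in> {..<p}"
      then have "(\<Sum>b<d. \<Lambda> i a b * S i b k) = (\<Sum>j<n. \<Sum>b<d. A i j a b * S j b k)"
        using local_max_amul[OF lm Asym ia, of k] by (simp add: \<Lambda>_def amul_def)
      then show "(\<Sum>b<d. \<Lambda> i a b * S i b k) * v k = (\<Sum>j<n. \<Sum>b<d. A i j a b * S j b k) * v k" by simp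
    qed
    also have "\<dots> = (\<Sum>j<n. \<Sum>b<d. \<Sum>k<p. A i j a b * S j b k * v k)"
      unfolding sum_distrib_right by (simp only: sum.swap[of _ "{..<p}"])
    finally show ?thesis by (simp add: sum_distrib_left mult.assoc)
  qed
  then show ?thesis by (simp add: q_mul)
qed

lemma q_sym: "q x y = q y x"
proof -
  have "(\<Sum>a<d. \<Sum>b<d. x i a * \<Lambda> i a b * y i b) = (\<Sum>a<d. \<Sum>b<d. y i a * \<Lambda> i a b * x i b)" if "i < n" for i
    by (subst sum.swap) (intro sum.cong refl, simp add: Lam_sym[OF that])
  moreover have "(\<Sum>i<n. \<Sum>j<n. \<Sum>a<d. \<Sum>b<d. x i a * A i j a b * y j b) = (\<Sum>i<n. \<Sum>j<n. \<Sum>a<d. \<Sum>b<d. y i a * A i j a b * x j b)"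
  proof -
    have "(\<Sum>i<n. \<Sum>j<n. \<Sum>a<d. \<Sum>b<d. x i a * A i j a b * y j b) = (\<Sum>j<n. \<Sum>i<n. \<Sum>a<d. \<Sum>b<d. x i a * A i j a b * y j b)"
      by (rule sum.swap)
    also have "\<dots> = (\<Sum>j<n. \<Sum>i<n. \<Sum>b<d. \<Sum>a<d. x i a * A i j a b * y j b)"
      by (intro sum.cong refl sum.swap)
    also have "\<dots> = (\<Sum>i<n. \<Sum>j<n. \<Sum>a<d. \<Sum>b<d. y i a * A i j a b * x j b)"
      using Asym by (intro sum.cong refl) (simp add: bsym_def)
    finally show ?thesis .
  qed
  ultimately show ?thesis by (simp add: q_def)
qed

lemma q_diff: "q (\<lambda>i a. x i a - y i a) z = q x z - q y z"
  by (simp add: q_mul left_diff_distrib sum_subtractf)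

text \<open>On vectors whose blocks sum to zero the rank-d signal Z Z^T vanishes, so only the noise
  competes with \<Lambda>: 3/8 - 1/16 >= 1/4.\<close>

lemma q_centred:
  assumes "\<And>a. a < d \<Longrightarrow> (\<Sum>i<n. y i a) = 0"
  shows "q y y \<ge> n / 4 * (\<Sum>i<n. \<Sum>a<d. (y i a)\<^sup>2)"
proof -
  let ?N = "\<Sum>i<n. \<Sum>a<d. (y i a)\<^sup>2"
  have nn: "?N \<ge> 0" by (simp add: sum_nonneg)
  have "(\<Sum>i<n. \<Sum>j<n. \<Sum>a<d. \<Sum>b<d. y i a * kron a b * y j b) = (\<Sum>i<n. \<Sum>j<n. \<Sum>a<d. y i a * y j a)"
  proof (intro sum.cong refl)
    fix i j a assume "a \<in> {..<d}"
    then have "(\<Sum>b<d. y i a * (kron a b * y j b)) = y i a * y j a"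
      by (simp add: sum_distrib_left[symmetric] sum_kron_left)
    then show "(\<Sum>b<d. y i a * kron a b * y j b) = y i a * y j a" by (simp add: mult.assoc)
  qed
  also have "\<dots> = (\<Sum>i<n. \<Sum>a<d. \<Sum>j<n. y i a * y j a)" by (intro sum.cong refl sum.swap)
  also have "\<dots> = 0" by (simp add: sum_distrib_left[symmetric] assms)
  finally have k: "(\<Sum>i<n. \<Sum>j<n. \<Sum>a<d. \<Sum>b<d. y i a * kron a b * y j b) = 0" .
  have "(\<Sum>i<n. \<Sum>j<n. \<Sum>a<d. \<Sum>b<d. y i a * A i j a b * y j b) =
    (\<Sum>i<n. \<Sum>j<n. \<Sum>a<d. \<Sum>b<d. y i a * kron a b * y j b) + (\<Sum>i<n. \<Sum>j<n. \<Sum>a<d. \<Sum>b<d. y i a * D i j a b * y j b)"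
    unfolding sum.distrib[symmetric] by (intro sum.cong refl) (simp add: A_def algebra_simps)
  also have "\<dots> \<le> L * ?N" using Dop[of y y] nn k by (simp add: mult.assoc)
  also have "\<dots> \<le> n / 16 * ?N" using L_le nn by (rule mult_right_mono)
  finally have 1: "(\<Sum>i<n. \<Sum>j<n. \<Sum>a<d. \<Sum>b<d. y i a * A i j a b * y j b) \<le> n / 16 * ?N" .
  have "(\<Sum>i<n. 3 * n / 8 * (\<Sum>a<d. (y i a)\<^sup>2)) \<le> (\<Sum>i<n. \<Sum>a<d. \<Sum>b<d. y i a * \<Lambda> i a b * y i b)"
    by (intro sum_mono Lam_ge) simp
  then have 2: "3 * n / 8 * ?N \<le> (\<Sum>i<n. \<Sum>a<d. \<Sum>b<d. y i a * \<Lambda> i a b * y i b)"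
    by (simp only: sum_distrib_left)
  have "real n * ?N \<ge> 0" using nn by simp
  then show ?thesis using 1 2 unfolding q_def by (simp add: field_simps)
qed

text \<open>Every vector can be centred by subtracting an element S v of the kernel. One needs
  \<open>Sb\<close> v = sum of the x_i and takes v = \<open>Sb\<close>^T z; the matrix
  \<open>G\<close> = \<open>Sb\<close> \<open>Sb\<close>^T is injective by
  \<open>Sb_lower\<close>.\<close>

lemma centring: "\<exists>v. \<forall>a<d. (\<Sum>i<n. x i a - (\<Sum>k<p. S i a k * v k)) = 0"
proof -
  define G where "G a b = (\<Sum>k<p. Sb a k * Sb b k)" for a b
  have Gz: "(\<Sum>b<d. G a b * z b) = (\<Sum>k<p. Sb a k * (\<Sum>b<d. z b * Sb b k))" for a z
    unfolding G_def sum_distrib_left sum_distrib_right by (subst sum.swap) (simp add: mult_ac)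
  have "\<exists>z. \<forall>a<d. (\<Sum>b<d. G a b * z b) = (\<Sum>i<n. x i a)"
  proof (rule injective_imp_solvable)
    fix z :: "nat \<Rightarrow> real" and a
    assume z: "\<And>a. a < d \<Longrightarrow> (\<Sum>b<d. G a b * z b) = 0" and a: "a < d"
    have "(\<Sum>k<p. (\<Sum>b<d. z b * Sb b k)\<^sup>2) = (\<Sum>k<p. \<Sum>a<d. z a * (Sb a k * (\<Sum>b<d. z b * Sb b k)))"
      by (simp add: power2_eq_square sum_distrib_right mult.assoc)
    also have "\<dots> = (\<Sum>a<d. z a * (\<Sum>b<d. G a b * z b))"
      by (subst sum.swap) (simp add: Gz sum_distrib_left)
    also have "\<dots> = 0" using z by simp
    finally have "(n / 2)\<^sup>2 * (\<Sum>a<d. (z a)\<^sup>2) \<le> 0" using Sb_lower[of z] by simp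
    then have "(\<Sum>a<d. (z a)\<^sup>2) \<le> 0" using n1 by (simp add: mult_le_0_iff)
    then have "(\<Sum>a<d. (z a)\<^sup>2) = 0" by (intro antisym sum_nonneg) auto
    then show "z a = 0" using a by (subst (asm) sum_nonneg_eq_0_iff) auto
  qed
  then obtain z where z: "\<And>a. a < d \<Longrightarrow> (\<Sum>b<d. G a b * z b) = (\<Sum>i<n. x i a)" by blast
  have "(\<Sum>i<n. x i a - (\<Sum>k<p. S i a k * (\<Sum>b<d. z b * Sb b k))) = 0" if "a < d" for a
  proof -
    have "(\<Sum>i<n. \<Sum>k<p. S i a k * (\<Sum>b<d. z b * Sb b k)) = (\<Sum>k<p. Sb a k * (\<Sum>b<d. z b * Sb b k))"
      by (subst sum.swap) (simp add: Sb_def sum_distrib_right)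
    then show ?thesis using z[OF that] by (simp add: sum_subtractf Gz)
  qed
  then show ?thesis by (intro exI[of _ "\<lambda>k. \<Sum>b<d. z b * Sb b k"]) simp
qed

lemma q_lower: "\<exists>v. q x x \<ge> n / 4 * (\<Sum>i<n. \<Sum>a<d. (x i a - (\<Sum>k<p. S i a k * v k))\<^sup>2)"
proof -
  obtain v where v: "\<And>a. a < d \<Longrightarrow> (\<Sum>i<n. x i a - (\<Sum>k<p. S i a k * v k)) = 0"
    using centring by blast
  let ?s = "\<lambda>i a. \<Sum>k<p. S i a k * v k"
  have "q (\<lambda>i a. x i a - ?s i a) (\<lambda>i a. x i a - ?s i a) = q x x"
    using q_S[of x v] q_S[of "?s" v] by (simp add: q_diff q_sym[of _ "\<lambda>i a. x i a - ?s i a"] q_sym[of ?s x])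
  with q_centred[of "\<lambda>i a. x i a - ?s i a"] v show ?thesis by auto
qed

end

section \<open>The kernel of the certificate, SDP optimality and rounding\<close>

context sync_max
begin

lemma zero_less_n: "0 < n"
  using n1 by simp

text \<open>The vector S w is in the kernel of \<open>q\<close> and centred by assumption, so
  \<open>q_centred\<close> forces it to vanish. In effect S has the same kernel as its block sum,
  hence rank d.\<close>

lemma S_ker:
  assumes "\<And>a. a < d \<Longrightarrow> (\<Sum>k<p. Sb a k * w k) = 0" "i < n" "a < d"
  shows "(\<Sum>k<p. S i a k * w k) = 0"
proof -
  let ?y = "\<lambda>i a. \<Sum>k<p. S i a k * w k"
  have y0: "(\<Sum>i<n. ?y i a) = 0" if "a < d" for a
    using assms(1)[OF that] by (subst sum.swap) (simp add: Sb_def sum_distrib_right)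
  from q_centred[of ?y, OF y0] have "n / 4 * (\<Sum>i<n. \<Sum>a<d. (?y i a)\<^sup>2) \<le> 0" by (simp add: q_S)
  then have "(\<Sum>i<n. \<Sum>a<d. (?y i a)\<^sup>2) \<le> 0" using n1 by (simp add: mult_le_0_iff)
  then have "(\<Sum>i<n. \<Sum>a<d. (?y i a)\<^sup>2) = 0" by (intro antisym sum_nonneg) auto
  then have "\<forall>i\<in>{..<n}. (\<Sum>a<d. (?y i a)\<^sup>2) = 0" by (subst (asm) sum_nonneg_eq_0_iff) (auto intro: sum_nonneg)
  then have "(\<Sum>a<d. (?y i a)\<^sup>2) = 0" using assms(2) by blast
  then have "\<forall>a\<in>{..<d}. (?y i a)\<^sup>2 = 0" by (subst (asm) sum_nonneg_eq_0_iff) auto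
  then show ?thesis using assms(3) by auto
qed

text \<open>The kernel of S is already that of its block 0. By \<open>S_ker\<close> the square
  matrix \<open>Sb\<close> S_0^T is injective, so w can be corrected by some S_0^T z to lie in the
  kernel of \<open>Sb\<close>, hence of every block; evaluating at block 0 shows z = 0.\<close>

lemma S_ker0:
  assumes w: "\<And>a. a < d \<Longrightarrow> (\<Sum>k<p. S 0 a k * w k) = 0" and i: "i < n" "a < d"
  shows "(\<Sum>k<p. S i a k * w k) = 0"
proof -
  define G where "G a b = (\<Sum>k<p. Sb a k * S 0 b k)" for a b
  have Gz: "(\<Sum>b<d. G a b * z b) = (\<Sum>k<p. Sb a k * (\<Sum>b<d. z b * S 0 b k))" for a z
    unfolding G_def sum_distrib_left sum_distrib_right by (subst sum.swap) (simp add: mult_ac)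
  have "\<exists>z. \<forall>a<d. (\<Sum>b<d. G a b * z b) = (\<Sum>k<p. Sb a k * w k)"
  proof (rule injective_imp_solvable)
    fix z :: "nat \<Rightarrow> real" and a
    assume z: "\<And>a. a < d \<Longrightarrow> (\<Sum>b<d. G a b * z b) = 0" and a: "a < d"
    have "(\<Sum>k<p. S 0 a k * (\<Sum>b<d. z b * S 0 b k)) = 0"
      using z by (intro S_ker zero_less_n a) (simp add: Gz)
    then show "z a = 0" by (simp add: stiefel_row_sum[OF S zero_less_n a])
  qed
  then obtain z where z: "\<And>a. a < d \<Longrightarrow> (\<Sum>b<d. G a b * z b) = (\<Sum>k<p. Sb a k * w k)" by blast
  define w' where "w' k = w k - (\<Sum>b<d. z b * S 0 b k)" for k
  have s: "(\<Sum>k<p. x k * w' k) = (\<Sum>k<p. x k * w k) - (\<Sum>k<p. x k * (\<Sum>b<d. z b * S 0 b k))" for x :: "nat \<Rightarrow> real"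
    by (simp add: w'_def right_diff_distrib sum_subtractf)
  have w': "(\<Sum>k<p. S i a k * w' k) = 0" if "i < n" "a < d" for i a
    using z by (intro S_ker that) (simp add: s Gz)
  have "z a = 0" if "a < d" for a
    using w'[OF zero_less_n that] w[OF that] stiefel_row_sum[OF S zero_less_n that, of z] by (simp add: s)
  then have "(\<Sum>k<p. S i a k * (\<Sum>b<d. z b * S 0 b k)) = 0" by simp
  with w'[OF i] show ?thesis by (simp add: s)
qed

text \<open>S_i = S_i S_0^T S_0, because the columns of the projection \<open>Q 0\<close> are killed
  by S_0 and therefore by S_i. So S is determined by its Gram matrix and block 0, which is the
  source of the rank, the rounding and the uniqueness up to rotation.\<close>

lemma S_factor:
  assumes i: "i < n" "a < d" and k: "k < p"
  shows "S i a k = (\<Sum>b<d. gram p S i 0 a b * S 0 b k)"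
proof -
  have "(\<Sum>l<p. S i a l * Q 0 k l) = 0"
    by (rule S_ker0[OF S_Q i]) (use zero_less_n k in auto)
  moreover have "(\<Sum>l<p. S i a l * Q 0 k l) = (\<Sum>l<p. kron k l * S i a l) - (\<Sum>l<p. S i a l * (\<Sum>b<d. S 0 b k * S 0 b l))"
    by (simp add: Q_def algebra_simps sum_subtractf)
  moreover have "(\<Sum>l<p. S i a l * (\<Sum>b<d. S 0 b k * S 0 b l)) = (\<Sum>b<d. gram p S i 0 a b * S 0 b k)"
    unfolding gram_def sum_distrib_left sum_distrib_right by (subst sum.swap) (simp add: mult_ac)
  ultimately show ?thesis using k by (simp add: sum_kron_left)
qed

lemma q_zero:
  assumes "q x x \<le> 0" "i < n" "a < d"
  shows "x i a = (\<Sum>b<d. gram p S i 0 a b * x 0 b)"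
proof -
  obtain v where v: "q x x \<ge> n / 4 * (\<Sum>i<n. \<Sum>a<d. (x i a - (\<Sum>k<p. S i a k * v k))\<^sup>2)"
    using q_lower by blast
  then have "n / 4 * (\<Sum>i<n. \<Sum>a<d. (x i a - (\<Sum>k<p. S i a k * v k))\<^sup>2) \<le> 0" using assms(1) by linarith
  then have "(\<Sum>i<n. \<Sum>a<d. (x i a - (\<Sum>k<p. S i a k * v k))\<^sup>2) \<le> 0" using n1 by (simp add: mult_le_0_iff)
  then have "(\<Sum>i<n. \<Sum>a<d. (x i a - (\<Sum>k<p. S i a k * v k))\<^sup>2) = 0" by (intro antisym sum_nonneg) auto
  then have "\<forall>i\<in>{..<n}. (\<Sum>a<d. (x i a - (\<Sum>k<p. S i a k * v k))\<^sup>2) = 0"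
    by (subst (asm) sum_nonneg_eq_0_iff) (auto intro: sum_nonneg)
  then have x: "x i a = (\<Sum>k<p. S i a k * v k)" if "i < n" "a < d" for i a
    using that by (auto simp: sum_nonneg_eq_0_iff)
  have "x i a = (\<Sum>k<p. (\<Sum>b<d. gram p S i 0 a b * S 0 b k) * v k)"
    using S_factor[OF assms(2,3)] by (simp add: x[OF assms(2,3)])
  also have "\<dots> = (\<Sum>b<d. gram p S i 0 a b * (\<Sum>k<p. S 0 b k * v k))"
    unfolding sum_distrib_left sum_distrib_right by (subst sum.swap) (simp add: mult_ac)
  finally show ?thesis using x[OF zero_less_n] by simp
qed

text \<open>Stated for a general family V because it is applied twice: to the columns of S itself,
  and to a Gram factorization of an arbitrary optimal SDP solution. That both produce the same
  right-hand side is the uniqueness of the SDP maximizer.\<close>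

lemma factor_Gram:
  assumes V: "\<And>m i a. m < N \<Longrightarrow> i < n \<Longrightarrow> a < d \<Longrightarrow> V m i a = (\<Sum>b<d. gram p S i 0 a b * V m 0 b)"
    and V0: "\<And>b c. b < d \<Longrightarrow> c < d \<Longrightarrow> (\<Sum>m<N. V m 0 b * V m 0 c) = kron b c"
    and i: "i < n" "a < d" and j: "j < n" "b < d"
  shows "(\<Sum>m<N. V m i a * V m j b) = (\<Sum>c<d. gram p S i 0 a c * gram p S j 0 b c)"
proof -
  let ?G = "gram p S"
  have "(\<Sum>m<N. V m i a * V m j b) = (\<Sum>m<N. (\<Sum>c<d. ?G i 0 a c * V m 0 c) * (\<Sum>e<d. ?G j 0 b e * V m 0 e))"
    using V i j by (intro sum.cong refl) (metis lessThan_iff)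
  also have "\<dots> = (\<Sum>m<N. \<Sum>c<d. \<Sum>e<d. ?G i 0 a c * ?G j 0 b e * (V m 0 c * V m 0 e))"
    by (simp add: sum_product mult_ac)
  also have "\<dots> = (\<Sum>c<d. \<Sum>e<d. \<Sum>m<N. ?G i 0 a c * ?G j 0 b e * (V m 0 c * V m 0 e))"
    by (simp only: sum.swap[of _ "{..<N}"])
  also have "\<dots> = (\<Sum>c<d. \<Sum>e<d. ?G i 0 a c * (kron c e * ?G j 0 b e))"
    by (intro sum.cong refl) (simp add: sum_distrib_left[symmetric] V0)
  also have "\<dots> = (\<Sum>c<d. ?G i 0 a c * ?G j 0 b c)"
    by (simp add: sum_distrib_left[symmetric] sum_kron_left)
  finally show ?thesis .
qed

lemma gram_factor:
  assumes "i < n" "a < d" "j < n" "b < d"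
  shows "gram p S i j a b = (\<Sum>c<d. gram p S i 0 a c * gram p S j 0 b c)"
proof -
  have "(\<Sum>k<p. S i a k * S j b k) = (\<Sum>c<d. gram p S i 0 a c * gram p S j 0 b c)"
  proof (rule factor_Gram[where V = "\<lambda>k i a. S i a k"])
    show "S i a k = (\<Sum>b<d. gram p S i 0 a b * S 0 b k)" if "k < p" "i < n" "a < d" for k i a
      by (rule S_factor[OF that(2,3,1)])
    show "(\<Sum>k<p. S 0 b k * S 0 c k) = kron b c" if "b < d" "c < d" for b c
      by (rule stiefelD[OF S zero_less_n that])
  qed (fact assms)+
  then show ?thesis by (subst gram_def)
qed

lemma gram_psd: "psd n d (gram p T)"
proof -
  have "(\<Sum>i<n. \<Sum>j<n. \<Sum>a<d. \<Sum>b<d. x i a * gram p T i j a b * x j b) \<ge> 0" for x :: "nat \<Rightarrow> nat \<Rightarrow> real"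
  proof -
    define c where "c k = (\<Sum>i<n. \<Sum>a<d. x i a * T i a k)" for k
    have "(\<Sum>i<n. \<Sum>j<n. \<Sum>a<d. \<Sum>b<d. x i a * gram p T i j a b * x j b) =
      (\<Sum>i<n. \<Sum>j<n. \<Sum>a<d. \<Sum>b<d. \<Sum>k<p. (x i a * T i a k) * (x j b * T j b k))"
      unfolding gram_def sum_distrib_left sum_distrib_right by (simp add: mult_ac)
    also have "\<dots> = (\<Sum>i<n. \<Sum>a<d. \<Sum>j<n. \<Sum>b<d. \<Sum>k<p. (x i a * T i a k) * (x j b * T j b k))"
      by (intro sum.cong refl sum.swap)
    also have "\<dots> = (\<Sum>k<p. \<Sum>i<n. \<Sum>a<d. \<Sum>j<n. \<Sum>b<d. (x i a * T i a k) * (x j b * T j b k))"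
      by (simp only: sum.swap[of _ "{..<p}"])
    also have "\<dots> = (\<Sum>k<p. c k * c k)"
    proof (rule sum.cong[OF refl])
      fix k
      have "(\<Sum>j<n. \<Sum>b<d. (x i a * T i a k) * (x j b * T j b k)) = (x i a * T i a k) * c k" for i a
        by (simp add: c_def sum_distrib_left)
      then show "(\<Sum>i<n. \<Sum>a<d. \<Sum>j<n. \<Sum>b<d. (x i a * T i a k) * (x j b * T j b k)) = c k * c k"
        by (simp only: sum_distrib_right[symmetric]) (simp only: c_def)
    qed
    also have "\<dots> \<ge> 0" by (intro sum_nonneg) simp
    finally show ?thesis .
  qed
  then show ?thesis by (simp add: psd_def gram_def mult.commute)
qed

text \<open>The duality identity: the inner product of diag(\<Lambda>_i) with Y is the trace of
  \<Lambda> for every feasible Y, since its diagonal blocks are identities. The gap to this value is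
  the certificate evaluated on a factorization of Y.\<close>

lemma binner_Gram:
  assumes "\<And>i j a b. i < n \<Longrightarrow> j < n \<Longrightarrow> a < d \<Longrightarrow> b < d \<Longrightarrow> Y i j a b = (\<Sum>m<N. V m i a * V m j b)"
    and Yd: "\<And>i a b. i < n \<Longrightarrow> a < d \<Longrightarrow> b < d \<Longrightarrow> Y i i a b = kron a b"
  shows "binner n d A Y = (\<Sum>i<n. \<Sum>a<d. \<Lambda> i a a) - (\<Sum>m<N. q (V m) (V m))"
proof -
  have "(\<Sum>m<N. q (V m) (V m)) = (\<Sum>m<N. \<Sum>i<n. \<Sum>a<d. \<Sum>b<d. V m i a * \<Lambda> i a b * V m i b) -
    (\<Sum>m<N. \<Sum>i<n. \<Sum>j<n. \<Sum>a<d. \<Sum>b<d. V m i a * A i j a b * V m j b)"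
    by (simp add: q_def sum_subtractf)
  also have "(\<Sum>m<N. \<Sum>i<n. \<Sum>a<d. \<Sum>b<d. V m i a * \<Lambda> i a b * V m i b) =
    (\<Sum>i<n. \<Sum>a<d. \<Sum>b<d. \<Sum>m<N. V m i a * \<Lambda> i a b * V m i b)"
    by (simp only: sum.swap[of _ "{..<N}"])
  also have "\<dots> = (\<Sum>i<n. \<Sum>a<d. \<Sum>b<d. kron a b * \<Lambda> i a b)"
  proof (intro sum.cong refl)
    fix i a b assume "i \<in> {..<n}" "a \<in> {..<d}" "b \<in> {..<d}"
    then have "(\<Sum>m<N. V m i a * V m i b) = kron a b" using assms(1)[of i i a b] Yd[of i a b] by simp
    then have "(\<Sum>m<N. V m i a * V m i b) * \<Lambda> i a b = kron a b * \<Lambda> i a b" by simp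
    then show "(\<Sum>m<N. V m i a * \<Lambda> i a b * V m i b) = kron a b * \<Lambda> i a b"
      by (simp add: sum_distrib_left mult_ac)
  qed
  also have "\<dots> = (\<Sum>i<n. \<Sum>a<d. \<Lambda> i a a)" by (simp add: sum_kron_left)
  also have "(\<Sum>m<N. \<Sum>i<n. \<Sum>j<n. \<Sum>a<d. \<Sum>b<d. V m i a * A i j a b * V m j b) =
    (\<Sum>i<n. \<Sum>j<n. \<Sum>a<d. \<Sum>b<d. \<Sum>m<N. V m i a * A i j a b * V m j b)"
    by (simp only: sum.swap[of _ "{..<N}"])
  also have "\<dots> = binner n d A Y"
    unfolding binner_def by (intro sum.cong refl) (simp add: assms(1) sum_distrib_left mult_ac)
  finally show ?thesis by simp
qed

lemma q_nonneg: "q x x \<ge> 0"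
proof -
  obtain v where v: "q x x \<ge> n / 4 * (\<Sum>i<n. \<Sum>a<d. (x i a - (\<Sum>k<p. S i a k * v k))\<^sup>2)"
    using q_lower by blast
  have "0 \<le> n / 4 * (\<Sum>i<n. \<Sum>a<d. (x i a - (\<Sum>k<p. S i a k * v k))\<^sup>2)"
    by (intro mult_nonneg_nonneg sum_nonneg) auto
  with v show ?thesis by linarith
qed

lemma binner_gram_S: "binner n d A (gram p S) = (\<Sum>i<n. \<Sum>a<d. \<Lambda> i a a)"
proof -
  have "q (\<lambda>i a. S i a k) (\<lambda>i a. S i a k) = 0" if k: "k < p" for k
  proof -
    have "(\<Sum>l<p. S i a l * kron k l) = S i a k" for i a
      using sum_kron_left[OF k, of "\<lambda>l. S i a l"] by (simp add: mult.commute)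
    then show ?thesis using q_S[of "\<lambda>i a. S i a k" "kron k"] by simp
  qed
  then show ?thesis
    using binner_Gram[of "gram p S" "\<lambda>k i a. S i a k" p] stiefelD[OF S] by (simp add: gram_def)
qed

lemma sdp_max: "sdp_unique_max n d A (gram p S)"
proof -
  have feas: "sdp_feasible n d (gram p S)"
    using gram_psd stiefelD[OF S] by (simp add: sdp_feasible_def gram_def)
  have main: "binner n d A Y \<le> binner n d A (gram p S) \<and> (binner n d A Y = binner n d A (gram p S) \<longrightarrow>
      (\<forall>i<n. \<forall>j<n. \<forall>a<d. \<forall>b<d. Y i j a b = gram p S i j a b))" if Y: "sdp_feasible n d Y" for Y
  proof -
    let ?I = "{..<n} \<times> {..<d}"
    define M where "M u v = Y (fst u) (fst v) (snd u) (snd v)" for u v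
    have Ys: "Y i j a b = Y j i b a" if "i < n" "j < n" "a < d" "b < d" for i j a b
      using Y that by (simp add: sdp_feasible_def psd_def)
    have Yd: "Y i i a b = kron a b" if "i < n" "a < d" "b < d" for i a b
      using Y that by (simp add: sdp_feasible_def)
    have Yp: "(\<Sum>i<n. \<Sum>j<n. \<Sum>a<d. \<Sum>b<d. x i a * Y i j a b * x j b) \<ge> 0" for x :: "nat \<Rightarrow> nat \<Rightarrow> real"
      using Y by (simp add: sdp_feasible_def psd_def)
    have "\<exists>N (V :: nat \<Rightarrow> nat \<times> nat \<Rightarrow> real). \<forall>u\<in>?I. \<forall>v\<in>?I. M u v = (\<Sum>m<N. V m u * V m v)"
    proof (rule psd_Gram_factorization)
      show "M u v = M v u" if "u \<in> ?I" "v \<in> ?I" for u v using that Ys by (auto simp: M_def)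
      fix x :: "nat \<times> nat \<Rightarrow> real"
      have "(\<Sum>u\<in>?I. \<Sum>v\<in>?I. x u * M u v * x v) = (\<Sum>i<n. \<Sum>a<d. \<Sum>j<n. \<Sum>b<d. x (i, a) * Y i j a b * x (j, b))"
        by (simp add: M_def sum.cartesian_product')
      also have "\<dots> = (\<Sum>i<n. \<Sum>j<n. \<Sum>a<d. \<Sum>b<d. x (i, a) * Y i j a b * x (j, b))"
        by (rule sum.cong[OF refl], rule sum.swap)
      also have "\<dots> \<ge> 0" using Yp[of "\<lambda>i a. x (i, a)"] .
      finally show "(\<Sum>u\<in>?I. \<Sum>v\<in>?I. x u * M u v * x v) \<ge> 0" .
    qed simp
    then obtain N and V :: "nat \<Rightarrow> nat \<times> nat \<Rightarrow> real" where
      NV: "\<And>u v. u \<in> ?I \<Longrightarrow> v \<in> ?I \<Longrightarrow> M u v = (\<Sum>m<N. V m u * V m v)" by blast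
    define W where "W m i a = V m (i, a)" for m i a
    have YW: "Y i j a b = (\<Sum>m<N. W m i a * W m j b)" if "i < n" "j < n" "a < d" "b < d" for i j a b
      using NV[of "(i, a)" "(j, b)"] that by (simp add: M_def W_def)
    have eq: "binner n d A Y = binner n d A (gram p S) - (\<Sum>m<N. q (W m) (W m))"
      using binner_Gram[of Y W N, OF YW Yd] by (simp add: binner_gram_S)
    have "(\<Sum>m<N. q (W m) (W m)) \<ge> 0" by (intro sum_nonneg q_nonneg)
    moreover have "Y i j a b = gram p S i j a b"
      if e: "binner n d A Y = binner n d A (gram p S)" and ij: "i < n" "j < n" "a < d" "b < d" for i j a b
    proof -
      have "(\<Sum>m<N. q (W m) (W m)) = 0" using e eq by simp
      then have "\<forall>m\<in>{..<N}. q (W m) (W m) = 0" by (subst (asm) sum_nonneg_eq_0_iff) (auto intro: q_nonneg)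
      then have W: "W m i a = (\<Sum>b<d. gram p S i 0 a b * W m 0 b)" if "m < N" "i < n" "a < d" for m i a
        using that q_zero[of "W m" i a] by simp
      have W0: "(\<Sum>m<N. W m 0 b * W m 0 c) = kron b c" if "b < d" "c < d" for b c
        using YW[OF zero_less_n zero_less_n that] Yd[OF zero_less_n that] by simp
      show ?thesis unfolding YW[OF ij] gram_factor[OF ij(1,3,2,4)]
        by (rule factor_Gram[OF W W0]) (use ij in auto)
    qed
    ultimately show ?thesis using eq by auto
  qed
  show ?thesis unfolding sdp_unique_max_def using feas main by blast
qed

lemma global_max: "global_max n d p A S"
proof -
  have "fobj n d p A T \<le> fobj n d p A S" if T: "T \<in> stiefel n d p" for T
  proof -
    have "sdp_feasible n d (gram p T)"
      using gram_psd stiefelD[OF T] by (simp add: sdp_feasible_def gram_def)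
    then show ?thesis using sdp_max by (simp add: sdp_unique_max_def fobj_def)
  qed
  then show ?thesis using S by (simp add: global_max_def)
qed

text \<open>R_i = S_i S_0^T reproduces the Gram matrix by \<open>gram_factor\<close>, so its
  diagonal blocks make R_i orthogonal. Optimality holds because every orthogonal tuple gives a
  feasible point of the SDP.\<close>

lemma rounding:
  "\<exists>R. orth_tuple n d R \<and> (\<forall>i<n. \<forall>j<n. \<forall>a<d. \<forall>b<d. gram p S i j a b = gram d R i j a b) \<and>
     (\<forall>R'. orth_tuple n d R' \<longrightarrow> gobj n d A R' \<le> gobj n d A R)"
proof -
  define R where "R i = gram p S i 0" for i
  have g: "gram p S i j a b = gram d R i j a b" if "i < n" "j < n" "a < d" "b < d" for i j a b
    using gram_factor[OF that(1,3,2,4)] by (simp add: gram_def[of d R] R_def)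
  have o: "orth_tuple n d R"
    using g stiefelD[OF S] unfolding orth_tuple_def by (simp add: gram_def)
  have "gobj n d A R' \<le> gobj n d A R" if R': "orth_tuple n d R'" for R'
  proof -
    have "psd n d (gram d R')"
    proof -
      \<comment> \<open>Zero columns are appended to reach width p >= d, so that
        \<open>gram_psd\<close> applies.\<close>
      define T where "T i a k = (if k < d then R' i a k else 0)" for i a k
      have "(\<Sum>k<p. T i a k * T j b k) = (\<Sum>k<d. T i a k * T j b k)" for i j a b
        using p by (intro sum.mono_neutral_right) (auto simp: T_def)
      then have "gram p T = gram d R'" unfolding gram_def by (intro ext) (simp add: T_def)
      with gram_psd[of T] show ?thesis by simp
    qed
    then have "sdp_feasible n d (gram d R')" using R' by (simp add: sdp_feasible_def orth_tuple_def gram_def)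
    then have "gobj n d A R' \<le> binner n d A (gram p S)" using sdp_max by (simp add: sdp_unique_max_def gobj_def)
    also have "\<dots> = gobj n d A R" unfolding gobj_def binner_def using g by simp
    finally show ?thesis .
  qed
  with g o show ?thesis by blast
qed

end

section \<open>Orthogonal equivalence, rank and existence\<close>

lemma orth_mult:
  assumes "orth p U" "orth p V"
  shows "orth p (\<lambda>l k. \<Sum>m<p. U l m * V m k)"
  unfolding orth_def
proof (intro allI impI)
  fix k k' assume k: "k < p" "k' < p"
  have "(\<Sum>l<p. (\<Sum>m<p. U l m * V m k) * (\<Sum>m<p. U l m * V m k')) =
    (\<Sum>l<p. \<Sum>m<p. \<Sum>m'<p. V m k * V m' k' * (U l m * U l m'))"
    unfolding sum_product by (intro sum.cong refl) (simp add: mult_ac)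
  also have "\<dots> = (\<Sum>m<p. \<Sum>l<p. \<Sum>m'<p. V m k * V m' k' * (U l m * U l m'))" by (rule sum.swap)
  also have "\<dots> = (\<Sum>m<p. \<Sum>m'<p. \<Sum>l<p. V m k * V m' k' * (U l m * U l m'))"
    by (rule sum.cong[OF refl], rule sum.swap)
  also have "\<dots> = (\<Sum>m<p. V m k * (\<Sum>m'<p. kron m m' * V m' k'))"
    using assms(1) by (simp add: sum_distrib_left[symmetric] orth_def) (simp add: sum_distrib_left mult_ac)
  also have "\<dots> = kron k k'" using assms(2) k by (simp add: sum_kron_left orth_def)
  finally show "(\<Sum>l<p. (\<Sum>m<p. U l m * V m k) * (\<Sum>m<p. U l m * V m k')) = kron k k'" .
qed

lemma Householder_orth:
  assumes s: "s = (\<Sum>l<p. (v l)\<^sup>2)" "s \<noteq> 0"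
  shows "orth p (\<lambda>l k. kron l k - 2 / s * v l * v k)"
  unfolding orth_def
proof (intro allI impI)
  fix k m assume k: "k < p" and m: "m < p"
  have "(\<Sum>l<p. (kron l k - 2 / s * v l * v k) * (kron l m - 2 / s * v l * v m)) =
    (\<Sum>l<p. kron k l * kron l m) - (2 / s * v m) * (\<Sum>l<p. kron k l * v l) - (2 / s * v k) * (\<Sum>l<p. kron m l * v l)
      + (2 / s)\<^sup>2 * v k * v m * (\<Sum>l<p. (v l)\<^sup>2)"
    unfolding sum_distrib_left sum_subtractf[symmetric] sum.distrib[symmetric]
    by (intro sum.cong refl) (simp add: kron_commute[of _ k] kron_commute[of _ m] power2_eq_square algebra_simps)
  also have "\<dots> = kron k m - (2 / s * v m) * v k - (2 / s * v k) * v m + (2 / s)\<^sup>2 * v k * v m * s"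
    using k m s(1) by (simp add: sum_kron_left)
  also have "\<dots> = kron k m" using s(2) by (simp add: field_simps power2_eq_square)
  finally show "(\<Sum>l<p. (kron l k - 2 / s * v l * v k) * (kron l m - 2 / s * v l * v m)) = kron k m" .
qed

lemma orth_row_products:
  assumes U: "orth p (\<lambda>k l. U l k)"
  shows "(\<Sum>k<p. (\<Sum>l<p. x l * U l k) * (\<Sum>l<p. y l * U l k)) = (\<Sum>l<p. x l * y l)"
proof -
  have "(\<Sum>k<p. (\<Sum>l<p. x l * U l k) * (\<Sum>l<p. y l * U l k)) = (\<Sum>k<p. \<Sum>l<p. \<Sum>l'<p. x l * y l' * (U l k * U l' k))"
    by (simp add: sum_product mult_ac)
  also have "\<dots> = (\<Sum>l<p. \<Sum>k<p. \<Sum>l'<p. x l * y l' * (U l k * U l' k))" by (rule sum.swap)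
  also have "\<dots> = (\<Sum>l<p. \<Sum>l'<p. \<Sum>k<p. x l * y l' * (U l k * U l' k))"
    by (rule sum.cong[OF refl], rule sum.swap)
  also have "\<dots> = (\<Sum>l<p. x l * (\<Sum>l'<p. kron l l' * y l'))"
    using U by (simp add: sum_distrib_left[symmetric] orth_def) (simp add: sum_distrib_left mult_ac)
  finally show ?thesis by (simp add: sum_kron_left)
qed

text \<open>The orthogonal matrix is a product of Householder reflections, one for each row.\<close>
lemma orthonormal_rows_congruent:
  fixes x y :: "nat \<Rightarrow> nat \<Rightarrow> real"
  assumes "\<And>a b. a < m \<Longrightarrow> b < m \<Longrightarrow> (\<Sum>k<p. x a k * x b k) = kron a b"
    and "\<And>a b. a < m \<Longrightarrow> b < m \<Longrightarrow> (\<Sum>k<p. y a k * y b k) = kron a b"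
  shows "\<exists>U. orth p U \<and> orth p (\<lambda>k l. U l k) \<and> (\<forall>a<m. \<forall>k<p. (\<Sum>l<p. x a l * U l k) = y a k)"
  using assms
proof (induction m)
  case 0
  have "orth p kron" by (simp add: orth_def kron_commute[of _ "_::nat"] sum_kron_left sum_kron_right)
  moreover have "(\<lambda>k l. kron l k) = kron" by (simp add: kron_commute fun_eq_iff)
  ultimately show ?case by (intro exI[of _ kron]) simp
next
  case (Suc m)
  from Suc.IH[OF Suc.prems] obtain U where
    U: "orth p U" "orth p (\<lambda>k l. U l k)" "\<And>a k. a < m \<Longrightarrow> k < p \<Longrightarrow> (\<Sum>l<p. x a l * U l k) = y a k" by auto
  define z where "z k = (\<Sum>l<p. x m l * U l k)" for k
  define v where "v k = z k - y m k" for k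
  define s where "s = (\<Sum>k<p. (v k)\<^sup>2)"
  have zz: "(\<Sum>k<p. z k * z k) = 1"
    using orth_row_products[OF U(2), of "x m" "x m"] Suc.prems(1)[of m m] by (simp add: z_def kron_def)
  have yy: "(\<Sum>k<p. y m k * y m k) = 1" using Suc.prems(2)[of m m] by (simp add: kron_def)
  show ?case
  proof (cases "s = 0")
    case True
    then have "v k = 0" if "k < p" for k using that unfolding s_def by (subst (asm) sum_nonneg_eq_0_iff) auto
    then have "(\<Sum>l<p. x a l * U l k) = y a k" if "a < Suc m" "k < p" for a k
      using that U(3) by (cases "a = m") (auto simp: v_def z_def)
    with U show ?thesis by blast
  next
    case False
    define H where "H l k = kron l k - 2 / s * v l * v k" for l k
    define U' where "U' l k = (\<Sum>m<p. U l m * H m k)" for l k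
    have H: "orth p H" unfolding H_def by (rule Householder_orth[OF s_def False])
    have Hs: "H l k = H k l" for l k by (simp add: H_def kron_commute mult_ac)
    have "orth p U'" unfolding U'_def by (rule orth_mult[OF U(1) H])
    moreover have "orth p (\<lambda>k l. U' l k)"
    proof -
      have "(\<lambda>k l. U' l k) = (\<lambda>k l. \<Sum>m<p. H k m * U l m)"
        by (intro ext) (simp add: U'_def Hs[of _ "_::nat"] mult.commute)
      then show ?thesis using orth_mult[OF H U(2)] by simp
    qed
    moreover have "(\<Sum>l<p. x a l * U' l k) = y a k" if a: "a < Suc m" and k: "k < p" for a k
    proof -
      define t where "t j = (\<Sum>l<p. x a l * U l j)" for j
      have "(\<Sum>l<p. x a l * U' l k) = (\<Sum>l<p. \<Sum>j<p. x a l * U l j * H j k)"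
        by (simp add: U'_def sum_distrib_left mult.assoc)
      also have "\<dots> = (\<Sum>j<p. t j * H j k)"
        by (subst sum.swap) (simp add: t_def sum_distrib_right)
      also have "\<dots> = (\<Sum>j<p. kron k j * t j) - 2 / s * v k * (\<Sum>j<p. t j * v j)"
        unfolding sum_distrib_left sum_subtractf[symmetric]
        by (intro sum.cong refl) (simp add: H_def kron_commute[of _ k] algebra_simps)
      also have "\<dots> = t k - 2 / s * v k * (\<Sum>j<p. t j * v j)" using k by (simp add: sum_kron_left)
      finally have e: "(\<Sum>l<p. x a l * U' l k) = t k - 2 / s * v k * (\<Sum>j<p. t j * v j)" .
      show ?thesis
      proof (cases "a = m")
        case True
        have tz: "t = z" using True by (simp add: t_def z_def fun_eq_iff)
        have "s = (\<Sum>k<p. z k * z k) + (\<Sum>k<p. y m k * y m k) - 2 * (\<Sum>k<p. z k * y m k)"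
          unfolding s_def v_def sum_distrib_left sum_subtractf[symmetric] sum.distrib[symmetric]
          by (intro sum.cong refl) (simp add: power2_eq_square algebra_simps)
        moreover have "(\<Sum>j<p. z j * v j) = (\<Sum>k<p. z k * z k) - (\<Sum>k<p. z k * y m k)"
          by (simp add: v_def right_diff_distrib sum_subtractf)
        \<comment> \<open>As z and \<open>y m\<close> are unit vectors, v = z - \<open>y m\<close>
          satisfies z.v = |v|^2 / 2, so the reflection along v carries z to
          \<open>y m\<close>.\<close>
        ultimately have h: "(\<Sum>j<p. t j * v j) = s / 2" using zz yy tz by simp
        have "2 / s * v k * (\<Sum>j<p. t j * v j) = v k" unfolding h using False by simp
        then show ?thesis using e tz True by (simp add: v_def)
      next
        case ne: False
        then have a: "a < m" using a by simp
        have ty: "t j = y a j" if "j < p" for j using U(3)[OF a that] by (simp add: t_def)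
        \<comment> \<open>An earlier row is already \<open>y a\<close>; it is orthogonal to z since
          U preserves products, and to \<open>y m\<close> by assumption. Hence it is orthogonal to v
          and fixed by the new reflection.\<close>
        have "(\<Sum>j<p. t j * z j) = (\<Sum>l<p. x a l * x m l)"
          unfolding t_def z_def by (rule orth_row_products[OF U(2)])
        also have "\<dots> = 0" using Suc.prems(1)[of a m] a by (simp add: kron_def)
        finally have "(\<Sum>j<p. t j * z j) = 0" .
        moreover have "(\<Sum>j<p. t j * y m j) = 0" using Suc.prems(2)[of a m] a ty by (simp add: kron_def)
        ultimately have "(\<Sum>j<p. t j * v j) = 0" by (simp add: v_def right_diff_distrib sum_subtractf)
        then show ?thesis using e ty[OF k] by simp
      qed
    qed
    ultimately show ?thesis by blast
  qed
qed

lemma (in vec_space) rank_le_sum_products: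
  fixes f g :: "nat \<Rightarrow> nat \<Rightarrow> 'a"
  assumes "A \<in> carrier_mat n nc"
    and "\<And>r c. r < n \<Longrightarrow> c < nc \<Longrightarrow> A $$ (r, c) = (\<Sum>k<m. f k r * g k c)"
  shows "rank A \<le> m"
  using assms
proof (induction m arbitrary: A)
  case 0
  then have "A = 0\<^sub>m n nc" by (intro eq_matI) auto
  then show ?case by (simp add: rank_0I)
next
  case (Suc m)
  define B where "B = mat n nc (\<lambda>(r, c). \<Sum>k<m. f k r * g k c)"
  define C where "C = mat n nc (\<lambda>(r, c). f m r * g m c)"
  have B: "B \<in> carrier_mat n nc" and C: "C \<in> carrier_mat n nc" by (simp_all add: B_def C_def)
  have "A = B + C" using Suc.prems by (intro eq_matI) (auto simp: B_def C_def)
  then have "rank A \<le> rank B + rank C" using rank_subadditive[OF B C] by simp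
  also have "rank B \<le> m" by (rule Suc.IH[OF B]) (simp add: B_def)
  also have "rank C \<le> 1" by (rule rank_le_1_product_entries[OF C]) (simp add: C_def)
  finally show ?case by simp
qed

text \<open>The factorization writes the flattened matrix as a sum of d outer products; the identity
  block in the top left corner is a nonzero d x d minor.\<close>

lemma brank_factor:
  assumes n: "n \<ge> 1"
    and X: "\<And>i j a b. i < n \<Longrightarrow> j < n \<Longrightarrow> a < d \<Longrightarrow> b < d \<Longrightarrow> X i j a b = (\<Sum>c<d. R i a c * R j b c)"
    and X0: "\<And>a b. a < d \<Longrightarrow> b < d \<Longrightarrow> X 0 0 a b = kron a b"
  shows "brank n d X = d"
proof (cases "d = 0")
  case True
  then show ?thesis unfolding brank_def
    using vec_space.rank_le_nc[of "flat_mat n d X" "n * d" "n * d"] by (simp add: flat_mat_def)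
next
  case False
  let ?A = "flat_mat n d X"
  have A: "?A \<in> carrier_mat (n * d) (n * d)" by (simp add: flat_mat_def)
  have div: "u div d < n" "u mod d < d" if "u < n * d" for u
    using that False by (auto simp: less_mult_imp_div_less)
  have "vec_space.rank (n * d) ?A \<le> d"
    by (rule vec_space.rank_le_sum_products[OF A, where f = "\<lambda>c u. R (u div d) (u mod d) c" and g = "\<lambda>c u. R (u div d) (u mod d) c"])
       (simp add: flat_mat_def X div)
  moreover have "d \<le> vec_space.rank (n * d) ?A"
  proof -
    have le: "d \<le> n * d" using n by simp
    have c: "{j. j < n * d \<and> j \<in> {..<d}} = {..<d}" by (auto intro: order_less_le_trans[OF _ le])
    have "submatrix ?A {..<d} {..<d} = 1\<^sub>m d"
    proof (rule eq_matI)
      fix i j assume "i < dim_row (1\<^sub>m d)" "j < dim_col (1\<^sub>m d)"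
      then have ij: "i < d" "j < d" by auto
      have s: "{a \<in> {..<d}. a < i} = {..<i}" "{a \<in> {..<d}. a < j} = {..<j}" using ij by auto
      have lt: "i < n * d" "j < n * d" using ij le by (auto intro: order_less_le_trans)
      have "submatrix ?A {..<d} {..<d} $$ (i, j) = ?A $$ (i, j)"
        using submatrix_index_card[of i ?A j "{..<d}" "{..<d}"] ij lt A unfolding s by simp
      also have "\<dots> = kron i j" using ij lt X0 by (simp add: flat_mat_def)
      finally show "submatrix ?A {..<d} {..<d} $$ (i, j) = 1\<^sub>m d $$ (i, j)"
        using ij by (simp add: kron_def)
    qed (use c in \<open>simp_all add: dim_submatrix flat_mat_def\<close>)
    then have "det (submatrix ?A {..<d} {..<d}) \<noteq> 0" by simp
    from vec_space.rank_gt_minor[OF A this] show ?thesis by (simp only: c card_lessThan)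
  qed
  ultimately show ?thesis by (simp add: brank_def)
qed

lemma compact_PiE_UNIV:
  fixes K :: "'i \<Rightarrow> 'b::topological_space set"
  assumes "\<And>i. compact (K i)"
  shows "compact (PiE UNIV K)"
proof -
  have "compactin (product_topology (\<lambda>i. euclidean) UNIV) (PiE UNIV K)"
    using assms by (simp add: compactin_PiE)
  then show ?thesis by (simp add: euclidean_product_topology)
qed

text \<open>In the function type, \<open>stiefel\<close> leaves entries outside the index range free
  and is not bounded. It is therefore intersected with a cube, compact by Tychonoff; setting the
  free entries to 0 moves any feasible point into the cube without changing the objective.\<close>

lemma local_max_exists:
  assumes "d \<le> p" shows "\<exists>S. local_max n d p A S"
proof -
  define P :: "(nat \<Rightarrow> nat \<Rightarrow> nat \<Rightarrow> real) set" where
    "P = PiE UNIV (\<lambda>_. PiE UNIV (\<lambda>_. PiE UNIV (\<lambda>_. {-1..1})))"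
  have P: "compact P" unfolding P_def by (intro compact_PiE_UNIV compact_Icc)
  have PI: "S \<in> P \<longleftrightarrow> (\<forall>i a k. -1 \<le> S i a k \<and> S i a k \<le> 1)" for S
    by (auto simp: P_def PiE_def Pi_def)
  have c: "continuous_on UNIV (\<lambda>S :: nat \<Rightarrow> nat \<Rightarrow> nat \<Rightarrow> real. S i a k)" for i a k
    by (rule continuous_on_product_then_coordinatewise[OF continuous_on_product_then_coordinatewise[OF
          continuous_on_product_then_coordinatewise[OF continuous_on_id]]])
  have "stiefel n d p = (\<Inter>i\<in>{..<n}. \<Inter>a\<in>{..<d}. \<Inter>b\<in>{..<d}. {S. (\<Sum>k<p. S i a k * S i b k) = kron a b})"
    by (auto simp: stiefel_def)
  also have "closed \<dots>"
    by (intro closed_INT ballI closed_Collect_eq continuous_intros c)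
  finally have "compact (P \<inter> stiefel n d p)" using P by (intro compact_Int_closed)
  moreover have "(\<lambda>i a k. kron a k) \<in> P \<inter> stiefel n d p"
  proof -
    have "(\<Sum>k<p. kron a k * kron b k) = kron a b" if "a < d" "b < d" for a b
      using that assms sum_kron_left[of a p "kron b"] by (simp add: kron_commute[of b a])
    then show ?thesis by (simp add: PI stiefel_def) (simp add: kron_def)
  qed
  moreover have "continuous_on UNIV (fobj n d p A)"
    unfolding fobj_def binner_def gram_def by (intro continuous_intros c)
  ultimately obtain S where S: "S \<in> P \<inter> stiefel n d p" "\<And>T. T \<in> P \<inter> stiefel n d p \<Longrightarrow> fobj n d p A T \<le> fobj n d p A S"
    using continuous_attains_sup[of "P \<inter> stiefel n d p" "fobj n d p A"] continuous_on_subset by blast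
  have "fobj n d p A T \<le> fobj n d p A S" if T: "T \<in> stiefel n d p" for T
  proof -
    define T' where "T' i a k = (if i < n \<and> a < d \<and> k < p then T i a k else 0)" for i a k
    have "gram p T' i j a b = gram p T i j a b" if "i < n" "j < n" "a < d" "b < d" for i j a b
      using that by (simp add: gram_def T'_def)
    then have f: "fobj n d p A T' = fobj n d p A T" by (simp add: fobj_def binner_def)
    have st: "T' \<in> stiefel n d p" using T by (simp add: stiefel_def T'_def)
    have "\<bar>T i a k\<bar> \<le> 1" if "i < n" "a < d" "k < p" for i a k
    proof -
      have "(T i a k)\<^sup>2 \<le> (\<Sum>k<p. (T i a k)\<^sup>2)" using that by (intro member_le_sum) auto
      also have "\<dots> = 1" using stiefelD[OF T, of i a a] that by (simp add: power2_eq_square kron_def)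
      finally show ?thesis by (simp add: abs_square_le_1)
    qed
    then have "T' \<in> P" unfolding PI T'_def by (auto simp: abs_le_iff)
    with S(2)[of T'] st f show ?thesis by simp
  qed
  then have "local_max n d p A S" using S(1) by (auto simp: local_max_def intro: exI[of _ 1])
  then show ?thesis by blast
qed

text \<open>Two local maxima share their Gram matrix, as each gives the unique SDP maximizer. An
  orthogonal U aligning their blocks 0 then aligns all other blocks through
  \<open>S_factor\<close>.\<close>

lemma (in sync) benign: "benign n d p A"
proof -
  have "\<exists>U. orth p U \<and> right_mult n d p S U S'" if S: "local_max n d p A S" and S': "local_max n d p A S'" for S S'
  proof -
    interpret s: sync_max n d p D L B S by unfold_locales (rule S)
    interpret s': sync_max n d p D L B S' by unfold_locales (rule S')
    have g: "gram p S i j a b = gram p S' i j a b" if "i < n" "j < n" "a < d" "b < d" for i j a b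
      using s.sdp_max s'.sdp_max that unfolding sdp_unique_max_def by (metis order.antisym)
    obtain U where U: "orth p U" "\<And>a k. a < d \<Longrightarrow> k < p \<Longrightarrow> (\<Sum>l<p. S 0 a l * U l k) = S' 0 a k"
      using orthonormal_rows_congruent[where m = d and p = p and x = "S 0" and y = "S' 0"] stiefelD[OF s.S s.zero_less_n] stiefelD[OF s'.S s.zero_less_n] by blast
    have "S' i a k = (\<Sum>l<p. S i a l * U l k)" if i: "i < n" and a: "a < d" and k: "k < p" for i a k
    proof -
      have "S' i a k = (\<Sum>b<d. gram p S i 0 a b * S' 0 b k)"
        using s'.S_factor[OF i a k] g[OF i s.zero_less_n a] by simp
      also have "\<dots> = (\<Sum>b<d. gram p S i 0 a b * (\<Sum>l<p. S 0 b l * U l k))" using U(2) k by simp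
      also have "\<dots> = (\<Sum>l<p. (\<Sum>b<d. gram p S i 0 a b * S 0 b l) * U l k)"
        unfolding sum_distrib_left sum_distrib_right by (subst sum.swap) (simp add: mult.assoc)
      also have "\<dots> = (\<Sum>l<p. S i a l * U l k)" 
        by (intro sum.cong refl) (simp add: s.S_factor[OF i a, symmetric])
      finally show ?thesis .
    qed
    with U(1) show ?thesis by (auto simp: right_mult_def)
  qed
  moreover have "global_max n d p A S \<and> sdp_unique_max n d A (gram p S) \<and> brank n d (gram p S) = d \<and>
      (\<exists>R. orth_tuple n d R \<and> (\<forall>i<n. \<forall>j<n. \<forall>a<d. \<forall>b<d. gram p S i j a b = gram d R i j a b) \<and>
           (\<forall>R'. orth_tuple n d R' \<longrightarrow> gobj n d A R' \<le> gobj n d A R))" if S: "local_max n d p A S" for S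
  proof -
    interpret s: sync_max n d p D L B S by unfold_locales (rule S)
    have "brank n d (gram p S) = d"
    proof (rule brank_factor[OF n1, where R = "\<lambda>i a c. gram p S i 0 a c"])
      show "gram p S i j a b = (\<Sum>c<d. gram p S i 0 a c * gram p S j 0 b c)"
        if "i < n" "j < n" "a < d" "b < d" for i j a b by (rule s.gram_factor[OF that(1,3,2,4)])
      show "gram p S 0 0 a b = kron a b" if "a < d" "b < d" for a b
        unfolding gram_def by (rule stiefelD[OF s.S s.zero_less_n that])
    qed
    with s.global_max s.sdp_max s.rounding show ?thesis by blast
  qed
  moreover have "\<exists>S. local_max n d p A S" using p by (intro local_max_exists) simp
  ultimately show ?thesis unfolding benign_def by blast
qed

section \<open>Gaussian bilinear forms\<close>

lemma std_normal_mgf: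
  "(\<integral>\<^sup>+ x. ennreal (exp (c * x)) \<partial>density lborel std_normal_density) = ennreal (exp (c\<^sup>2 / 2))"
proof -
  have "std_normal_density x * exp (c * x) = exp (c\<^sup>2 / 2) * normal_density c 1 x" for x
  proof -
    have "- (x\<^sup>2) / 2 + c * x = c\<^sup>2 / 2 + - ((x - c)\<^sup>2) / 2" by (simp add: power2_eq_square field_simps)
    then have "exp (- (x\<^sup>2) / 2) * exp (c * x) = exp (c\<^sup>2 / 2) * exp (- ((x - c)\<^sup>2) / 2)"
      by (simp only: exp_add[symmetric])
    then show ?thesis by (simp add: normal_density_def)
  qed
  then have "(\<integral>\<^sup>+ x. ennreal (exp (c * x)) \<partial>density lborel std_normal_density)
    = (\<integral>\<^sup>+ x. ennreal (exp (c\<^sup>2 / 2)) * ennreal (normal_density c 1 x) \<partial>lborel)"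
    by (simp add: nn_integral_density ennreal_mult[symmetric] normal_density_nonneg)
  also have "\<dots> = ennreal (exp (c\<^sup>2 / 2)) * (\<integral>\<^sup>+ x. ennreal (normal_density c 1 x) \<partial>lborel)"
    by (rule nn_integral_cmult) simp
  also have "(\<integral>\<^sup>+ x. ennreal (normal_density c 1 x) \<partial>lborel) = 1"
  proof -
    interpret prob_space "density lborel (\<lambda>x. ennreal (normal_density c 1 x))"
      by (rule prob_space_normal_density) simp
    show ?thesis using emeasure_space_1 by (simp add: emeasure_density)
  qed
  finally show ?thesis by simp
qed

lemma prob_space_std_normal: "prob_space (density lborel (\<lambda>x. ennreal (std_normal_density x)))"
  by (rule prob_space_normal_density) simp

lemma gaussian_mgf:
  assumes "finite I"
  shows "(\<integral>\<^sup>+ g. ennreal (exp (\<Sum>e\<in>I. c e * g e)) \<partial>PiM I (\<lambda>_. density lborel std_normal_density)) =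
    ennreal (exp ((\<Sum>e\<in>I. (c e)\<^sup>2) / 2))"
proof -
  interpret product_sigma_finite "\<lambda>_. density lborel (\<lambda>x. ennreal (std_normal_density x))"
    using prob_space_std_normal by (intro product_sigma_finite.intro prob_space_imp_sigma_finite)
  have "(\<integral>\<^sup>+ g. ennreal (exp (\<Sum>e\<in>I. c e * g e)) \<partial>PiM I (\<lambda>_. density lborel std_normal_density)) =
     (\<integral>\<^sup>+ g. (\<Prod>e\<in>I. ennreal (exp (c e * g e))) \<partial>PiM I (\<lambda>_. density lborel std_normal_density))"
    using assms by (simp add: exp_sum prod_ennreal)
  also have "\<dots> = (\<Prod>e\<in>I. \<integral>\<^sup>+ x. ennreal (exp (c e * x)) \<partial>density lborel std_normal_density)"
    by (rule product_nn_integral_prod) (use assms in auto)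
  also have "\<dots> = ennreal (exp ((\<Sum>e\<in>I. (c e)\<^sup>2) / 2))"
    using assms by (simp only: std_normal_mgf) (simp add: prod_ennreal exp_sum[symmetric] sum_divide_distrib)
  finally show ?thesis .
qed

lemma gaussian_tail:
  assumes I: "finite I" and v: "(\<Sum>e\<in>I. (c e)\<^sup>2) \<le> v" "v > 0" and t: "t \<ge> 0"
  defines "P \<equiv> PiM I (\<lambda>_. density lborel (\<lambda>x. ennreal (std_normal_density x)))"
  shows "{g \<in> space P. t \<le> (\<Sum>e\<in>I. c e * g e)} \<in> sets P"
    and "measure P {g \<in> space P. t \<le> (\<Sum>e\<in>I. c e * g e)} \<le> exp (- t\<^sup>2 / (2 * v))"
proof -
  interpret prob_space P unfolding P_def by (intro prob_space_PiM prob_space_std_normal)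
  have meas: "(\<lambda>g. \<Sum>e\<in>I. c e * g e) \<in> borel_measurable P"
    unfolding P_def by measurable
  then show set: "{g \<in> space P. t \<le> (\<Sum>e\<in>I. c e * g e)} \<in> sets P" by measurable
  \<comment> \<open>The minimizer of the Chernoff exponent
    \<open>- l * t + l\<^sup>2 * v / 2\<close>.\<close>
  define l where "l = t / v"
  have l: "l \<ge> 0" using t v by (simp add: l_def)
  let ?X = "\<lambda>g. \<Sum>e\<in>I. c e * g e"
  let ?u = "\<lambda>g. ennreal (exp (\<Sum>e\<in>I. (l * c e) * g e))"
  have lX: "(\<Sum>e\<in>I. (l * c e) * g e) = l * ?X g" for g :: "'a \<Rightarrow> real" by (simp add: sum_distrib_left mult.assoc)
  have "emeasure P {g \<in> space P. t \<le> ?X g} \<le> emeasure P {g \<in> space P. 1 \<le> ennreal (exp (- l * t)) * ?u g}"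
  proof (intro emeasure_mono subsetI)
    fix g assume g: "g \<in> {g \<in> space P. t \<le> ?X g}"
    then have "l * t \<le> l * ?X g" using l by (simp add: mult_left_mono)
    then have "1 \<le> exp (- l * t) * exp (l * ?X g)" by (simp add: exp_add[symmetric])
    then have "1 \<le> ennreal (exp (- l * t) * exp (l * ?X g))" by (simp only: ennreal_1[symmetric] ennreal_leI)
    with g show "g \<in> {g \<in> space P. 1 \<le> ennreal (exp (- l * t)) * ?u g}" by (simp add: lX ennreal_mult)
  next
    show "{g \<in> space P. 1 \<le> ennreal (exp (- l * t)) * ?u g} \<in> sets P"
      unfolding lX using meas by measurable
  qed
  also have "\<dots> \<le> ennreal (exp (- l * t)) * (\<integral>\<^sup>+ g. ?u g * indicator (space P) g \<partial>P)"
    using meas unfolding lX by (intro nn_integral_Markov_inequality) auto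
  also have "(\<integral>\<^sup>+ g. ?u g * indicator (space P) g \<partial>P) = (\<integral>\<^sup>+ g. ?u g \<partial>P)"
    by (intro nn_integral_cong) simp
  also have "\<dots> = ennreal (exp ((\<Sum>e\<in>I. (l * c e)\<^sup>2) / 2))"
    unfolding P_def by (rule gaussian_mgf[OF I])
  also have "ennreal (exp (- l * t)) * \<dots> = ennreal (exp (- l * t + (\<Sum>e\<in>I. (l * c e)\<^sup>2) / 2))"
    by (simp add: ennreal_mult[symmetric] exp_add[symmetric])
  also have "\<dots> \<le> ennreal (exp (- t\<^sup>2 / (2 * v)))"
  proof -
    have "(\<Sum>e\<in>I. (l * c e)\<^sup>2) = l\<^sup>2 * (\<Sum>e\<in>I. (c e)\<^sup>2)" by (simp add: power_mult_distrib sum_distrib_left)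
    also have "\<dots> \<le> l\<^sup>2 * v" using v by (intro mult_left_mono) auto
    finally have "- l * t + (\<Sum>e\<in>I. (l * c e)\<^sup>2) / 2 \<le> - l * t + l\<^sup>2 * v / 2" by simp
    also have "\<dots> = - t\<^sup>2 / (2 * v)" using v by (simp add: l_def field_simps power2_eq_square)
    finally show ?thesis by (intro ennreal_leI) simp
  qed
  finally show "measure P {g \<in> space P. t \<le> ?X g} \<le> exp (- t\<^sup>2 / (2 * v))"
    by (simp add: emeasure_eq_measure)
qed

lemma gaussian_tail_abs:
  assumes I: "finite I" and v: "(\<Sum>e\<in>I. (c e)\<^sup>2) \<le> v" "v > 0" and t: "t \<ge> 0"
  defines "P \<equiv> PiM I (\<lambda>_. density lborel (\<lambda>x. ennreal (std_normal_density x)))"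
  shows "{g \<in> space P. t \<le> \<bar>\<Sum>e\<in>I. c e * g e\<bar>} \<in> sets P"
    and "measure P {g \<in> space P. t \<le> \<bar>\<Sum>e\<in>I. c e * g e\<bar>} \<le> 2 * exp (- t\<^sup>2 / (2 * v))"
proof -
  interpret prob_space P unfolding P_def by (intro prob_space_PiM prob_space_std_normal)
  let ?A = "{g \<in> space P. t \<le> (\<Sum>e\<in>I. c e * g e)}" and ?B = "{g \<in> space P. t \<le> (\<Sum>e\<in>I. (- c e) * g e)}"
  have eq: "{g \<in> space P. t \<le> \<bar>\<Sum>e\<in>I. c e * g e\<bar>} = ?A \<union> ?B"
    by (auto simp: sum_negf abs_if)
  have v': "(\<Sum>e\<in>I. (- c e)\<^sup>2) \<le> v" using v by simp
  note A = gaussian_tail[OF I v t, folded P_def] and B = gaussian_tail[OF I v' v(2) t, folded P_def]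
  show "{g \<in> space P. t \<le> \<bar>\<Sum>e\<in>I. c e * g e\<bar>} \<in> sets P" unfolding eq using A(1) B(1) by (rule sets.Un)
  have "measure P (?A \<union> ?B) \<le> measure P ?A + measure P ?B" by (rule measure_Un_le[OF A(1) B(1)])
  then show "measure P {g \<in> space P. t \<le> \<bar>\<Sum>e\<in>I. c e * g e\<bar>} \<le> 2 * exp (- t\<^sup>2 / (2 * v))"
    unfolding eq using A(2) B(2) by linarith
qed

section \<open>Lattice nets of the unit ball and bilinear forms\<close>

definition lattice_net :: "'a set \<Rightarrow> ('a \<Rightarrow> int) set" where
  "lattice_net I = {k \<in> PiE I (\<lambda>_. {- int (16 * card I)..int (16 * card I)}). (\<Sum>e\<in>I. (k e)\<^sup>2) \<le> int (16 * card I)}"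

text \<open>With N = \<open>card I\<close>, the mesh 1/(4 sqrt(N)) makes the norm of the rounding
  error at most 1/4, and the constraint that the squares of k sum to at most 16 N places the scaled
  point in the unit ball. The explicit box in \<open>lattice_net\<close> gives finiteness and lets
  the counting argument sum over a product set.\<close>

definition net_point :: "'a set \<Rightarrow> ('a \<Rightarrow> int) \<Rightarrow> 'a \<Rightarrow> real" where
  "net_point I k e = real_of_int (k e) / (4 * sqrt (card I))"

lemma finite_lattice_net: "finite I \<Longrightarrow> finite (lattice_net I)"
  unfolding lattice_net_def by (intro finite_subset[OF _ finite_PiE[of I "\<lambda>_. {- int (16 * card I)..int (16 * card I)}"]]) auto

lemma two_sided_geometric_sum: "(\<Sum>m\<in>{- int M..int M}. (1 / 2 :: real) ^ nat \<bar>m\<bar>) = 3 - 2 * (1 / 2) ^ M"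
proof (induction M)
  case (Suc M)
  have "{- int (Suc M)..int (Suc M)} = insert (- int (Suc M)) (insert (int (Suc M)) {- int M..int M})" by auto
  then show ?case using Suc by (simp add: nat_add_distrib)
qed simp

text \<open>Each lattice point is counted with weight \<open>2\<^bsup>16N-\<Sum>|k|\<^esup> \<ge> 1\<close>, and the weights sum to a product.\<close>
lemma card_lattice_net:
  assumes "finite I" shows "real (card (lattice_net I)) \<le> 2 ^ (18 * card I)"
proof -
  let ?N = "card I" and ?R = "{- int (16 * card I)..int (16 * card I)}"
  have w: "1 \<le> 2 ^ (16 * ?N) * (\<Prod>e\<in>I. (1 / 2 :: real) ^ nat \<bar>k e\<bar>)" if k: "k \<in> lattice_net I" for k
  proof -
    \<comment> \<open>For integers |k| \<le> k^2, so the Euclidean constraint bounds the l1 norm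
      that appears in the weight.\<close>
    have "(\<Sum>e\<in>I. \<bar>k e\<bar>) \<le> (\<Sum>e\<in>I. (k e)\<^sup>2)"
    proof (rule sum_mono)
      fix e show "\<bar>k e\<bar> \<le> (k e)\<^sup>2"
        by (cases "k e = 0") (auto simp: power2_eq_square abs_mult_self_eq[of "k e", symmetric] mult_le_cancel_left1 simp del: abs_mult_self_eq)
    qed
    also have "\<dots> \<le> int (16 * ?N)" using k by (simp add: lattice_net_def)
    finally have "(\<Sum>e\<in>I. int (nat \<bar>k e\<bar>)) \<le> int (16 * ?N)" by simp
    then have "(\<Sum>e\<in>I. nat \<bar>k e\<bar>) \<le> 16 * ?N" by (simp only: of_nat_sum[symmetric] of_nat_le_iff)
    then have "(1 / 2 :: real) ^ (16 * ?N) \<le> (1 / 2) ^ (\<Sum>e\<in>I. nat \<bar>k e\<bar>)" by (intro power_decreasing) auto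
    also have "\<dots> = (\<Prod>e\<in>I. (1 / 2 :: real) ^ nat \<bar>k e\<bar>)" by (rule power_sum)
    finally have "2 ^ (16 * ?N) * (1 / 2 :: real) ^ (16 * ?N) \<le> 2 ^ (16 * ?N) * (\<Prod>e\<in>I. (1 / 2 :: real) ^ nat \<bar>k e\<bar>)"
      by (intro mult_left_mono) auto
    then show ?thesis by (simp add: power_mult_distrib[symmetric])
  qed
  have "real (card (lattice_net I)) = (\<Sum>k\<in>lattice_net I. 1)" by simp
  also have "\<dots> \<le> (\<Sum>k\<in>lattice_net I. 2 ^ (16 * ?N) * (\<Prod>e\<in>I. (1 / 2 :: real) ^ nat \<bar>k e\<bar>))"
    by (intro sum_mono w)
  also have "\<dots> \<le> (\<Sum>k\<in>PiE I (\<lambda>_. ?R). 2 ^ (16 * ?N) * (\<Prod>e\<in>I. (1 / 2 :: real) ^ nat \<bar>k e\<bar>))"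
    using assms by (intro sum_mono2 finite_PiE) (auto simp: lattice_net_def intro!: mult_nonneg_nonneg prod_nonneg)
  also have "\<dots> = 2 ^ (16 * ?N) * (\<Prod>e\<in>I. \<Sum>m\<in>?R. (1 / 2 :: real) ^ nat \<bar>m\<bar>)"
    using assms by (simp only: sum_distrib_left[symmetric]) (subst prod_sum_PiE, auto)
  \<comment> \<open>Each geometric sum is below 3; rounding up to 4 = 2^2 turns the exponent 16 N
    into 18 N.\<close>
  also have "\<dots> \<le> 2 ^ (16 * ?N) * (\<Prod>e\<in>I. 4)"
  proof (intro mult_left_mono prod_mono conjI)
    have "(0 :: real) \<le> (1 / 2) ^ (16 * ?N)" "(1 / 2 :: real) ^ (16 * ?N) \<le> 1" by (auto intro: power_le_one)
    then show "0 \<le> (\<Sum>m\<in>?R. (1 / 2 :: real) ^ nat \<bar>m\<bar>)" "(\<Sum>m\<in>?R. (1 / 2 :: real) ^ nat \<bar>m\<bar>) \<le> 4"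
      unfolding two_sided_geometric_sum by linarith+
  qed simp
  also have "\<dots> = 2 ^ (18 * ?N)"
    by (simp add: power_mult power_mult_distrib[symmetric])
  finally show ?thesis .
qed

text \<open>Coordinates are rounded towards zero, not to the nearest integer: this never increases
  their size, so the net point stays in the unit ball along with x.\<close>

lemma lattice_net_rounding:
  fixes x :: "'a \<Rightarrow> real"
  assumes I: "finite I" "I \<noteq> {}" and x: "(\<Sum>e\<in>I. (x e)\<^sup>2) \<le> 1"
  obtains k where "k \<in> lattice_net I" "(\<Sum>e\<in>I. (net_point I k e)\<^sup>2) \<le> 1"
    "(\<Sum>e\<in>I. (x e - net_point I k e)\<^sup>2) \<le> 1 / 16"
proof -
  define s where "s = 4 * sqrt (card I)"
  have N: "real (card I) > 0" using I by (simp add: card_gt_0_iff)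
  have s: "s > 0" "s\<^sup>2 = 16 * card I" using N by (simp_all add: s_def power_mult_distrib)
  define tr where "tr y = (if y \<ge> 0 then \<lfloor>y\<rfloor> else - \<lfloor>- y\<rfloor>)" for y :: real
  have tr: "\<bar>real_of_int (tr y)\<bar> \<le> \<bar>y\<bar> \<and> \<bar>y - tr y\<bar> \<le> 1" for y
  proof (cases "y \<ge> 0")
    case True
    then have "real_of_int \<lfloor>y\<rfloor> \<ge> 0" by simp
    moreover have "tr y = \<lfloor>y\<rfloor>" using True by (simp add: tr_def)
    ultimately show ?thesis using True by (simp only:) (intro conjI; linarith)
  next
    case False
    then have "real_of_int \<lfloor>- y\<rfloor> \<ge> 0" by simp
    moreover have "real_of_int (tr y) = - real_of_int \<lfloor>- y\<rfloor>" using False by (simp add: tr_def)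
    ultimately show ?thesis using False by (simp only:) (intro conjI; linarith)
  qed
  note tr = conjunct1[OF tr] conjunct2[OF tr]
  define k where "k e = (if e \<in> I then tr (s * x e) else undefined)" for e
  have pk: "net_point I k e = tr (s * x e) / s" if "e \<in> I" for e
    using that by (simp add: net_point_def k_def s_def)
  have tx: "(real_of_int (tr (s * x e)))\<^sup>2 \<le> s\<^sup>2 * (x e)\<^sup>2" for e
    using tr(1)[of "s * x e"] by (simp add: abs_le_square_iff power_mult_distrib)
  have "(\<Sum>e\<in>I. (real_of_int (k e))\<^sup>2) \<le> (\<Sum>e\<in>I. s\<^sup>2 * (x e)\<^sup>2)"
    using tx by (intro sum_mono) (simp add: k_def)
  also have "\<dots> \<le> s\<^sup>2 * 1" unfolding sum_distrib_left[symmetric] using x by (intro mult_left_mono) auto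
  finally have "real_of_int (\<Sum>e\<in>I. (k e)\<^sup>2) \<le> real_of_int (int (16 * card I))" using s by simp
  then have ks: "(\<Sum>e\<in>I. (k e)\<^sup>2) \<le> int (16 * card I)" by (simp only: of_int_le_iff)
  have "\<bar>k e\<bar> \<le> int (16 * card I)" if "e \<in> I" for e
  proof -
    have "\<bar>k e\<bar> \<le> (k e)\<^sup>2"
      by (cases "k e = 0") (auto simp: power2_eq_square abs_mult_self_eq[of "k e", symmetric] mult_le_cancel_left1 simp del: abs_mult_self_eq)
    also have "\<dots> \<le> (\<Sum>e\<in>I. (k e)\<^sup>2)" using that I by (intro member_le_sum) auto
    finally show ?thesis using ks by simp
  qed
  then have "k e \<in> {- int (16 * card I)..int (16 * card I)}" if "e \<in> I" for e
    using that by (simp add: abs_le_iff) (smt (verit))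
  then have "k \<in> lattice_net I" using ks by (auto simp: lattice_net_def PiE_def extensional_def k_def)
  moreover have "(\<Sum>e\<in>I. (net_point I k e)\<^sup>2) \<le> 1"
  proof -
    have "(\<Sum>e\<in>I. (net_point I k e)\<^sup>2) \<le> (\<Sum>e\<in>I. (x e)\<^sup>2)"
    proof (rule sum_mono)
      fix e assume "e \<in> I"
      then show "(net_point I k e)\<^sup>2 \<le> (x e)\<^sup>2" using tx[of e] s(1) by (simp add: pk power_divide divide_le_eq mult.commute)
    qed
    with x show ?thesis by simp
  qed
  moreover have "(\<Sum>e\<in>I. (x e - net_point I k e)\<^sup>2) \<le> 1 / 16"
  proof -
    have "(\<Sum>e\<in>I. (x e - net_point I k e)\<^sup>2) \<le> (\<Sum>e\<in>I. 1 / s\<^sup>2)"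
    proof (rule sum_mono)
      fix e assume e: "e \<in> I"
      have "x e - net_point I k e = (s * x e - tr (s * x e)) / s" using s by (simp add: pk[OF e] field_simps)
      then have "(x e - net_point I k e)\<^sup>2 = (s * x e - tr (s * x e))\<^sup>2 / s\<^sup>2" by (simp add: power_divide)
      also have "\<dots> \<le> 1 / s\<^sup>2" using tr(2)[of "s * x e"] by (intro divide_right_mono) (auto simp: abs_square_le_1)
      finally show "(x e - net_point I k e)\<^sup>2 \<le> 1 / s\<^sup>2" .
    qed
    also have "\<dots> = 1 / 16" using N by (simp add: s)
    finally show ?thesis .
  qed
  ultimately show ?thesis using that by blast
qed

text \<open>Let m be the supremum over pairs in the unit ball. Replacing x and y by net points costs
  at most m/4 each, because 4 times a rounding error is again in the ball. Hence m \<le> t + m/2,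
  and m is finite.\<close>

lemma bilinear_bound_from_net:
  fixes M :: "'a \<Rightarrow> 'a \<Rightarrow> real"
  assumes I: "finite I" "I \<noteq> {}"
    and net: "\<And>k l. k \<in> lattice_net I \<Longrightarrow> l \<in> lattice_net I \<Longrightarrow>
      (\<Sum>e\<in>I. (net_point I k e)\<^sup>2) \<le> 1 \<Longrightarrow> (\<Sum>e\<in>I. (net_point I l e)\<^sup>2) \<le> 1 \<Longrightarrow>
      \<bar>\<Sum>a\<in>I. \<Sum>b\<in>I. net_point I k a * M a b * net_point I l b\<bar> \<le> t"
  shows "\<bar>\<Sum>a\<in>I. \<Sum>b\<in>I. x a * M a b * y b\<bar> \<le> 2 * t * sqrt (\<Sum>a\<in>I. (x a)\<^sup>2) * sqrt (\<Sum>b\<in>I. (y b)\<^sup>2)"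
proof -
  define q where "q x y = (\<Sum>a\<in>I. \<Sum>b\<in>I. x a * M a b * y b)" for x y
  define nn where "nn x = (\<Sum>a\<in>I. (x a)\<^sup>2)" for x :: "'a \<Rightarrow> real"
  have nn0: "nn x \<ge> 0" for x by (simp add: nn_def sum_nonneg)
  have qs: "q (\<lambda>a. c * x a) y = c * q x y" "q x (\<lambda>a. c * y a) = c * q x y" for c x y
    by (simp_all add: q_def sum_distrib_left mult_ac)
  have qd: "q (\<lambda>a. x a - z a) y = q x y - q z y" "q x (\<lambda>a. y a - z a) = q x y - q x z" for x y z
    by (simp_all add: q_def left_diff_distrib right_diff_distrib sum_subtractf)
  have ns: "nn (\<lambda>a. c * x a) = c\<^sup>2 * nn x" for c x by (simp add: nn_def power_mult_distrib sum_distrib_left)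
  define V where "V = {\<bar>q x y\<bar> | x y. nn x \<le> 1 \<and> nn y \<le> 1}"
  have "\<bar>q x y\<bar> \<le> (\<Sum>a\<in>I. \<Sum>b\<in>I. \<bar>M a b\<bar>)" if "nn x \<le> 1" "nn y \<le> 1" for x y
  proof -
    have le1: "\<bar>z a\<bar> \<le> 1" if "nn z \<le> 1" "a \<in> I" for z a
    proof -
      have "(z a)\<^sup>2 \<le> nn z" unfolding nn_def using that I by (intro member_le_sum) auto
      then show ?thesis using that by (simp add: abs_square_le_1[symmetric])
    qed
    have "\<bar>q x y\<bar> \<le> (\<Sum>a\<in>I. \<Sum>b\<in>I. \<bar>x a * M a b * y b\<bar>)"
      unfolding q_def by (rule order_trans[OF sum_abs], intro sum_mono sum_abs)
    also have "\<dots> \<le> (\<Sum>a\<in>I. \<Sum>b\<in>I. \<bar>M a b\<bar>)"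
    proof (intro sum_mono)
      fix a b assume ab: "a \<in> I" "b \<in> I"
      have "\<bar>x a\<bar> * \<bar>M a b\<bar> * \<bar>y b\<bar> \<le> 1 * \<bar>M a b\<bar> * 1"
        using le1 that ab by (intro mult_mono) auto
      then show "\<bar>x a * M a b * y b\<bar> \<le> \<bar>M a b\<bar>" by (simp add: abs_mult)
    qed
    finally show ?thesis .
  qed
  then have bdd: "bdd_above V" unfolding V_def by (intro bdd_aboveI[of _ "\<Sum>a\<in>I. \<Sum>b\<in>I. \<bar>M a b\<bar>"]) auto
  define m where "m = Sup V"
  have m: "\<bar>q x y\<bar> \<le> m" if "nn x \<le> 1" "nn y \<le> 1" for x y
    unfolding m_def using that by (intro cSup_upper bdd) (auto simp: V_def)
  have "nn (\<lambda>_. 0) \<le> 1" by (simp add: nn_def)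
  then have ne: "V \<noteq> {}" by (auto simp: V_def)
  have step: "\<bar>q x y\<bar> \<le> t + m / 2" if x: "nn x \<le> 1" and y: "nn y \<le> 1" for x y
  proof -
    obtain k where k: "k \<in> lattice_net I" "nn (net_point I k) \<le> 1" "nn (\<lambda>a. x a - net_point I k a) \<le> 1 / 16"
      using lattice_net_rounding[OF I, of x] x unfolding nn_def by blast
    obtain l where l: "l \<in> lattice_net I" "nn (net_point I l) \<le> 1" "nn (\<lambda>a. y a - net_point I l a) \<le> 1 / 16"
      using lattice_net_rounding[OF I, of y] y unfolding nn_def by blast
    have "nn (\<lambda>a. 4 * (x a - net_point I k a)) \<le> 1" unfolding ns using k(3) by simp
    then have "\<bar>q (\<lambda>a. 4 * (x a - net_point I k a)) y\<bar> \<le> m" using y by (rule m)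
    then have 1: "\<bar>q (\<lambda>a. x a - net_point I k a) y\<bar> \<le> m / 4" unfolding qs abs_mult by simp
    have "nn (\<lambda>a. 4 * (y a - net_point I l a)) \<le> 1" unfolding ns using l(3) by simp
    with k(2) have "\<bar>q (net_point I k) (\<lambda>a. 4 * (y a - net_point I l a))\<bar> \<le> m" by (rule m)
    then have 2: "\<bar>q (net_point I k) (\<lambda>a. y a - net_point I l a)\<bar> \<le> m / 4" unfolding qs abs_mult by simp
    have 3: "\<bar>q (net_point I k) (net_point I l)\<bar> \<le> t" unfolding q_def by (rule net[OF k(1) l(1) k(2)[unfolded nn_def] l(2)[unfolded nn_def]])
    show ?thesis using 1 2 3 unfolding qd by linarith
  qed
  have "m \<le> t + m / 2" unfolding m_def by (rule cSup_least[OF ne]) (use step in \<open>auto simp: V_def m_def\<close>)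
  then have m2: "m \<le> 2 * t" by simp
  show ?thesis
  proof (cases "nn x = 0 \<or> nn y = 0")
    case True
    then have "(\<forall>a\<in>I. x a = 0) \<or> (\<forall>a\<in>I. y a = 0)" using I by (auto simp: nn_def sum_nonneg_eq_0_iff)
    then have "q x y = 0" by (auto simp: q_def)
    then show ?thesis using True unfolding q_def nn_def by auto
  next
    case False
    define r s where "r = sqrt (nn x)" and "s = sqrt (nn y)"
    have r: "r > 0" "r\<^sup>2 = nn x" and s: "s > 0" "s\<^sup>2 = nn y"
      using False nn0[of x] nn0[of y] by (auto simp: r_def s_def order_less_le)
    have "\<bar>q (\<lambda>a. (1 / r) * x a) (\<lambda>a. (1 / s) * y a)\<bar> \<le> m"
      using r s by (intro m) (simp_all only: ns, simp_all add: power_divide)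
    then have "\<bar>1 / r * (1 / s * q x y)\<bar> \<le> m" by (simp only: qs)
    then have "\<bar>q x y\<bar> / (r * s) \<le> m" using r s by (simp add: abs_mult)
    then have "\<bar>q x y\<bar> \<le> m * (r * s)" using r s by (simp add: divide_le_eq)
    also have "\<dots> \<le> 2 * t * (r * s)" using r s m2 by (intro mult_right_mono) auto
    finally show ?thesis by (simp add: q_def r_def s_def nn_def mult.assoc)
  qed
qed

section \<open>The random landscape\<close>

lemma finite_gidx: "finite (gidx n d)"
  by (rule finite_subset[of _ "{..<n} \<times> {..<n} \<times> {..<d} \<times> {..<d}"]) (auto simp: gidx_def)

text \<open>The coefficient of the variable g (i, j, a, b), for i < j, in x^T W y; there are two
  terms because symmetry places each variable in W twice.\<close>

definition bform_coeff :: "(nat \<Rightarrow> nat \<Rightarrow> real) \<Rightarrow> (nat \<Rightarrow> nat \<Rightarrow> real) \<Rightarrow> nat \<times> nat \<times> nat \<times> nat \<Rightarrow> real" where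
  "bform_coeff x y = (\<lambda>(i, j, a, b). x i a * y j b + x j b * y i a)"

lemma noise_bform:
  "(\<Sum>i<n. \<Sum>j<n. \<Sum>a<d. \<Sum>b<d. x i a * noiseW g i j a b * y j b) = (\<Sum>e\<in>gidx n d. bform_coeff x y e * g e)"
proof -
  let ?B = "{..<n} \<times> {..<n} \<times> {..<d} \<times> {..<d}"
  let ?f = "\<lambda>i j a b. if i < j then x i a * g (i, j, a, b) * y j b else 0"
  let ?h = "\<lambda>i j a b. if j < i then x i a * g (j, i, b, a) * y j b else 0"
  have "(\<Sum>e\<in>gidx n d. bform_coeff x y e * g e) = (\<Sum>e\<in>?B. if fst e < fst (snd e) then bform_coeff x y e * g e else 0)"
    by (rule sum.mono_neutral_cong_left) (auto simp: gidx_def)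
  also have "\<dots> = (\<Sum>i<n. \<Sum>j<n. \<Sum>a<d. \<Sum>b<d. if i < j then bform_coeff x y (i, j, a, b) * g (i, j, a, b) else 0)"
    by (simp only: sum.cartesian_product' fst_conv snd_conv)
  also have "\<dots> = (\<Sum>i<n. \<Sum>j<n. \<Sum>a<d. \<Sum>b<d. ?f i j a b + ?h j i b a)"
    by (intro sum.cong refl) (simp add: bform_coeff_def algebra_simps)
  also have "\<dots> = (\<Sum>i<n. \<Sum>j<n. \<Sum>a<d. \<Sum>b<d. ?f i j a b) + (\<Sum>i<n. \<Sum>j<n. \<Sum>a<d. \<Sum>b<d. ?h j i b a)"
    by (simp only: sum.distrib)
  also have "(\<Sum>i<n. \<Sum>j<n. \<Sum>a<d. \<Sum>b<d. ?h j i b a) = (\<Sum>j<n. \<Sum>i<n. \<Sum>a<d. \<Sum>b<d. ?h j i b a)"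
    by (rule sum.swap)
  also have "\<dots> = (\<Sum>j<n. \<Sum>i<n. \<Sum>b<d. \<Sum>a<d. ?h j i b a)"
    by (rule sum.cong[OF refl], rule sum.cong[OF refl], rule sum.swap)
  also have "(\<Sum>i<n. \<Sum>j<n. \<Sum>a<d. \<Sum>b<d. ?f i j a b) + \<dots> = (\<Sum>i<n. \<Sum>j<n. \<Sum>a<d. \<Sum>b<d. ?f i j a b + ?h i j a b)"
    by (simp only: sum.distrib)
  also have "\<dots> = (\<Sum>i<n. \<Sum>j<n. \<Sum>a<d. \<Sum>b<d. x i a * noiseW g i j a b * y j b)"
    by (intro sum.cong refl) (simp add: noiseW_def)
  finally show ?thesis ..
qed

lemma bform_coeff_norm:
  "(\<Sum>e\<in>gidx n d. (bform_coeff x y e)\<^sup>2) \<le> 2 * ((\<Sum>i<n. \<Sum>a<d. (x i a)\<^sup>2) * (\<Sum>i<n. \<Sum>a<d. (y i a)\<^sup>2))"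
proof -
  let ?x = "\<lambda>i a. (x i a)\<^sup>2" and ?y = "\<lambda>i a. (y i a)\<^sup>2"
  have sq: "(u + v)\<^sup>2 \<le> 2 * (u\<^sup>2 + v\<^sup>2)" for u v :: real
    using zero_le_power2[of "u - v"] by (simp add: power2_eq_square algebra_simps)
  have "(\<Sum>e\<in>gidx n d. (bform_coeff x y e)\<^sup>2) \<le> (\<Sum>e\<in>gidx n d. 2 * (bform_coeff ?x ?y e * 1))"
    using sq by (intro sum_mono) (simp add: bform_coeff_def power_mult_distrib[symmetric] split: prod.split)
  \<comment> \<open>Read backwards with all variables equal to 1, \<open>noise_bform\<close> turns
    this sum into a noise form in the squared vectors. The entries of that noise matrix are at most
    1, so the form is bounded by the product of the two squared norms.\<close>
  also have "\<dots> = 2 * (\<Sum>e\<in>gidx n d. bform_coeff ?x ?y e * (\<lambda>_. 1) e)" by (simp only: sum_distrib_left)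
  also have "\<dots> = 2 * (\<Sum>i<n. \<Sum>j<n. \<Sum>a<d. \<Sum>b<d. ?x i a * noiseW (\<lambda>_. 1) i j a b * ?y j b)"
    by (simp only: noise_bform)
  also have "\<dots> \<le> 2 * (\<Sum>i<n. \<Sum>j<n. \<Sum>a<d. \<Sum>b<d. ?x i a * 1 * ?y j b)"
    by (intro mult_left_mono sum_mono mult_right_mono) (auto simp: noiseW_def)
  also have "\<dots> = 2 * (\<Sum>i<n. \<Sum>a<d. \<Sum>j<n. \<Sum>b<d. ?x i a * ?y j b)"
    by (simp add: sum.swap[of _ "{..<n}" "{..<d}"])
  also have "\<dots> = 2 * ((\<Sum>i<n. \<Sum>a<d. ?x i a) * (\<Sum>i<n. \<Sum>a<d. ?y i a))"
  proof -
    define Y where "Y = (\<Sum>i<n. \<Sum>a<d. ?y i a)"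
    have "(\<Sum>j<n. \<Sum>b<d. ?x i a * ?y j b) = ?x i a * Y" for i a by (simp add: Y_def sum_distrib_left)
    then show ?thesis unfolding Y_def[symmetric] by (simp add: sum_distrib_right)
  qed
  finally show ?thesis .
qed

lemma noise_tail:
  assumes V: "(\<Sum>i<n. \<Sum>a<d. (x i a)\<^sup>2) * (\<Sum>i<n. \<Sum>a<d. (y i a)\<^sup>2) \<le> V" "V > 0" and t: "t \<ge> 0"
  defines "F \<equiv> {g \<in> space (gauss_space n d). t \<le> \<bar>\<Sum>i<n. \<Sum>j<n. \<Sum>a<d. \<Sum>b<d. x i a * noiseW g i j a b * y j b\<bar>}"
  shows "F \<in> sets (gauss_space n d)" and "measure (gauss_space n d) F \<le> 2 * exp (- t\<^sup>2 / (4 * V))"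
proof -
  have v: "(\<Sum>e\<in>gidx n d. (bform_coeff x y e)\<^sup>2) \<le> 2 * V" using bform_coeff_norm[of x y n d] V by linarith
  have "2 * V > 0" using V by simp
  note T = gaussian_tail_abs[OF finite_gidx v this t]
  show "F \<in> sets (gauss_space n d)" using T(1) by (simp only: F_def noise_bform gauss_space_def)
  show "measure (gauss_space n d) F \<le> 2 * exp (- t\<^sup>2 / (4 * V))"
    using T(2) by (simp add: F_def noise_bform gauss_space_def)
qed

lemma (in prob_space) prob_finite_union_le:
  assumes "finite K" "\<And>k. k \<in> K \<Longrightarrow> F k \<in> events" "\<And>k. k \<in> K \<Longrightarrow> prob (F k) \<le> r" "real (card K) \<le> c" "r \<ge> 0"
  shows "prob (\<Union>k\<in>K. F k) \<le> c * r"
proof -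
  have "prob (\<Union>k\<in>K. F k) \<le> (\<Sum>k\<in>K. prob (F k))"
    using assms by (intro finite_measure_subadditive_finite) auto
  also have "\<dots> \<le> real (card K) * r" using assms(3) by (intro sum_bounded_above) auto
  also have "\<dots> \<le> c * r" using assms by (intro mult_right_mono) auto
  finally show ?thesis .
qed

lemma prob_space_gauss: "prob_space (gauss_space n d)"
  unfolding gauss_space_def by (intro prob_space_PiM prob_space_std_normal)

abbreviation noise_form :: "nat \<Rightarrow> nat \<Rightarrow> (nat \<times> nat \<times> nat \<times> nat \<Rightarrow> real) \<Rightarrow> (nat \<Rightarrow> nat \<Rightarrow> real) \<Rightarrow> (nat \<Rightarrow> nat \<Rightarrow> real) \<Rightarrow> real" where
  "noise_form n d g x y \<equiv> (\<Sum>i<n. \<Sum>j<n. \<Sum>a<d. \<Sum>b<d. x i a * noiseW g i j a b * y j b)"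

lemma noise_norm_whp:
  assumes n: "n \<ge> 1" and d: "d \<ge> 1"
  shows "\<exists>F \<in> sets (gauss_space n d). measure (gauss_space n d) F \<le> 2 * exp (- real n) \<and>
    (\<forall>g \<in> space (gauss_space n d) - F. \<forall>x y. \<bar>noise_form n d g x y\<bar> \<le>
       26 * sqrt (real n * d) * sqrt (\<Sum>i<n. \<Sum>a<d. (x i a)\<^sup>2) * sqrt (\<Sum>i<n. \<Sum>a<d. (y i a)\<^sup>2))"
proof -
  interpret prob_space "gauss_space n d" by (rule prob_space_gauss)
  let ?I = "{..<n} \<times> {..<d}"
  let ?p = "\<lambda>k i a. net_point ?I k (i, a)"
  define K where "K = {k \<in> lattice_net ?I. (\<Sum>e\<in>?I. (net_point ?I k e)\<^sup>2) \<le> 1}"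
  \<comment> \<open>There are at most 2^(36 nd) \<le> exp (36 nd) pairs of net points, and t^2/4 =
    42.25 nd outweighs this by more than nd >= n. Passing from net to ball doubles 13 to 26.\<close>
  define t where "t = 13 * sqrt (real n * d)"
  define F where "F kl = {g \<in> space (gauss_space n d). t \<le> \<bar>noise_form n d g (?p (fst kl)) (?p (snd kl))\<bar>}" for kl
  have nd: "real n * d \<ge> n" "real n * d > 0" using n d by (simp_all add: mult_le_cancel_left1)
  have t: "t \<ge> 0" "t\<^sup>2 = 169 * (real n * d)" by (simp_all add: t_def power_mult_distrib)
  have pn: "(\<Sum>i<n. \<Sum>a<d. (?p k i a)\<^sup>2) \<le> 1" if "k \<in> K" for k
    using that by (simp add: K_def sum.cartesian_product')
  have prod1: "(\<Sum>i<n. \<Sum>a<d. (?p (fst kl) i a)\<^sup>2) * (\<Sum>i<n. \<Sum>a<d. (?p (snd kl) i a)\<^sup>2) \<le> 1" if "kl \<in> K \<times> K" for kl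
    using pn[of "fst kl"] pn[of "snd kl"] that by (intro mult_le_one) (auto intro!: sum_nonneg)
  have "(0::real) < 1" by simp
  note T = noise_tail[OF prod1 this t(1), folded F_def]
  have fK: "finite K" unfolding K_def by (intro finite_subset[OF _ finite_lattice_net[of ?I]]) auto
  have cK: "real (card (K \<times> K)) \<le> exp (36 * (real n * d))"
  proof -
    have "card K \<le> card (lattice_net ?I)" unfolding K_def by (intro card_mono finite_lattice_net) auto
    then have "real (card K) \<le> 2 ^ (18 * (n * d))" using card_lattice_net[of ?I] by simp
    then have "real (card K) * real (card K) \<le> 2 ^ (18 * (n * d)) * 2 ^ (18 * (n * d))" by (intro mult_mono) auto
    also have "\<dots> = (2::real) ^ (36 * (n * d))" by (simp add: power_add[symmetric])
    also have "\<dots> \<le> exp 1 ^ (36 * (n * d))" using exp_ge_add_one_self[of 1] by (intro power_mono) auto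
    also have "\<dots> = exp (36 * (real n * d))" by (simp add: exp_of_nat_mult[symmetric])
    finally show ?thesis by (simp add: card_cartesian_product)
  qed
  have "prob (\<Union>kl\<in>K \<times> K. F kl) \<le> exp (36 * (real n * d)) * (2 * exp (- t\<^sup>2 / (4 * 1)))"
    by (rule prob_finite_union_le) (use fK T cK in auto)
  also have "\<dots> = 2 * exp (36 * (real n * d) - 169 / 4 * (real n * d))" by (simp add: t exp_add[symmetric])
  also have "\<dots> \<le> 2 * exp (- real n)"
  proof -
    have "36 * (real n * d) - 169 / 4 * (real n * d) \<le> - real n" using nd by linarith
    then show ?thesis by simp
  qed
  finally have "prob (\<Union>kl\<in>K \<times> K. F kl) \<le> 2 * exp (- real n)" .
  moreover have "(\<Union>kl\<in>K \<times> K. F kl) \<in> sets (gauss_space n d)" using fK T(1) by (intro sets.finite_UN) auto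
  moreover have "\<bar>noise_form n d g x y\<bar> \<le>
       26 * sqrt (real n * d) * sqrt (\<Sum>i<n. \<Sum>a<d. (x i a)\<^sup>2) * sqrt (\<Sum>i<n. \<Sum>a<d. (y i a)\<^sup>2)"
    if g: "g \<in> space (gauss_space n d) - (\<Union>kl\<in>K \<times> K. F kl)" for g x y
  proof -
    define M where "M e f = noiseW g (fst e) (fst f) (snd e) (snd f)" for e f
    have conv: "(\<Sum>e\<in>?I. \<Sum>f\<in>?I. u e * M e f * v f) = noise_form n d g (\<lambda>i a. u (i, a)) (\<lambda>i a. v (i, a))" for u v
    proof -
      have "(\<Sum>e\<in>?I. \<Sum>f\<in>?I. u e * M e f * v f) = (\<Sum>i<n. \<Sum>a<d. \<Sum>j<n. \<Sum>b<d. u (i, a) * noiseW g i j a b * v (j, b))"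
        by (simp add: M_def sum.cartesian_product')
      also have "\<dots> = noise_form n d g (\<lambda>i a. u (i, a)) (\<lambda>i a. v (i, a))"
        by (rule sum.cong[OF refl], rule sum.swap)
      finally show ?thesis .
    qed
    have "\<bar>\<Sum>e\<in>?I. \<Sum>f\<in>?I. u e * M e f * v f\<bar> \<le> 2 * t * sqrt (\<Sum>e\<in>?I. (u e)\<^sup>2) * sqrt (\<Sum>e\<in>?I. (v e)\<^sup>2)" for u v
    proof (rule bilinear_bound_from_net)
      show "?I \<noteq> {}" using n d by (auto simp: lessThan_empty_iff)
      fix k l assume "k \<in> lattice_net ?I" "l \<in> lattice_net ?I" "(\<Sum>e\<in>?I. (net_point ?I k e)\<^sup>2) \<le> 1" "(\<Sum>e\<in>?I. (net_point ?I l e)\<^sup>2) \<le> 1"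
      then have "(k, l) \<in> K \<times> K" by (simp add: K_def)
      then have "g \<notin> F (k, l)" using g by blast
      then show "\<bar>\<Sum>e\<in>?I. \<Sum>f\<in>?I. net_point ?I k e * M e f * net_point ?I l f\<bar> \<le> t"
        using g unfolding conv F_def by simp
    qed simp
    from this[of "\<lambda>(i, a). x i a" "\<lambda>(i, a). y i a"] show ?thesis
      unfolding conv by (simp add: sum.cartesian_product' t_def)
  qed
  ultimately show ?thesis by blast
qed

text \<open>Only d-dimensional nets are needed here, one pair for each of the n rows. The power
  n^(3/4), above the typical n^(1/2), produces a tail exponent of order sqrt(n) d, which absorbs the
  union over rows even for bounded d.\<close>

lemma noise_row_sums_whp:
  assumes n: "n \<ge> 1" and d: "d \<ge> 1"
  shows "\<exists>F \<in> sets (gauss_space n d). measure (gauss_space n d) F \<le> 2 * real n * exp (- sqrt (real n)) \<and>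
    (\<forall>g \<in> space (gauss_space n d) - F. \<forall>i<n. \<forall>u v. \<bar>\<Sum>j<n. \<Sum>a<d. \<Sum>b<d. u a * noiseW g i j a b * v b\<bar> \<le>
       26 * (real n powr (3/4) * sqrt d) * sqrt (\<Sum>a<d. (u a)\<^sup>2) * sqrt (\<Sum>a<d. (v a)\<^sup>2))"
proof -
  interpret prob_space "gauss_space n d" by (rule prob_space_gauss)
  let ?I = "{..<d}"
  define K where "K = {k \<in> lattice_net ?I. (\<Sum>e\<in>?I. (net_point ?I k e)\<^sup>2) \<le> 1}"
  \<comment> \<open>The variance bound below is n, so the tail exponent is t^2/(4n) = 42.25 sqrt(n)
    d, enough to beat the net exponent 36 d and leave sqrt(n).\<close>
  define t where "t = 13 * (real n powr (3/4) * sqrt d)"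
  \<comment> \<open>Places u in block i; paired with the vector repeating v in every block, it
    expresses the i-th block row sum as a noise form, so that \<open>noise_tail\<close>
    applies.\<close>
  define X where "X i u j a = (if j = i then u a else 0)" for i :: nat and u :: "nat \<Rightarrow> real" and j a :: nat
  have form: "noise_form n d g (X i u) (\<lambda>_. v) = (\<Sum>a<d. \<Sum>b<d. u a * (\<Sum>j<n. noiseW g i j a b) * v b)" if "i < n" for g i u v
  proof -
    have "(\<Sum>j<n. \<Sum>a<d. \<Sum>b<d. X i u l a * noiseW g l j a b * v b) =
      (if l = i then (\<Sum>j<n. \<Sum>a<d. \<Sum>b<d. u a * noiseW g i j a b * v b) else 0)" for l
      by (simp add: X_def)
    then have "noise_form n d g (X i u) (\<lambda>_. v) = (\<Sum>j<n. \<Sum>a<d. \<Sum>b<d. u a * noiseW g i j a b * v b)"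
      using that by (simp add: sum.delta)
    also have "\<dots> = (\<Sum>a<d. \<Sum>b<d. \<Sum>j<n. u a * noiseW g i j a b * v b)"
      by (simp only: sum.swap[of _ "{..<n}"])
    finally show ?thesis by (simp add: sum_distrib_left sum_distrib_right)
  qed
  define F where "F z = {g \<in> space (gauss_space n d).
      t \<le> \<bar>noise_form n d g (X (fst z) (net_point ?I (fst (snd z)))) (\<lambda>_. net_point ?I (snd (snd z)))\<bar>}" for z
  have n0: "real n > 0" using n by simp
  have t: "t \<ge> 0" "t\<^sup>2 / (4 * n) = 169 / 4 * (sqrt n * d)"
  proof -
    have "(real n powr (3/4))\<^sup>2 = real n * sqrt n"
    proof -
      have "(real n powr (3/4))\<^sup>2 = real n powr (1 + 1/2)" by (simp add: power2_eq_square powr_add[symmetric])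
      also have "\<dots> = real n * sqrt n" using n0 by (subst powr_add) (simp add: powr_half_sqrt)
      finally show ?thesis .
    qed
    then have "t\<^sup>2 = 169 * (real n * sqrt n * d)" by (simp add: t_def power_mult_distrib)
    then show "t\<^sup>2 / (4 * n) = 169 / 4 * (sqrt n * d)" using n0 by simp
  qed (simp add: t_def)
  have prod1: "(\<Sum>j<n. \<Sum>a<d. (X (fst z) (net_point ?I (fst (snd z))) j a)\<^sup>2) * (\<Sum>j<n. \<Sum>a<d. (net_point ?I (snd (snd z)) a)\<^sup>2) \<le> n"
    if z: "z \<in> {..<n} \<times> K \<times> K" for z
  proof -
    have "(\<Sum>a<d. (X i u j a)\<^sup>2) = (if j = i then (\<Sum>a<d. (u a)\<^sup>2) else 0)" for i u j by (simp add: X_def)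
    then have "(\<Sum>j<n. \<Sum>a<d. (X (fst z) (net_point ?I (fst (snd z))) j a)\<^sup>2) = (\<Sum>a<d. (net_point ?I (fst (snd z)) a)\<^sup>2)"
      using z by (auto simp: sum.delta)
    moreover have "\<dots> \<le> 1" "(\<Sum>a<d. (net_point ?I (snd (snd z)) a)\<^sup>2) \<le> 1" using z by (auto simp: K_def)
    ultimately have "(\<Sum>j<n. \<Sum>a<d. (X (fst z) (net_point ?I (fst (snd z))) j a)\<^sup>2) * (real n * (\<Sum>a<d. (net_point ?I (snd (snd z)) a)\<^sup>2)) \<le> 1 * (real n * 1)"
      by (intro mult_mono mult_left_mono) (auto intro!: sum_nonneg mult_nonneg_nonneg)
    then show ?thesis by simp
  qed
  note T = noise_tail[OF prod1 n0 t(1), folded F_def]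
  have fK: "finite K" unfolding K_def by (intro finite_subset[OF _ finite_lattice_net[of ?I]]) auto
  have cK: "real (card ({..<n} \<times> K \<times> K)) \<le> n * exp (36 * real d)"
  proof -
    have "card K \<le> card (lattice_net ?I)" unfolding K_def by (intro card_mono finite_lattice_net) auto
    then have "real (card K) \<le> 2 ^ (18 * d)" using card_lattice_net[of ?I] by simp
    then have "real (card K) * real (card K) \<le> 2 ^ (18 * d) * 2 ^ (18 * d)" by (intro mult_mono) auto
    also have "\<dots> = (2::real) ^ (36 * d)" by (simp add: power_add[symmetric])
    also have "\<dots> \<le> exp 1 ^ (36 * d)" using exp_ge_add_one_self[of 1] by (intro power_mono) auto
    also have "\<dots> = exp (36 * real d)" by (simp add: exp_of_nat_mult[symmetric])
    finally show ?thesis by (simp add: card_cartesian_product mult_left_mono)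
  qed
  have "prob (\<Union>z\<in>{..<n} \<times> K \<times> K. F z) \<le> (n * exp (36 * real d)) * (2 * exp (- t\<^sup>2 / (4 * n)))"
    by (rule prob_finite_union_le) (use fK T cK in auto)
  also have "\<dots> = 2 * real n * exp (36 * real d - t\<^sup>2 / (4 * n))" by (simp add: exp_add[symmetric])
  also have "\<dots> \<le> 2 * real n * exp (- sqrt n)"
  proof -
    have s: "sqrt n \<ge> 1" "real d \<ge> 1" using n d by auto
    then have "sqrt n * 1 \<le> sqrt n * d" "1 * real d \<le> sqrt n * d" by (intro mult_left_mono mult_right_mono; simp)+
    then have "36 * real d - t\<^sup>2 / (4 * n) \<le> - sqrt n" unfolding t(2) by linarith
    then show ?thesis by (intro mult_left_mono) auto
  qed
  finally have "prob (\<Union>z\<in>{..<n} \<times> K \<times> K. F z) \<le> 2 * real n * exp (- sqrt n)" .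
  moreover have "(\<Union>z\<in>{..<n} \<times> K \<times> K. F z) \<in> sets (gauss_space n d)" using fK T(1) by (intro sets.finite_UN) auto
  moreover have "\<bar>\<Sum>j<n. \<Sum>a<d. \<Sum>b<d. u a * noiseW g i j a b * v b\<bar> \<le>
       26 * (real n powr (3/4) * sqrt d) * sqrt (\<Sum>a<d. (u a)\<^sup>2) * sqrt (\<Sum>a<d. (v a)\<^sup>2)"
    if g: "g \<in> space (gauss_space n d) - (\<Union>z\<in>{..<n} \<times> K \<times> K. F z)" and i: "i < n" for g i u v
  proof -
    have "\<bar>\<Sum>a<d. \<Sum>b<d. u a * (\<Sum>j<n. noiseW g i j a b) * v b\<bar> \<le> 2 * t * sqrt (\<Sum>a<d. (u a)\<^sup>2) * sqrt (\<Sum>a<d. (v a)\<^sup>2)"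
    proof (rule bilinear_bound_from_net)
      show "?I \<noteq> {}" using d by (auto simp: lessThan_empty_iff)
      fix k l assume "k \<in> lattice_net ?I" "l \<in> lattice_net ?I" "(\<Sum>e\<in>?I. (net_point ?I k e)\<^sup>2) \<le> 1" "(\<Sum>e\<in>?I. (net_point ?I l e)\<^sup>2) \<le> 1"
      then have "(i, k, l) \<in> {..<n} \<times> K \<times> K" using i by (simp add: K_def)
      then have "g \<notin> F (i, k, l)" using g by blast
      then show "\<bar>\<Sum>a<d. \<Sum>b<d. net_point ?I k a * (\<Sum>j<n. noiseW g i j a b) * net_point ?I l b\<bar> \<le> t"
        using g unfolding form[OF i, symmetric] F_def by simp
    qed simp
    moreover have "(\<Sum>j<n. \<Sum>a<d. \<Sum>b<d. u a * noiseW g i j a b * v b) = (\<Sum>a<d. \<Sum>b<d. u a * (\<Sum>j<n. noiseW g i j a b) * v b)"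
      by (simp only: sum.swap[of _ "{..<n}"] sum_distrib_left sum_distrib_right)
    ultimately show ?thesis by (simp add: t_def)
  qed
  ultimately show ?thesis by blast
qed

text \<open>The constant 416 is 16 * 26, the locale's 16 times the 26 of the noise bounds. The
  operator-norm condition becomes (416 \<sigma>)^4 d^3 \<le> n, the fourth power of
  \<open>small\<close>; the row-sum condition then holds with a spare factor d^(-1/4).\<close>

lemma sync_noise:
  fixes \<sigma> :: real
  assumes n: "n \<ge> 1" and d: "d \<ge> 1" and p: "p \<ge> 2 * d + 1" and s: "\<sigma> > 0"
    and small: "416 * \<sigma> \<le> real n powr (1/4) / real d powr (3/4)"
    and W: "\<And>x y. \<bar>noise_form n d g x y\<bar> \<le>
       26 * sqrt (real n * d) * sqrt (\<Sum>i<n. \<Sum>a<d. (x i a)\<^sup>2) * sqrt (\<Sum>i<n. \<Sum>a<d. (y i a)\<^sup>2)"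
    and R: "\<And>i u v. i < n \<Longrightarrow> \<bar>\<Sum>j<n. \<Sum>a<d. \<Sum>b<d. u a * noiseW g i j a b * v b\<bar> \<le>
       26 * (real n powr (3/4) * sqrt d) * sqrt (\<Sum>a<d. (u a)\<^sup>2) * sqrt (\<Sum>a<d. (v a)\<^sup>2)"
  shows "sync n d p (\<lambda>i j a b. \<sigma> * noiseW g i j a b) (\<sigma> * (26 * sqrt (real n * d))) (\<sigma> * (26 * (real n powr (3/4) * sqrt d)))"
proof
  have n0: "real n > 0" and d0: "real d > 0" using n d by auto
  show "bsym n d (\<lambda>i j a b. \<sigma> * noiseW g i j a b)" by (simp add: bsym_def noiseW_def)
  show "\<sigma> * noiseW g i i a b = 0" for i a b by (simp add: noiseW_def)
  show "\<bar>\<Sum>i<n. \<Sum>j<n. \<Sum>a<d. \<Sum>b<d. x i a * (\<sigma> * noiseW g i j a b) * y j b\<bar> \<le>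
     \<sigma> * (26 * sqrt (real n * d)) * sqrt (\<Sum>i<n. \<Sum>a<d. (x i a)\<^sup>2) * sqrt (\<Sum>i<n. \<Sum>a<d. (y i a)\<^sup>2)" for x y
  proof -
    have "(\<Sum>i<n. \<Sum>j<n. \<Sum>a<d. \<Sum>b<d. x i a * (\<sigma> * noiseW g i j a b) * y j b) = \<sigma> * noise_form n d g x y"
      by (simp add: sum_distrib_left mult_ac)
    then show ?thesis using mult_left_mono[OF W[of x y], of \<sigma>] s by (simp add: abs_mult mult_ac)
  qed
  show "\<bar>\<Sum>j<n. \<Sum>a<d. \<Sum>b<d. u a * (\<sigma> * noiseW g i j a b) * v b\<bar> \<le>
     \<sigma> * (26 * (real n powr (3/4) * sqrt d)) * sqrt (\<Sum>a<d. (u a)\<^sup>2) * sqrt (\<Sum>a<d. (v a)\<^sup>2)" if "i < n" for i u v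
  proof -
    have "(\<Sum>j<n. \<Sum>a<d. \<Sum>b<d. u a * (\<sigma> * noiseW g i j a b) * v b) = \<sigma> * (\<Sum>j<n. \<Sum>a<d. \<Sum>b<d. u a * noiseW g i j a b * v b)"
      by (simp add: sum_distrib_left mult_ac)
    then show ?thesis using mult_left_mono[OF R[OF that, of u v], of \<sigma>] s by (simp add: abs_mult mult_ac)
  qed
  show "65536 * (\<sigma> * (26 * sqrt (real n * d))) ^ 4 * d \<le> real n ^ 3"
  proof -
    have "(416 * \<sigma>) ^ 4 \<le> (real n powr (1/4) / real d powr (3/4)) ^ 4" using small s by (intro power_mono) auto
    also have "\<dots> = n / real d ^ 3"
    proof -
      have "(real n powr (1/4)) ^ 4 = n" using n0 by (simp add: powr_powr powr_numeral[symmetric] del: powr_numeral)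
      moreover have "(real d powr (3/4)) ^ 4 = real d ^ 3" using d0 by (simp add: powr_powr powr_numeral[symmetric] del: powr_numeral)
      ultimately show ?thesis by (simp add: power_divide)
    qed
    finally have 1: "(416 * \<sigma>) ^ 4 \<le> n / real d ^ 3" .
    have "(sqrt (real n * d)) ^ 4 = (real n * d)\<^sup>2"
    proof -
      have "z ^ 4 = (z\<^sup>2)\<^sup>2" for z :: real by (simp add: power4_eq_xxxx power2_eq_square)
      from this[of "sqrt (real n * d)"] show ?thesis by (simp only: real_sqrt_pow2 of_nat_0_le_iff mult_nonneg_nonneg)
    qed
    then have "65536 * (\<sigma> * (26 * sqrt (real n * d))) ^ 4 * d = (416 * \<sigma>) ^ 4 * ((real n)\<^sup>2 * real d ^ 3)"
      by (simp add: power_mult_distrib power3_eq_cube power2_eq_square)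
    also have "\<dots> \<le> n / real d ^ 3 * ((real n)\<^sup>2 * real d ^ 3)" using 1 by (rule mult_right_mono) simp
    also have "\<dots> = real n ^ 3" using d0 by (simp add: power3_eq_cube power2_eq_square)
    finally show ?thesis .
  qed
  show "16 * (\<sigma> * (26 * (real n powr (3/4) * sqrt d))) \<le> n"
  proof -
    have "16 * (\<sigma> * (26 * (real n powr (3/4) * sqrt d))) = (416 * \<sigma>) * (real n powr (3/4) * real d powr (1/2))"
      using d0 by (simp add: powr_half_sqrt)
    also have "\<dots> \<le> (real n powr (1/4) / real d powr (3/4)) * (real n powr (3/4) * real d powr (1/2))"
      using small by (rule mult_right_mono) simp
    also have "\<dots> = (real n powr (1/4) * real n powr (3/4)) * (real d powr (1/2) / real d powr (3/4))" by simp
    also have "\<dots> = n * real d powr (1/2 - 3/4)" using n0 by (simp add: powr_add[symmetric] powr_diff[symmetric])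
    also have "\<dots> \<le> n * real d powr 0" using d by (intro mult_left_mono powr_mono) auto
    also have "\<dots> = n" using d0 by simp
    finally show ?thesis .
  qed
qed (use assms in auto)

lemma failure_probability_tendsto_0:
  "(\<lambda>n. 2 * exp (- real n) + 2 * real n * exp (- sqrt (real n))) \<longlonglongrightarrow> 0"
  by real_asymp

theorem theorem4:
  shows "\<exists>C0 :: real. C0 > 0 \<and>
    (\<exists>\<epsilon> :: nat \<Rightarrow> real. \<epsilon> \<longlonglongrightarrow> 0 \<and>
      (\<forall>n d p :: nat. \<forall>\<sigma> :: real.
         n \<ge> 1 \<longrightarrow> d \<ge> 1 \<longrightarrow> p \<ge> 2 * d + 1 \<longrightarrow> \<sigma> > 0 \<longrightarrow>
         \<sigma> \<le> C0 * sqrt ((real p - 2 * real d) / (real p + real d))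
                 * (real n powr (1/4) / real d powr (3/4)) \<longrightarrow>
         (\<exists>E \<in> sets (gauss_space n d).
             E \<subseteq> {g. benign n d p (dataA \<sigma> g)} \<and>
             measure (gauss_space n d) E \<ge> 1 - \<epsilon> n)))"
proof (intro exI[of _ "1 / 416 :: real"] exI[of _ "\<lambda>n. 2 * exp (- real n) + 2 * real n * exp (- sqrt (real n))"] conjI allI impI)
  show "(\<lambda>n. 2 * exp (- real n) + 2 * real n * exp (- sqrt (real n))) \<longlonglongrightarrow> 0"
    by (rule failure_probability_tendsto_0)
  show "(0 :: real) < 1 / 416" by simp
  fix n d p :: nat and \<sigma> :: real
  assume n: "n \<ge> 1" and d: "d \<ge> 1" and p: "p \<ge> 2 * d + 1" and s: "\<sigma> > 0"
    and small: "\<sigma> \<le> 1 / 416 * sqrt ((real p - 2 * real d) / (real p + real d)) * (real n powr (1/4) / real d powr (3/4))"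
  interpret prob_space "gauss_space n d" by (rule prob_space_gauss)
  \<comment> \<open>The factor is at most 1, so the hypothesis with constant 1/416 implies the bound
    on \<sigma> in \<open>sync_noise\<close>.\<close>
  have "sqrt ((real p - 2 * real d) / (real p + real d)) \<le> 1" using p by (simp add: divide_le_eq_1)
  then have "1 / 416 * sqrt ((real p - 2 * real d) / (real p + real d)) * (real n powr (1/4) / real d powr (3/4))
      \<le> 1 / 416 * 1 * (real n powr (1/4) / real d powr (3/4))"
    by (intro mult_right_mono mult_left_mono) auto
  with small have small': "416 * \<sigma> \<le> real n powr (1/4) / real d powr (3/4)" by simp
  obtain F where F: "F \<in> events" "prob F \<le> 2 * exp (- real n)"
    "\<And>g x y. g \<in> space (gauss_space n d) - F \<Longrightarrow> \<bar>noise_form n d g x y\<bar> \<le>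
       26 * sqrt (real n * d) * sqrt (\<Sum>i<n. \<Sum>a<d. (x i a)\<^sup>2) * sqrt (\<Sum>i<n. \<Sum>a<d. (y i a)\<^sup>2)"
    using noise_norm_whp[OF n d] by blast
  obtain G where G: "G \<in> events" "prob G \<le> 2 * real n * exp (- sqrt (real n))"
    "\<And>g i u v. g \<in> space (gauss_space n d) - G \<Longrightarrow> i < n \<Longrightarrow> \<bar>\<Sum>j<n. \<Sum>a<d. \<Sum>b<d. u a * noiseW g i j a b * v b\<bar> \<le>
       26 * (real n powr (3/4) * sqrt d) * sqrt (\<Sum>a<d. (u a)\<^sup>2) * sqrt (\<Sum>a<d. (v a)\<^sup>2)"
    using noise_row_sums_whp[OF n d] by blast
  show "\<exists>E \<in> sets (gauss_space n d). E \<subseteq> {g. benign n d p (dataA \<sigma> g)} \<and>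
      prob E \<ge> 1 - (2 * exp (- real n) + 2 * real n * exp (- sqrt (real n)))"
  proof (intro bexI conjI subsetI CollectI)
    \<comment> \<open>The event is the complement of the two exceptional sets, measurable by
      construction and contained in the benign set. The failure bound depends on n alone, hence is
      uniform in d, p and \<sigma>.\<close>
    show "space (gauss_space n d) - (F \<union> G) \<in> events" using F(1) G(1) by auto
    have "prob (F \<union> G) \<le> prob F + prob G" by (rule measure_Un_le[OF F(1) G(1)])
    then show "1 - (2 * exp (- real n) + 2 * real n * exp (- sqrt (real n))) \<le> prob (space (gauss_space n d) - (F \<union> G))"
      using F G by (subst prob_compl) auto
    fix g assume g: "g \<in> space (gauss_space n d) - (F \<union> G)"
    interpret sync n d p "\<lambda>i j a b. \<sigma> * noiseW g i j a b" "\<sigma> * (26 * sqrt (real n * d))" "\<sigma> * (26 * (real n powr (3/4) * sqrt d))"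
      by (rule sync_noise[OF n d p s small' F(3) G(3)]) (use g in auto)
    have "A = dataA \<sigma> g" by (intro ext) (simp add: A_def dataA_def)
    with benign show "benign n d p (dataA \<sigma> g)" by simp
  qed
qed

end
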